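(* Let $\Sigma=\{0,1\}^{\mathbb Z}$ with the left shift $f((x_n)_{n\in\mathbb Z})=(x_{n+1})_{n\in\mathbb Z}$ and the metric $d(x,y)=2^{-N(x,y)}$, where $N(x,y)=\max\{N\ge 0: x_n=y_n \text{ for all } |n|<N\}$. Fix $\alpha>0$ and let $C^{\alpha}(\Sigma,SL(2,\mathbb R))$ be the space of $\alpha$-H\"older continuous maps $A:\Sigma\to SL(2,\mathbb R)$ with the norm \[\|A\|_{\alpha}=\sup_{x\in\Sigma}\|A(x)\|+\sup_{x\neq y}\frac{\|A(x)-A(y)\|}{d(x,y)^{\alpha}}.\] For $\sigma>1$ let $A_\sigma(x)=\mathrm{diag}(\sigma^{-1},\sigma)$ if $x_0=0$ and $A_\sigma(x)=\mathrm{diag}(\sigma,\sigma^{-1})$ if $x_0=1$. For $p\in(1/2,1)$ let $\mu_p$ be the Bernoulli product measure $\nu_p^{\mathbb Z}$ on $\Sigma$, where $\nu_p(\{0\})=1-p$, $\nu_p(\{1\})=p$. Let $p\in(1/2,1)$ and $\sigma>1$ satisfy $\sigma^{4p-2}\ge 2^{\alpha}$. Then for every open neighborhood $\mathcal U\subset C^{\alpha}(\Sigma,SL(2,\mathbb R))$ of $A_\sigma$ and every $\kappa\in(0,(2p-1)\log\sigma]$ there is a locally constant cocycle $L\in\mathcal U$ with $\lambda_+(L,\mu_p)=\kappa$. In particular, $A_\sigma$ is a discontinuity point of the map $A\mapsto\lambda_+(A,\mu_p)$ on $C^{\alpha}(\Sigma,SL(2,\mathbb R))$.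
   Context: $\|\cdot\|$ denotes the Euclidean norm on $\mathbb R^2$ and the associated operator norm. For a cocycle $A:\Sigma\to SL(2,\mathbb R)$ over $f$, $A^n(x)=A(f^{n-1}(x))\cdots A(x)$, and the upper Lyapunov exponent with respect to an $f$-invariant probability measure $\mu$ is $\lambda_+(A,\mu)=\inf_{n\ge1}\frac1n\int_\Sigma\log\|A^n\|\,d\mu$. A cocycle is locally constant if it is constant on cylinders of some fixed length. Note $\lambda_+(A_\sigma,\mu_p)=(2p-1)\log\sigma$. *)

theory Defs
  imports "HOL-Probability.Probability"
begin

text \<open>The full two-sided shift: points of Sigma are maps int => bool,
  where True encodes the symbol 1 and False the symbol 0.\<close>
type_synonym sigma = "int \<Rightarrow> bool"

type_synonym mat2 = "real^2^2"

definition shift :: "sigma \<Rightarrow> sigma" where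
  "shift x = (\<lambda>n. x (n + 1))"

definition sdist :: "sigma \<Rightarrow> sigma \<Rightarrow> real" where
  "sdist x y = (if x = y then 0
     else 2 powr (- real (GREATEST N::nat. \<forall>n. \<bar>n\<bar> < int N \<longrightarrow> x n = y n)))"

definition opnorm :: "mat2 \<Rightarrow> real" where
  "opnorm M = onorm (\<lambda>v. M *v v)"

definition holder_norm :: "real \<Rightarrow> (sigma \<Rightarrow> mat2) \<Rightarrow> real" where
  "holder_norm \<alpha> A = (SUP x. opnorm (A x))
     + (SUP xy \<in> {(x, y). x \<noteq> y}. opnorm (A (fst xy) - A (snd xy)) / sdist (fst xy) (snd xy) powr \<alpha>)"

definition holder :: "real \<Rightarrow> (sigma \<Rightarrow> mat2) \<Rightarrow> bool" where
  "holder \<alpha> A \<longleftrightarrow> bdd_above (range (\<lambda>x. opnorm (A x)))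
     \<and> (\<exists>C. \<forall>x y. opnorm (A x - A y) \<le> C * sdist x y powr \<alpha>)"

definition C_alpha :: "real \<Rightarrow> (sigma \<Rightarrow> mat2) set" where
  "C_alpha \<alpha> = {A. (\<forall>x. det (A x) = 1) \<and> holder \<alpha> A}"

definition C_alpha_open :: "real \<Rightarrow> (sigma \<Rightarrow> mat2) set \<Rightarrow> bool" where
  "C_alpha_open \<alpha> U \<longleftrightarrow> U \<subseteq> C_alpha \<alpha> \<and>
     (\<forall>A\<in>U. \<exists>\<epsilon>>0. \<forall>B\<in>C_alpha \<alpha>. holder_norm \<alpha> (\<lambda>x. B x - A x) < \<epsilon> \<longrightarrow> B \<in> U)"

definition locally_constant :: "(sigma \<Rightarrow> mat2) \<Rightarrow> bool" where
  "locally_constant L \<longleftrightarrow> (\<exists>k::nat. \<forall>x y. (\<forall>n. \<bar>n\<bar> \<le> int k \<longrightarrow> x n = y n) \<longrightarrow> L x = L y)"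

definition diag2 :: "real \<Rightarrow> real \<Rightarrow> mat2" where
  "diag2 a b = (\<chi> i j. if i = j then (if i = 1 then a else b) else 0)"

definition A_sig :: "real \<Rightarrow> sigma \<Rightarrow> mat2" where
  "A_sig \<sigma> x = (if x 0 then diag2 \<sigma> (1 / \<sigma>) else diag2 (1 / \<sigma>) \<sigma>)"

fun cocycle_pow :: "(sigma \<Rightarrow> mat2) \<Rightarrow> nat \<Rightarrow> sigma \<Rightarrow> mat2" where
  "cocycle_pow A 0 x = mat 1"
| "cocycle_pow A (Suc n) x = A ((shift ^^ n) x) ** cocycle_pow A n x"

definition mu :: "real \<Rightarrow> sigma measure" where
  "mu p = (\<Pi>\<^sub>M i\<in>(UNIV::int set). measure_pmf (bernoulli_pmf p))"

definition lyap :: "(sigma \<Rightarrow> mat2) \<Rightarrow> sigma measure \<Rightarrow> real" where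
  "lyap A M = (INF n\<in>{1::nat..}. (1 / real n) * (\<integral>x. ln (opnorm (cocycle_pow A n x)) \<partial>M))"

end

theory Submission
  imports Defs
begin

text \<open>
  Close to \<open>A_sig s\<close>, with \<open>s\<close> slightly larger than \<open>\<sigma>\<close>, we apply three kinds of shears. At every short
  marker \<open>1 0\<^sup>m\<close> a lower shear of size \<open>s\<^bsup>-2m\<^esup>\<close> tilts the horizontal axis. At the end of a long marker
  \<open>1 0\<^sup>d\<close> the tilted axis has become almost vertical, and an upper shear of size \<open>s\<^bsup>-2(d-m)\<^esup>\<close> makes it
  exactly vertical. At time \<open>T\<close> after the short marker a second lower shear undoes the first one if
  there was no long marker, and otherwise completes the three shears to a swap of the two axes. The last
  decision needs a window of radius \<open>T\<close>, but a typical orbit has expanded the horizontal axis by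
  \<open>s\<^bsup>\<gamma>T\<^esup>\<close> by then, with \<open>s\<^bsup>2\<gamma>\<^esup> > 2\<^bsup>\<alpha>\<^esup>\<close> because \<open>\<sigma>\<^bsup>4p-2\<^esup> \<ge> 2\<^bsup>\<alpha>\<^esup>\<close>, so the correction is small
  in the Hoelder norm. Outside rare events the resulting cocycle is monomial and swaps the axes at the
  long markers, hence its exponent tends to 0 as \<open>m\<close> grows.

  Scale all shears by \<open>t \<in> [0,1]\<close> and insert a fixed positive matrix close to the identity at every
  symbol 0. For \<open>t = 0\<close> the matrices are nonnegative and the exponent is at least \<open>(2p-1) ln s\<close>; for
  \<open>t = 1\<close> it is below \<open>\<kappa>\<close>. The positive matrices spread every direction, so all vectors grow at the
  same rate uniformly, and the exponent is both an infimum and a supremum of functions that are continuous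
  in \<open>t\<close>. The intermediate value theorem gives a parameter with exponent \<open>\<kappa>\<close>.
\<close>

section \<open>Functions of finitely many coordinates\<close>

text \<open>The obstacle is the price of looking ahead: a function of a window of radius
  \<open>k\<close> is small in the Hoelder norm only if its values are well below
  \<open>2 powr (- \<alpha> * k)\<close>. A lower shear a and an upper shear b that make the axis
  vertical over d zeros satisfy a * b * s^(2d) = 1. If both had to see the whole marker, their costs
  would multiply to (2^\<alpha> / s)^(2d), which need not be small under the hypothesis. So the
  first shear is decided after only \<open>m\<close> zeros, and its false alarms have to be repaired
  later, once the accumulated expansion pays for the wide window.

  The exponent is small at full strength because a swap reverses the sign of the accumulated
  logarithmic growth \<open>rho\<close>. Its mean stays of order 1/q, where \<open>q\<close> is the
  frequency of long markers, and its second moment is of order n/q up to negligible terms. After n =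
  m/q steps the average growth is thus of order m^(-1/2).

  All functions see finitely many coordinates, so expectations are finite sums, and uniform
  estimates at one finite time take the place of stationary measures on directions.\<close>

definition fdep :: "int set \<Rightarrow> (sigma \<Rightarrow> 'a) \<Rightarrow> bool" where
  "fdep I F \<longleftrightarrow> (\<forall>x y. (\<forall>i\<in>I. x i = y i) \<longrightarrow> F x = F y)"

definition fd :: "(sigma \<Rightarrow> 'a) \<Rightarrow> bool" where
  "fd F \<longleftrightarrow> (\<exists>I. finite I \<and> fdep I F)"

text \<open>Resamples the coordinates in \<open>J\<close>; averaging over \<open>S\<close> replaces
  conditioning on the coordinates outside \<open>J\<close>.\<close>

definition overwrite :: "int set \<Rightarrow> int set \<Rightarrow> sigma \<Rightarrow> sigma" where
  "overwrite J S x = (\<lambda>i. if i \<in> J then i \<in> S else x i)"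

lemma fdepI: "(\<And>x y. (\<And>i. i \<in> I \<Longrightarrow> x i = y i) \<Longrightarrow> F x = F y) \<Longrightarrow> fdep I F"
  unfolding fdep_def by blast

lemma fdepD: "fdep I F \<Longrightarrow> (\<And>i. i \<in> I \<Longrightarrow> x i = y i) \<Longrightarrow> F x = F y"
  unfolding fdep_def by blast

lemma fdep_mono: "fdep I F \<Longrightarrow> I \<subseteq> J \<Longrightarrow> fdep J F"
  unfolding fdep_def by blast

lemma fdep_comp2: "fdep I F \<Longrightarrow> fdep I G \<Longrightarrow> fdep I (\<lambda>x. h (F x) (G x))"
  unfolding fdep_def by metis

lemma fdep_comp: "fdep I F \<Longrightarrow> fdep I (\<lambda>x. h (F x))"
  unfolding fdep_def by metis

lemma fdep_const: "fdep I (\<lambda>x. c)"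
  unfolding fdep_def by simp

lemma fdI: "finite I \<Longrightarrow> fdep I F \<Longrightarrow> fd F"
  unfolding fd_def by blast

lemma fd_const: "fd (\<lambda>x. c)"
  by (rule fdI[of "{}"]) (auto simp: fdep_def)

lemma fd_comp2: "fd F \<Longrightarrow> fd G \<Longrightarrow> fd (\<lambda>x. h (F x) (G x))"
proof -
  assume "fd F" "fd G"
  then obtain I J where I: "finite I" "fdep I F" and J: "finite J" "fdep J G"
    unfolding fd_def by blast
  have "fdep (I \<union> J) (\<lambda>x. h (F x) (G x))"
    by (rule fdep_comp2[OF fdep_mono[OF I(2)] fdep_mono[OF J(2)]]) auto
  then show ?thesis
    by (rule fdI[rotated]) (use I J in simp)
qed

lemma fd_comp: "fd F \<Longrightarrow> fd (\<lambda>x. h (F x))"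
  unfolding fd_def using fdep_comp by blast

lemma fd_coord: "fd (\<lambda>x. x i)"
  by (rule fdI[of "{i}"]) (auto simp: fdep_def)

lemma fd_sum: "(\<And>i. i \<in> A \<Longrightarrow> fd (F i)) \<Longrightarrow> fd (\<lambda>x. \<Sum>i\<in>A. F i x :: real)"
proof (induction A rule: infinite_finite_induct)
  case (insert i A)
  then show ?case
    using fd_comp2[of "F i" "\<lambda>x. \<Sum>i\<in>A. F i x" "(+)"] by simp
qed (simp_all add: fd_const)

lemma fd_bex: "finite A \<Longrightarrow> (\<And>i. i \<in> A \<Longrightarrow> fd (P i)) \<Longrightarrow> fd (\<lambda>x. \<exists>i\<in>A. P i x)"
proof (induction A rule: finite_induct)
  case (insert i A)
  then show ?case using fd_comp2[of "P i" "\<lambda>x. \<exists>i\<in>A. P i x" "(\<or>)"] by simp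
qed (simp add: fd_const)

lemma shift_pow: "(shift ^^ n) x = (\<lambda>i. x (i + int n))"
  by (induction n) (auto simp: shift_def algebra_simps)

lemma fdep_shift: "fdep I F \<Longrightarrow> (\<And>i. i \<in> I \<Longrightarrow> i + int n \<in> J) \<Longrightarrow> fdep J (\<lambda>x. F ((shift ^^ n) x))"
  by (rule fdepI, erule fdepD) (simp add: shift_pow)

lemma fd_shift:
  assumes "fd F" shows "fd (\<lambda>x. F ((shift ^^ n) x))"
proof -
  obtain I where "finite I" "fdep I F" using assms unfolding fd_def by blast
  then show ?thesis
    by (intro fdI[of "(\<lambda>i. i + int n) ` I"] fdep_shift[of I F]) auto
qed

lemma fdep_overwrite: "fdep I F \<Longrightarrow> fdep (I - J) (\<lambda>x. F (overwrite J S x))"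
  by (rule fdepI, erule fdepD) (simp add: overwrite_def)

lemma fd_overwrite: "fd F \<Longrightarrow> fd (\<lambda>x. F (overwrite J S x))"
  unfolding fd_def using fdep_overwrite finite_Diff by blast

lemma fdep_overwrite_same: "fdep I F \<Longrightarrow> I \<inter> J = {} \<Longrightarrow> F (overwrite J S x) = F x"
  by (erule fdepD) (auto simp: overwrite_def)

section \<open>Expectations under the Bernoulli measure as finite sums\<close>

locale bern =
  fixes p :: real
  assumes p0: "0 < p" and p1: "p < 1"
begin

definition E :: "(sigma \<Rightarrow> real) \<Rightarrow> real" where
  "E F = (\<integral>x. F x \<partial>mu p)"

definition wt :: "int set \<Rightarrow> int set \<Rightarrow> real" where
  "wt I S = (\<Prod>i\<in>I. if i \<in> S then p else 1 - p)"

lemma mu_prob: "prob_space (mu p)"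
  unfolding mu_def by (intro prob_space_PiM prob_space_measure_pmf)

lemma space_mu: "space (mu p) = UNIV"
  by (auto simp: mu_def space_PiM)

lemma cyl:
  assumes "finite I"
  shows "{x. \<forall>i\<in>I. x i = (i \<in> S)} \<in> sets (mu p)"
    and "measure (mu p) {x. \<forall>i\<in>I. x i = (i \<in> S)} = wt I S"
proof -
  interpret product_prob_space "\<lambda>i::int. measure_pmf (bernoulli_pmf p)" UNIV
    by (intro product_prob_spaceI prob_space_measure_pmf)
  have eq: "{x. \<forall>i\<in>I. x i = (i \<in> S)} =
     prod_emb UNIV (\<lambda>i. measure_pmf (bernoulli_pmf p)) I (Pi\<^sub>E I (\<lambda>i. {i \<in> S}))"
    by (auto simp: prod_emb_def PiE_def Pi_def extensional_def restrict_def)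
  show "{x. \<forall>i\<in>I. x i = (i \<in> S)} \<in> sets (mu p)"
    unfolding eq mu_def by (intro sets_PiM_I_finite sets_PiM_I) (auto simp: assms)
  have "measure (mu p) {x. \<forall>i\<in>I. x i = (i \<in> S)} = (\<Prod>i\<in>I. measure (measure_pmf (bernoulli_pmf p)) {i \<in> S})"
    unfolding eq mu_def by (rule measure_PiM_emb) (auto simp: assms)
  also have "\<dots> = wt I S"
    unfolding wt_def using p0 p1 by (intro prod.cong) (auto simp: measure_pmf_single)
  finally show "measure (mu p) {x. \<forall>i\<in>I. x i = (i \<in> S)} = wt I S" .
qed

lemma fdep_repr:
  fixes F :: "sigma \<Rightarrow> real"
  assumes "finite I" "fdep I F"
  shows "F x = (\<Sum>S\<in>Pow I. F (\<lambda>i. i \<in> S) * indicator {x. \<forall>i\<in>I. x i = (i \<in> S)} x)" (is "_ = ?r")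
proof -
  let ?S = "{i\<in>I. x i}"
  have "?r = (\<Sum>S\<in>{?S}. F (\<lambda>i. i \<in> S) * indicator {x. \<forall>i\<in>I. x i = (i \<in> S)} x)"
  proof (rule sum.mono_neutral_right)
    show "\<forall>S\<in>Pow I - {?S}. F (\<lambda>i. i \<in> S) * indicator {x. \<forall>i\<in>I. x i = (i \<in> S)} x = 0"
    proof
      fix S assume S: "S \<in> Pow I - {?S}"
      have "\<not> (\<forall>i\<in>I. x i = (i \<in> S))"
      proof
        assume "\<forall>i\<in>I. x i = (i \<in> S)"
        then have "S = ?S" using S by auto
        then show False using S by blast
      qed
      then show "F (\<lambda>i. i \<in> S) * indicator {x. \<forall>i\<in>I. x i = (i \<in> S)} x = 0"
        by (simp add: indicator_def)
    qed
  qed (use assms in auto)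
  also have "\<dots> = F (\<lambda>i. i \<in> ?S)" by (simp add: indicator_def)
  also have "\<dots> = F x" by (rule fdepD[OF assms(2)]) auto
  finally show ?thesis by simp
qed

text \<open>Integrability, independence and continuity in a parameter are all derived from this
  finite sum.\<close>

lemma E_repr:
  assumes "finite I" "fdep I F"
  shows "integrable (mu p) F" "E F = (\<Sum>S\<in>Pow I. wt I S * F (\<lambda>i. i \<in> S))"
proof -
  interpret prob_space "mu p" by (rule mu_prob)
  let ?G = "\<lambda>x. \<Sum>S\<in>Pow I. F (\<lambda>i. i \<in> S) * indicator {x. \<forall>i\<in>I. x i = (i \<in> S)} x"
  have F: "F = ?G" using fdep_repr[OF assms] by (intro ext)
  have i: "integrable (mu p) (\<lambda>x. F (\<lambda>i. i \<in> S) * indicator {x. \<forall>i\<in>I. x i = (i \<in> S)} x)" for S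
    using cyl[OF assms(1)] by (intro integrable_mult_right integrable_real_indicator) (auto simp: emeasure_eq_measure)
  show "integrable (mu p) F" by (subst F) (intro Bochner_Integration.integrable_sum i)
  have "E F = E ?G" by (rule arg_cong[of _ _ E, OF F])
  also have "\<dots> = (\<Sum>S\<in>Pow I. F (\<lambda>i. i \<in> S) * measure (mu p) {x. \<forall>i\<in>I. x i = (i \<in> S)})"
    unfolding E_def using i by (simp add: space_mu)
  finally show "E F = (\<Sum>S\<in>Pow I. wt I S * F (\<lambda>i. i \<in> S))"
    by (simp only: cyl(2)[OF assms(1)] mult.commute)
qed

lemma fd_integrable: "fd F \<Longrightarrow> integrable (mu p) (F :: sigma \<Rightarrow> real)"
  unfolding fd_def by (elim exE conjE) (rule E_repr(1))

lemma E_const: "E (\<lambda>x. c) = c"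
  unfolding E_def using prob_space.prob_space[OF mu_prob] by (simp)

lemma E_add: "fd F \<Longrightarrow> fd G \<Longrightarrow> E (\<lambda>x. F x + G x) = E F + E G"
  unfolding E_def by (intro Bochner_Integration.integral_add fd_integrable)

lemma E_diff: "fd F \<Longrightarrow> fd G \<Longrightarrow> E (\<lambda>x. F x - G x) = E F - E G"
  unfolding E_def by (intro Bochner_Integration.integral_diff fd_integrable)

lemma E_cmult: "E (\<lambda>x. c * F x) = c * E F"
  unfolding E_def by simp

lemma E_sum: "(\<And>i. i \<in> A \<Longrightarrow> fd (F i)) \<Longrightarrow> E (\<lambda>x. \<Sum>i\<in>A. F i x) = (\<Sum>i\<in>A. E (F i))"
  unfolding E_def by (intro Bochner_Integration.integral_sum fd_integrable)

lemma E_mono: "fd F \<Longrightarrow> fd G \<Longrightarrow> (\<And>x. F x \<le> G x) \<Longrightarrow> E F \<le> E G"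
  unfolding E_def by (intro integral_mono fd_integrable)

lemma E_or:
  assumes "fd P" "fd Q"
  shows "E (\<lambda>x. of_bool (P x \<or> Q x)) \<le> E (\<lambda>x. of_bool (P x)) + E (\<lambda>x. of_bool (Q x))"
proof -
  have f: "fd (\<lambda>x. of_bool (P x) :: real)" "fd (\<lambda>x. of_bool (Q x) :: real)"
    by (intro fd_comp[where h = of_bool] assms)+
  have "E (\<lambda>x. of_bool (P x \<or> Q x)) \<le> E (\<lambda>x. of_bool (P x) + of_bool (Q x))"
    by (intro E_mono fd_comp2[OF f] fd_comp2[OF assms, where h = "\<lambda>a b. of_bool (a \<or> b)"]) simp
  then show ?thesis by (simp only: E_add[OF f])
qed

lemma E_bex:
  assumes "finite A" "\<And>i. i \<in> A \<Longrightarrow> fd (P i)"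
  shows "E (\<lambda>x. of_bool (\<exists>i\<in>A. P i x)) \<le> (\<Sum>i\<in>A. E (\<lambda>x. of_bool (P i x)))"
  using assms
proof (induction A rule: finite_induct)
  case (insert i A)
  then show ?case using E_or[OF _ fd_bex, of "P i" A P] by force
qed (simp add: E_const)

lemma wt_pos: "wt I S > 0"
  unfolding wt_def using p0 p1 by (intro prod_pos) auto

lemma wt_sum: "finite I \<Longrightarrow> (\<Sum>S\<in>Pow I. wt I S) = 1"
  using E_repr(2)[of I "\<lambda>x. 1"] by (simp add: fdep_const E_const)

lemma wt_ge: assumes "finite I" shows "wt I S \<ge> min p (1 - p) ^ card I"
proof -
  have "(\<Prod>i\<in>I. min p (1 - p)) \<le> wt I S"
    unfolding wt_def using p0 p1 by (intro prod_mono) auto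
  then show ?thesis by simp
qed

text \<open>Fubini for the splitting into \<open>J\<close> and its complement: each word on
  \<open>I \<union> J\<close> is split into its parts on the two disjoint sets, and the weights
  multiply.\<close>

lemma E_overwrite:
  assumes F: "fd F" and J: "finite J"
  shows "E F = (\<Sum>S\<in>Pow J. wt J S * E (\<lambda>x. F (overwrite J S x)))"
proof -
  obtain I0 where I0: "finite I0" "fdep I0 F" using F unfolding fd_def by blast
  define I where "I = I0 - J"
  have fin: "finite I" and dis: "I \<inter> J = {}" using I0 by (auto simp: I_def)
  have dF: "fdep (I \<union> J) F" using I0 by (auto intro: fdep_mono simp: I_def)
  have dO: "fdep I (\<lambda>x. F (overwrite J S x))" for S
    using fdep_overwrite[OF I0(2)] by (simp add: I_def)
  have "E F = (\<Sum>S\<in>Pow (I \<union> J). wt (I \<union> J) S * F (\<lambda>i. i \<in> S))"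
    by (rule E_repr) (use fin J dF in auto)
  also have "\<dots> = (\<Sum>(A,B)\<in>Pow I \<times> Pow J. wt (I \<union> J) (A \<union> B) * F (\<lambda>i. i \<in> A \<union> B))"
  proof (rule sum.reindex_bij_witness[of _ "\<lambda>(A,B). A \<union> B" "\<lambda>S. (S \<inter> I, S \<inter> J)"])
    fix S assume "S \<in> Pow (I \<union> J)"
    then have "(S \<inter> I) \<union> (S \<inter> J) = S" by auto
    then show "(case (S \<inter> I, S \<inter> J) of (A, B) \<Rightarrow> wt (I \<union> J) (A \<union> B) * F (\<lambda>i. i \<in> A \<union> B)) =
         wt (I \<union> J) S * F (\<lambda>i. i \<in> S)" by (simp only: prod.case)
  qed (use dis in auto)
  also have "\<dots> = (\<Sum>A\<in>Pow I. \<Sum>B\<in>Pow J. wt J B * (wt I A * F (overwrite J B (\<lambda>i. i \<in> A))))"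
    unfolding sum.cartesian_product[symmetric]
  proof (intro sum.cong refl)
    fix A B assume AB: "A \<in> Pow I" "B \<in> Pow J"
    have "wt (I \<union> J) (A \<union> B) = wt I (A \<union> B) * wt J (A \<union> B)"
      unfolding wt_def by (rule prod.union_disjoint) (use fin J dis in auto)
    also have "wt I (A \<union> B) = wt I A" unfolding wt_def using AB dis by (intro prod.cong) auto
    also have "wt J (A \<union> B) = wt J B" unfolding wt_def using AB dis by (intro prod.cong) auto
    finally have w: "wt (I \<union> J) (A \<union> B) = wt I A * wt J B" .
    have "F (\<lambda>i. i \<in> A \<union> B) = F (overwrite J B (\<lambda>i. i \<in> A))"
      by (rule fdepD[OF dF]) (use AB dis in \<open>auto simp: overwrite_def\<close>)
    with w show "wt (I \<union> J) (A \<union> B) * F (\<lambda>i. i \<in> A \<union> B) = wt J B * (wt I A * F (overwrite J B (\<lambda>i. i \<in> A)))"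
      by simp
  qed
  also have "\<dots> = (\<Sum>B\<in>Pow J. \<Sum>A\<in>Pow I. wt J B * (wt I A * F (overwrite J B (\<lambda>i. i \<in> A))))"
    by (rule sum.swap)
  also have "\<dots> = (\<Sum>B\<in>Pow J. wt J B * E (\<lambda>x. F (overwrite J B x)))"
    by (intro sum.cong refl) (simp add: E_repr(2)[OF fin dO] sum_distrib_left)
  finally show ?thesis .
qed

lemma E_indep:
  assumes "finite I" "fdep I F" "fd G" "fdep J G" "I \<inter> J = {}"
  shows "E (\<lambda>x. F x * G x) = E F * E G"
proof -
  have "fd F" using assms by (auto intro: fdI)
  have "E (\<lambda>x. F x * G x) = (\<Sum>S\<in>Pow I. wt I S * E (\<lambda>x. F (overwrite I S x) * G (overwrite I S x)))"
    by (rule E_overwrite[OF fd_comp2[OF \<open>fd F\<close> assms(3)] assms(1)])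
  also have "\<dots> = (\<Sum>S\<in>Pow I. wt I S * F (\<lambda>i. i \<in> S) * E G)"
  proof (intro sum.cong refl)
    fix S assume "S \<in> Pow I"
    have "G (overwrite I S x) = G x" for x by (rule fdep_overwrite_same[OF assms(4)]) (use assms in auto)
    moreover have "F (overwrite I S x) = F (\<lambda>i. i \<in> S)" for x
      by (rule fdepD[OF assms(2)]) (auto simp: overwrite_def)
    ultimately show "wt I S * E (\<lambda>x. F (overwrite I S x) * G (overwrite I S x)) = wt I S * F (\<lambda>i. i \<in> S) * E G"
      by (simp add: E_cmult)
  qed
  also have "\<dots> = E F * E G" by (simp add: E_repr(2)[OF assms(1,2)] sum_distrib_right)
  finally show ?thesis .
qed

lemma E_shift:
  assumes "fd F" shows "E (\<lambda>x. F ((shift ^^ n) x)) = E F"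
proof -
  obtain I where I: "finite I" "fdep I F" using assms unfolding fd_def by blast
  let ?g = "\<lambda>i. i + int n"
  have inj: "inj_on ?g X" for X by (simp add: inj_on_def)
  have "E (\<lambda>x. F ((shift ^^ n) x)) = (\<Sum>S\<in>Pow (?g ` I). wt (?g ` I) S * F ((shift ^^ n) (\<lambda>i. i \<in> S)))"
    by (rule E_repr) (use I in \<open>auto intro: fdep_shift\<close>)
  also have "Pow (?g ` I) = (\<lambda>S. ?g ` S) ` Pow I" by (rule image_Pow_surj[symmetric]) simp
  also have "(\<Sum>S\<in>(\<lambda>S. ?g ` S) ` Pow I. wt (?g ` I) S * F ((shift ^^ n) (\<lambda>i. i \<in> S)))
     = (\<Sum>S\<in>Pow I. wt (?g ` I) (?g ` S) * F ((shift ^^ n) (\<lambda>i. i \<in> ?g ` S)))"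
    by (subst sum.reindex) (auto simp: inj_on_def inj_image_eq_iff[OF inj] o_def)
  also have "\<dots> = (\<Sum>S\<in>Pow I. wt I S * F (\<lambda>i. i \<in> S))"
  proof (intro sum.cong refl)
    fix S
    have "wt (?g ` I) (?g ` S) = wt I S"
      unfolding wt_def by (subst prod.reindex[OF inj]) (auto simp: o_def inj_image_mem_iff[OF inj] intro!: prod.cong)
    moreover have "(shift ^^ n) (\<lambda>i. i \<in> ?g ` S) = (\<lambda>i. i \<in> S)"
      by (auto simp: shift_pow)
    ultimately show "wt (?g ` I) (?g ` S) * F ((shift ^^ n) (\<lambda>i. i \<in> ?g ` S)) = wt I S * F (\<lambda>i. i \<in> S)"
      by simp
  qed
  also have "\<dots> = E F" by (simp add: E_repr(2)[OF I])
  finally show ?thesis .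
qed

lemma E_coord: "E (\<lambda>x. if x i then a else b) = p * a + (1 - p) * b"
proof -
  have "Pow {i} = {{}, {i}}" by auto
  then show ?thesis
    by (subst E_repr(2)[of "{i}"]) (auto simp: fdep_def wt_def)
qed

text \<open>One finite set serves all parameters, so the expectation is a sum with fixed index set
  and fixed weights.\<close>

lemma E_cont:
  assumes "finite I" "\<And>t. fdep I (F t)" "\<And>x. continuous_on A (\<lambda>t. F t x)"
  shows "continuous_on A (\<lambda>t. E (F t))"
  by (simp add: E_repr(2)[OF assms(1,2)]) (intro continuous_intros assms)

end

section \<open>Two-by-two matrices and cocycles\<close>

definition mk2 :: "real \<Rightarrow> real \<Rightarrow> real \<Rightarrow> real \<Rightarrow> mat2" where
  "mk2 a b c d = (\<chi> i j. if i = 1 then (if j = 1 then a else b) else (if j = 1 then c else d))"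

lemma mk2_nth [simp]:
  "mk2 a b c d $ 1 $ 1 = a" "mk2 a b c d $ 1 $ 2 = b" "mk2 a b c d $ 2 $ 1 = c" "mk2 a b c d $ 2 $ 2 = d"
  by (simp_all add: mk2_def)

lemma mat2_eqI:
  fixes M N :: mat2
  assumes "M$1$1 = N$1$1" "M$1$2 = N$1$2" "M$2$1 = N$2$1" "M$2$2 = N$2$2"
  shows "M = N"
  using assms by (simp add: vec_eq_iff forall_2)

lemma mat2_cases: "(M :: mat2) = mk2 (M$1$1) (M$1$2) (M$2$1) (M$2$2)"
  by (rule mat2_eqI) simp_all

lemma mult_nth [simp]: "((M :: mat2) ** N) $ i $ j = M$i$1 * N$1$j + M$i$2 * N$2$j"
  by (simp add: matrix_matrix_mult_def sum_2)

lemma mk2_mult: "mk2 a b c d ** mk2 a' b' c' d' =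
    mk2 (a*a' + b*c') (a*b' + b*d') (c*a' + d*c') (c*b' + d*d')"
  by (rule mat2_eqI) simp_all

lemma mk2_diff: "mk2 a b c d - mk2 a' b' c' d' = mk2 (a-a') (b-b') (c-c') (d-d')"
  by (rule mat2_eqI) simp_all

lemma mat1_mk2: "(mat 1 :: mat2) = mk2 1 0 0 1"
  by (rule mat2_eqI) (simp_all add: mat_def)

lemma diag2_mk2: "diag2 a b = mk2 a 0 0 b"
  by (rule mat2_eqI) (simp_all add: diag2_def)

lemma det_mk2 [simp]: "det (mk2 a b c d) = a * d - b * c"
  by (simp add: det_2)

lemma mv_nth: "((M :: mat2) *v v) $ i = M$i$1 * v$1 + M$i$2 * v$2"
  by (simp add: matrix_vector_mult_def sum_2)

lemma norm2_sq: "(norm (v :: real^2))\<^sup>2 = (v$1)\<^sup>2 + (v$2)\<^sup>2"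
  by (simp add: norm_vec_def L2_set_def sum_2)

lemma norm2_le: "norm (v :: real^2) \<le> \<bar>v$1\<bar> + \<bar>v$2\<bar>"
  using norm_le_l1_cart[of v] by (simp add: sum_2)

lemma comp_le_norm: "\<bar>(v :: real^2)$i\<bar> \<le> norm v"
  using component_le_norm_cart[of v i] by simp

lemma opnorm_bl: "bounded_linear (\<lambda>v. (M :: mat2) *v v)"
  by (rule matrix_vector_mul_bounded_linear)

lemma opnorm_mv: "norm (M *v v) \<le> opnorm M * norm v"
  unfolding opnorm_def by (rule onorm[OF opnorm_bl])

lemma opnorm_le: "(\<And>v. norm (M *v v) \<le> b * norm v) \<Longrightarrow> opnorm M \<le> b"
  unfolding opnorm_def by (rule onorm_le)

lemma opnorm_nonneg: "0 \<le> opnorm M"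
  unfolding opnorm_def by (rule onorm_pos_le[OF opnorm_bl])

lemma opnorm_mult: "opnorm (M ** N) \<le> opnorm M * opnorm N"
proof (rule opnorm_le)
  fix v
  have "norm (M ** N *v v) \<le> opnorm M * norm (N *v v)"
    by (simp add: matrix_vector_mul_assoc[symmetric] opnorm_mv)
  also have "\<dots> \<le> opnorm M * (opnorm N * norm v)"
    by (intro mult_left_mono opnorm_mv opnorm_nonneg)
  finally show "norm (M ** N *v v) \<le> opnorm M * opnorm N * norm v" by (simp add: mult.assoc)
qed

lemma opnorm_add: "opnorm (M + N) \<le> opnorm M + opnorm N"
proof (rule opnorm_le)
  fix v
  have "norm ((M + N) *v v) \<le> norm (M *v v) + norm (N *v v)"
    by (simp add: matrix_vector_mult_add_rdistrib norm_triangle_ineq)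
  also have "\<dots> \<le> opnorm M * norm v + opnorm N * norm v" by (intro add_mono opnorm_mv)
  finally show "norm ((M + N) *v v) \<le> (opnorm M + opnorm N) * norm v" by (simp add: algebra_simps)
qed

lemma opnorm_mk2_le: "opnorm (mk2 a b c d) \<le> \<bar>a\<bar> + \<bar>b\<bar> + \<bar>c\<bar> + \<bar>d\<bar>"
proof (rule opnorm_le)
  fix v :: "real^2"
  have "norm (mk2 a b c d *v v) \<le> \<bar>a * v$1 + b * v$2\<bar> + \<bar>c * v$1 + d * v$2\<bar>"
    using norm2_le[of "mk2 a b c d *v v"] by (simp add: mv_nth)
  also have "\<dots> \<le> (\<bar>a\<bar> * \<bar>v$1\<bar> + \<bar>b\<bar> * \<bar>v$2\<bar>) + (\<bar>c\<bar> * \<bar>v$1\<bar> + \<bar>d\<bar> * \<bar>v$2\<bar>)"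
    by (intro add_mono order_trans[OF abs_triangle_ineq]) (simp_all add: abs_mult)
  also have "\<dots> \<le> (\<bar>a\<bar> * norm v + \<bar>b\<bar> * norm v) + (\<bar>c\<bar> * norm v + \<bar>d\<bar> * norm v)"
    by (intro add_mono mult_left_mono comp_le_norm) simp_all
  finally show "norm (mk2 a b c d *v v) \<le> (\<bar>a\<bar> + \<bar>b\<bar> + \<bar>c\<bar> + \<bar>d\<bar>) * norm v"
    by (simp add: algebra_simps)
qed

lemma opnorm_entries: "opnorm M \<le> \<bar>M$1$1\<bar> + \<bar>M$1$2\<bar> + \<bar>M$2$1\<bar> + \<bar>M$2$2\<bar>"
  using opnorm_mk2_le[of "M$1$1" "M$1$2" "M$2$1" "M$2$2"] by (simp flip: mat2_cases)

lemma opnorm_entry11: "\<bar>M$1$1\<bar> \<le> opnorm M"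
proof -
  have "\<bar>M$1$1\<bar> \<le> norm (M *v axis 1 1)"
    using comp_le_norm[of "M *v axis 1 1" 1] by (simp add: mv_nth axis_def)
  also have "\<dots> \<le> opnorm M" using opnorm_mv[of M "axis 1 1"] by (simp add: norm_axis_1)
  finally show ?thesis .
qed

lemma opnorm_le_norm: "opnorm M \<le> 4 * norm M"
proof -
  have "\<bar>M$i$j\<bar> \<le> norm M" for i j
    using comp_le_norm[of "M$i" j] Finite_Cartesian_Product.norm_nth_le[of M i] by linarith
  from this[of 1 1] this[of 1 2] this[of 2 1] this[of 2 2] opnorm_entries[of M]
  show ?thesis by linarith
qed

lemma opnorm_uminus: "opnorm (- M) = opnorm M"
proof -
  have "(- M) *v v = - (M *v v)" for v by (vector matrix_vector_mult_def sum_negf)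
  then show ?thesis by (simp add: opnorm_def onorm_neg)
qed

lemma opnorm_minus_commute: "opnorm (M - N) = opnorm (N - M)"
  using opnorm_uminus[of "M - N"] by simp

lemma opnorm_triangle3: "\<bar>opnorm M - opnorm N\<bar> \<le> opnorm (M - N)"
  using opnorm_add[of "M - N" N] opnorm_add[of "N - M" M] opnorm_minus_commute[of M N] by simp

lemma opnorm_diff: "opnorm (M - N) \<le> opnorm M + opnorm N"
  using opnorm_add[of M "- N"] by (simp add: opnorm_uminus)

lemma continuous_opnorm [continuous_intros]:
  assumes "continuous_on A F" shows "continuous_on A (\<lambda>t. opnorm (F t))"
proof -
  have "continuous_on UNIV opnorm"
  proof (rule continuous_onI)
    fix M :: mat2 and e :: real assume e: "0 < e"
    have "dist (opnorm N) (opnorm M) \<le> e" if "dist N M < e / 4" for N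
      using opnorm_triangle3[of N M] opnorm_le_norm[of "N - M"] that by (simp add: dist_norm)
    with e show "\<exists>d>0. \<forall>N\<in>UNIV. dist N M < d \<longrightarrow> dist (opnorm N) (opnorm M) \<le> e"
      by (intro exI[of _ "e/4"]) simp
  qed
  then show ?thesis by (rule continuous_on_compose2[OF _ assms]) simp
qed

text \<open>The area form. For unit vectors its modulus is the sine of the angle between the two
  lines; unlike the angle it is transported exactly by matrices, see \<open>cross_mv\<close> and
  \<open>cross_mv_mv\<close>.\<close>

definition cross :: "real^2 \<Rightarrow> real^2 \<Rightarrow> real" where
  "cross v w = v$1 * w$2 - v$2 * w$1"

definition adj2 :: "mat2 \<Rightarrow> mat2" where
  "adj2 M = mk2 (M$2$2) (- (M$1$2)) (- (M$2$1)) (M$1$1)"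

text \<open>Lagrange's identity: the defect is the square of the inner product.\<close>

lemma cross_le: "\<bar>cross v w\<bar> \<le> norm v * norm w"
proof (rule abs_le_square_iff[THEN iffD2, of "cross v w" "norm v * norm w", simplified abs_mult abs_norm_cancel])
  have "(norm v * norm w)\<^sup>2 = (cross v w)\<^sup>2 + (v$1 * w$1 + v$2 * w$2)\<^sup>2"
    by (simp add: power_mult_distrib norm2_sq cross_def) algebra
  then show "(cross v w)\<^sup>2 \<le> (norm v * norm w)\<^sup>2" by simp
qed

lemma cross_mv: "cross (M *v v) w = cross v (adj2 M *v w)"
  by (simp add: cross_def adj2_def mv_nth algebra_simps)

lemma cross_scale: "cross (c *\<^sub>R v) w = c * cross v w" "cross v (c *\<^sub>R w) = c * cross v w"
  by (simp_all add: cross_def algebra_simps)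

lemma mv_adj2: "M *v (adj2 M *v w) = det M *\<^sub>R w"
  by (simp add: vec_eq_iff forall_2 mv_nth adj2_def det_2 algebra_simps)

lemma cross_mv_mv: "cross (M *v v) (M *v w) = det M * cross v w"
  by (simp add: cross_def mv_nth det_2 algebra_simps)

text \<open>In SL(2) a matrix and its inverse have the same norm: \<open>v\<close> and its rotation
  \<open>w\<close> by a right angle span area \<open>(norm v)\<^sup>2\<close>, which
  \<open>M\<close> preserves.\<close>

lemma norm_le_opnorm_mv:
  assumes "det M = 1" shows "norm v \<le> opnorm M * norm (M *v v)"
proof (cases "v = 0")
  case False
  define w :: "real^2" where "w = (\<chi> i. if i = 1 then - (v$2) else v$1)"
  have w: "w$1 = - (v$2)" "w$2 = v$1" by (simp_all add: w_def)
  have nw: "norm w = norm v"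
  proof -
    have "(norm w)\<^sup>2 = (norm v)\<^sup>2" by (simp add: norm2_sq w)
    then show ?thesis by (simp only: power2_eq_iff_nonneg norm_ge_zero)
  qed
  have "(norm v)\<^sup>2 = cross v w" unfolding norm2_sq by (simp add: cross_def w power2_eq_square)
  also have "\<dots> = cross (M *v v) (M *v w)" using cross_mv_mv[of M v w] assms by simp
  also have "\<dots> \<le> norm (M *v v) * norm (M *v w)" using cross_le abs_le_D1 by blast
  also have "\<dots> \<le> norm (M *v v) * (opnorm M * norm v)"
    using opnorm_mv[of M w] nw by (intro mult_left_mono) simp_all
  finally have "norm v * norm v \<le> (opnorm M * norm (M *v v)) * norm v"
    by (simp add: power2_eq_square algebra_simps)
  then show ?thesis using False by simp
qed (simp add: opnorm_nonneg)

lemma opnorm_ge1: assumes "det M = 1" shows "1 \<le> opnorm M"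
proof -
  let ?v = "axis 1 1 :: real^2"
  have "1 \<le> opnorm M * norm (M *v ?v)" using norm_le_opnorm_mv[OF assms, of ?v] by (simp add: norm_axis_1)
  also have "\<dots> \<le> opnorm M * opnorm M"
    using opnorm_mv[of M ?v] by (intro mult_left_mono opnorm_nonneg) (simp add: norm_axis_1)
  finally have "1\<^sup>2 \<le> (opnorm M)\<^sup>2" by (simp add: power2_eq_square)
  then show ?thesis using opnorm_nonneg power2_le_imp_le by blast
qed

text \<open>The unit vector orthogonal to the longer row of \<open>M\<close> is, up to a factor 2, the direction that
  \<open>M\<close> contracts most.\<close>

lemma contracted_direction:
  "\<exists>s :: real^2. norm s = 1 \<and> (\<forall>w. opnorm M / 2 * \<bar>cross w s\<bar> \<le> norm (M *v w))"
proof -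
  define r where "r i = sqrt ((M$i$1)\<^sup>2 + (M$i$2)\<^sup>2)" for i :: 2
  have r0: "r i \<ge> 0" for i by (simp add: r_def)
  have cs: "\<bar>M$i$1 * v$1 + M$i$2 * v$2\<bar> \<le> r i * norm v" for i and v :: "real^2"
  proof (rule abs_le_square_iff[THEN iffD2, of _ "r i * norm v", simplified abs_mult abs_norm_cancel abs_of_nonneg[OF r0]])
    have "(r i * norm v)\<^sup>2 = (M$i$1 * v$1 + M$i$2 * v$2)\<^sup>2 + (M$i$1 * v$2 - M$i$2 * v$1)\<^sup>2"
      by (simp add: power_mult_distrib norm2_sq r_def) algebra
    then show "(M$i$1 * v$1 + M$i$2 * v$2)\<^sup>2 \<le> (r i * norm v)\<^sup>2" by simp
  qed
  have "opnorm M \<le> r 1 + r 2"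
  proof (rule opnorm_le)
    fix v :: "real^2"
    show "norm (M *v v) \<le> (r 1 + r 2) * norm v"
      using norm2_le[of "M *v v"] cs[of 1 v] cs[of 2 v] by (simp add: mv_nth algebra_simps)
  qed
  then have "opnorm M / 2 \<le> r 1 \<or> opnorm M / 2 \<le> r 2" by linarith
  then obtain i where i: "opnorm M / 2 \<le> r i" by blast
  show ?thesis
  proof (cases "r i = 0")
    case True
    then have "opnorm M = 0" using i opnorm_nonneg[of M] by simp
    then show ?thesis by (intro exI[of _ "axis 1 1"]) (simp add: norm_axis_1)
  next
    case False
    then have rho_after: "r i > 0" using r0[of i] by simp
    define s :: "real^2" where "s = (\<chi> j. if j = 1 then M$i$2 / r i else - (M$i$1) / r i)"
    have s: "s$1 = M$i$2 / r i" "s$2 = - (M$i$1) / r i" by (simp_all add: s_def)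
    have rsq: "(M$i$1)\<^sup>2 + (M$i$2)\<^sup>2 = (r i)\<^sup>2" by (simp add: r_def)
    have "(norm s)\<^sup>2 = ((M$i$1)\<^sup>2 + (M$i$2)\<^sup>2) / (r i)\<^sup>2"
      by (simp add: norm2_sq s power_divide add_divide_distrib)
    also have "\<dots> = 1" using rho_after by (simp add: rsq)
    finally have "(norm s)\<^sup>2 = 1\<^sup>2" by simp
    then have ns: "norm s = 1" by (simp only: power2_eq_iff_nonneg norm_ge_zero zero_le_one)
    have "opnorm M / 2 * \<bar>cross w s\<bar> \<le> norm (M *v w)" for w
    proof -
      have "opnorm M / 2 * \<bar>cross w s\<bar> \<le> r i * \<bar>cross w s\<bar>" by (intro mult_right_mono i) simp
      also have "\<dots> = \<bar>r i * cross w s\<bar>" using rho_after by (simp add: abs_mult)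
      also have "r i * cross w s = - ((M *v w)$i)" using rho_after by (simp add: cross_def s mv_nth field_simps)
      also have "\<bar>\<dots>\<bar> \<le> norm (M *v w)" using comp_le_norm[of "M *v w" i] by simp
      finally show ?thesis .
    qed
    with ns show ?thesis by blast
  qed
qed

definition cdir :: "mat2 \<Rightarrow> real^2" where
  "cdir M = (SOME s. norm s = 1 \<and> (\<forall>w. opnorm M / 2 * \<bar>cross w s\<bar> \<le> norm (M *v w)))"

lemma cdir: "norm (cdir M) = 1" "opnorm M / 2 * \<bar>cross w (cdir M)\<bar> \<le> norm (M *v w)"
  using someI_ex[OF contracted_direction[of M]] unfolding cdir_def by blast+

lemma cp_add: "cocycle_pow L (n + k) x = cocycle_pow L k ((shift ^^ n) x) ** cocycle_pow L n x"
proof (induction k)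
  case (Suc k)
  have "(shift ^^ k) ((shift ^^ n) x) = (shift ^^ (n + k)) x"
    by (simp add: shift_pow algebra_simps)
  with Suc show ?case by (simp add: matrix_mul_assoc)
qed simp

section \<open>Cocycles of determinant one and their growth along fields of directions\<close>

locale coc = bern +
  fixes L :: "sigma \<Rightarrow> mat2" and K :: nat and C :: real
  assumes Ldep: "fdep {- int K..int K} L"
    and Ldet: "det (L x) = 1"
    and LC: "opnorm (L x) \<le> C"
begin

abbreviation cp :: "nat \<Rightarrow> sigma \<Rightarrow> mat2" where "cp \<equiv> cocycle_pow L"

lemma C1: "1 \<le> C"
  using opnorm_ge1[OF Ldet] LC by (meson order_trans)

lemma cp_dep: "fdep {- int K..<int n + int K} (cp n)"
proof (induction n)
  case (Suc n)
  have "fdep {- int K..<int (Suc n) + int K} (\<lambda>x. L ((shift ^^ n) x))"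
    by (rule fdep_shift[OF Ldep]) auto
  moreover have "fdep {- int K..<int (Suc n) + int K} (cp n)"
    by (rule fdep_mono[OF Suc]) auto
  ultimately show ?case using fdep_comp2[where h = "(**)"] by (simp, blast)
qed (simp add: fdep_def)

lemma cp_fd: "fd (cp n)"
  by (rule fdI[OF _ cp_dep]) simp

lemma cp_det: "det (cp n x) = 1"
  by (induction n) (simp_all add: det_mul Ldet)

lemma cp_ge1: "1 \<le> opnorm (cp n x)"
  by (rule opnorm_ge1[OF cp_det])

lemma cp_le: "opnorm (cp n x) \<le> C ^ n"
proof (induction n)
  case 0
  have "opnorm (mat 1) \<le> 1" by (rule opnorm_le) simp
  then show ?case by simp
next
  case (Suc n)
  have "opnorm (cp (Suc n) x) \<le> opnorm (L ((shift ^^ n) x)) * opnorm (cp n x)"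
    by (simp add: opnorm_mult)
  also have "\<dots> \<le> C * C ^ n" using LC Suc C1 by (intro mult_mono opnorm_nonneg) auto
  finally show ?case by simp
qed

definition mlog :: "nat \<Rightarrow> real" where "mlog n = E (\<lambda>x. ln (opnorm (cp n x)))"

lemma lnop_fd: "fd (\<lambda>x. ln (opnorm (cp n x)))"
  by (rule fd_comp[OF cp_fd, where h = "\<lambda>M. ln (opnorm M)"])

lemma ln_cp_le: "ln (opnorm (cp n x)) \<le> real n * ln C"
proof -
  have "ln (opnorm (cp n x)) \<le> ln (C ^ n)"
    using cp_le[of n x] cp_ge1[of n x] C1 by (subst ln_le_cancel_iff) auto
  then show ?thesis using C1 by (simp add: ln_realpow)
qed

lemma mlog_nonneg: "0 \<le> mlog n"
proof -
  have "E (\<lambda>x. 0) \<le> mlog n" unfolding mlog_def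
    by (rule E_mono[OF fd_const lnop_fd]) (use cp_ge1 in simp)
  then show ?thesis by (simp add: E_const)
qed

lemma mlog_sub: "mlog (n + k) \<le> mlog n + mlog k"
proof -
  have fdk: "fd (\<lambda>x. ln (opnorm (cp k ((shift ^^ n) x))))"
    by (rule fd_shift[OF lnop_fd])
  have "mlog (n + k) \<le> E (\<lambda>x. ln (opnorm (cp n x)) + ln (opnorm (cp k ((shift ^^ n) x))))"
    unfolding mlog_def
  proof (rule E_mono[OF lnop_fd fd_comp2[OF lnop_fd fdk]])
    fix x
    have "ln (opnorm (cp (n + k) x)) \<le>
        ln (opnorm (cp k ((shift ^^ n) x)) * opnorm (cp n x))"
    proof (subst ln_le_cancel_iff)
      show "0 < opnorm (cp (n + k) x)" using cp_ge1[of "n + k" x] by simp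
      show "0 < opnorm (cp k ((shift ^^ n) x)) * opnorm (cp n x)"
        using cp_ge1[of n x] cp_ge1[of k "(shift ^^ n) x"] by simp
      show "opnorm (cp (n + k) x) \<le> opnorm (cp k ((shift ^^ n) x)) * opnorm (cp n x)"
        by (simp add: cp_add opnorm_mult)
    qed
    also have "\<dots> = ln (opnorm (cp n x)) + ln (opnorm (cp k ((shift ^^ n) x)))"
      using cp_ge1[of n x] cp_ge1[of k "(shift ^^ n) x"] by (subst ln_mult_pos) auto
    finally show "ln (opnorm (cp (n + k) x)) \<le>
        ln (opnorm (cp n x)) + ln (opnorm (cp k ((shift ^^ n) x)))" .
  qed
  also have "\<dots> = mlog n + mlog k"
    unfolding mlog_def using E_shift[OF lnop_fd, of k n] by (subst E_add[OF lnop_fd fdk]) simp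
  finally show ?thesis .
qed

lemma mlog_mult: "mlog (n * k) \<le> real k * mlog n"
proof (induction k)
  case 0
  have "mlog 0 \<le> 0" using ln_cp_le[of 0] E_mono[OF lnop_fd fd_const, of 0 0] unfolding mlog_def by (simp add: E_const)
  then show ?case by simp
next
  case (Suc k)
  then show ?case using mlog_sub[of n "n * k"] by (simp add: algebra_simps)
qed

lemma lyap_eq: "lyap L (mu p) = (INF n\<in>{1..}. mlog n / real n)"
  by (simp add: lyap_def mlog_def E_def)

lemma lyap_le: "1 \<le> n \<Longrightarrow> lyap L (mu p) \<le> mlog n / real n"
  unfolding lyap_eq by (rule cINF_lower) (auto intro!: bdd_belowI[of _ 0] divide_nonneg_nonneg mlog_nonneg)

lemma lyap_ge: "(\<And>n. 1 \<le> n \<Longrightarrow> real n * c \<le> mlog n) \<Longrightarrow> c \<le> lyap L (mu p)"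
  unfolding lyap_eq by (rule cINF_greatest) (auto simp: field_simps)

text \<open>\<open>L x\<close> depends on coordinates up to \<open>K\<close>, so the bound \<open>K\<close> on the coordinates of a past field makes the
  class invariant under applying \<open>L\<close> and shifting.\<close>

definition past_field :: "(sigma \<Rightarrow> real^2) \<Rightarrow> bool" where
  "past_field V \<longleftrightarrow> (\<exists>I. finite I \<and> I \<subseteq> {..int K} \<and> fdep I V) \<and> (\<forall>x. norm (V x) = 1)"

text \<open>The mirror image of \<open>past_field\<close>, wide enough for the directions that
  future products contract most (\<open>cdir_fut\<close>). Both kinds of fields may see the
  coordinates from -K to K, so they are not independent; this forces the margins in
  \<open>Jb\<close>.\<close>

definition fut_field :: "(sigma \<Rightarrow> real^2) \<Rightarrow> bool" where
  "fut_field S \<longleftrightarrow> (\<exists>I. finite I \<and> I \<subseteq> {- int K..} \<and> fdep I S) \<and> (\<forall>x. norm (S x) = 1)"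

definition growth :: "nat \<Rightarrow> (sigma \<Rightarrow> real^2) \<Rightarrow> real" where
  "growth n V = E (\<lambda>x. ln (norm (cp n x *v V x)))"

lemma past_fieldD: "past_field V \<Longrightarrow> norm (V x) = 1" "past_field V \<Longrightarrow> fd V"
  unfolding past_field_def using fdI by blast+

lemma growth_fd: "fd V \<Longrightarrow> fd (\<lambda>x. ln (norm (cp n x *v V x)))"
  by (rule fd_comp2[OF cp_fd, where h = "\<lambda>M v. ln (norm (M *v v))"])

lemma cp_norm_pos: "v \<noteq> 0 \<Longrightarrow> 0 < norm (cp n x *v v)"
  using norm_le_opnorm_mv[OF cp_det, of v n x] by auto

text \<open>The image field \<open>x \<mapsto> L\<^sup>n(x) V(x)\<close>, normalised and seen from the point \<open>f\<^sup>n x\<close>.\<close>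

definition push :: "nat \<Rightarrow> (sigma \<Rightarrow> real^2) \<Rightarrow> sigma \<Rightarrow> real^2" where
  "push n V y = (let x = (\<lambda>i. y (i - int n)) in sgn (cp n x *v V x))"

lemma push_shift: "push n V ((shift ^^ n) x) = sgn (cp n x *v V x)"
  by (simp add: push_def shift_pow)

lemma push_past: assumes "past_field V" shows "past_field (push n V)"
proof -
  obtain I where I: "finite I" "I \<subseteq> {..int K}" "fdep I V" and nV: "\<And>x. norm (V x) = 1"
    using assms unfolding past_field_def by blast
  let ?I = "{- int K..<int n + int K} \<union> I"
  have d: "fdep ?I (\<lambda>x. sgn (cp n x *v V x))"
    by (rule fdep_comp2[where h = "\<lambda>M v. sgn (M *v v)", OF fdep_mono[OF cp_dep] fdep_mono[OF I(3)]]) auto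
  have "fdep ((\<lambda>i. i - int n) ` ?I) (push n V)"
    unfolding push_def Let_def by (rule fdepI, rule fdepD[OF d]) blast
  moreover have "(\<lambda>i. i - int n) ` ?I \<subseteq> {..int K}" using I(2) by force
  moreover have "norm (push n V x) = 1" for x
  proof -
    let ?x = "\<lambda>i. x (i - int n)"
    have "V ?x \<noteq> 0" using nV[of ?x] by (metis norm_zero zero_neq_one)
    then have "0 < norm (cp n ?x *v V ?x)" by (rule cp_norm_pos)
    then show ?thesis unfolding push_def Let_def by (simp add: norm_sgn)
  qed
  moreover have "finite ((\<lambda>i. i - int n) ` ?I)" using I(1) by simp
  ultimately show ?thesis unfolding past_field_def by blast
qed

text \<open>The logarithm of the norm splits along the orbit, and shift invariance turns the second
  part into the growth of the pushed field.\<close>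

lemma growth_add:
  assumes "past_field V" shows "growth (n + k) V = growth n V + growth k (push n V)"
proof -
  have nV: "V x \<noteq> 0" for x using past_fieldD(1)[OF assms, of x] by auto
  note fV = past_fieldD(2)[OF assms] past_fieldD(2)[OF push_past[OF assms]]
  have "ln (norm (cp (n + k) x *v V x)) = ln (norm (cp n x *v V x))
     + ln (norm (cp k ((shift ^^ n) x) *v push n V ((shift ^^ n) x)))" for x
  proof -
    let ?w = "cp n x *v V x"
    have w: "norm ?w > 0" by (rule cp_norm_pos[OF nV])
    have "?w = norm ?w *\<^sub>R sgn ?w" using w by (simp add: sgn_div_norm)
    then have "cp (n + k) x *v V x = norm ?w *\<^sub>R (cp k ((shift ^^ n) x) *v sgn ?w)"
      by (metis cp_add matrix_vector_mul_assoc matrix_vector_mult_scaleR)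
    then have "norm (cp (n + k) x *v V x)
        = norm ?w * norm (cp k ((shift ^^ n) x) *v push n V ((shift ^^ n) x))"
      by (simp add: push_shift)
    moreover have "norm (cp k ((shift ^^ n) x) *v push n V ((shift ^^ n) x)) > 0"
      by (rule cp_norm_pos) (use past_fieldD(1)[OF push_past[OF assms], of n "(shift ^^ n) x"] in auto)
    ultimately show ?thesis using w by (simp add: ln_mult_pos)
  qed
  then have "growth (n + k) V = E (\<lambda>x. ln (norm (cp n x *v V x))
     + ln (norm (cp k ((shift ^^ n) x) *v push n V ((shift ^^ n) x))))"
    unfolding growth_def by simp
  also have "\<dots> = growth n V + E (\<lambda>x. ln (norm (cp k ((shift ^^ n) x) *v push n V ((shift ^^ n) x))))"
    unfolding growth_def by (intro E_add growth_fd fV fd_shift[OF growth_fd])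
  also have "E (\<lambda>x. ln (norm (cp k ((shift ^^ n) x) *v push n V ((shift ^^ n) x)))) = growth k (push n V)"
    unfolding growth_def by (intro E_shift growth_fd fV)
  finally show ?thesis .
qed

lemma growth_le_mlog: assumes "past_field V" shows "growth n V \<le> mlog n"
  unfolding growth_def mlog_def
proof (rule E_mono[OF growth_fd[OF past_fieldD(2)[OF assms]] lnop_fd])
  fix x
  have v: "norm (V x) = 1" by (rule past_fieldD(1)[OF assms])
  then have "0 < norm (cp n x *v V x)" by (intro cp_norm_pos) auto
  then show "ln (norm (cp n x *v V x)) \<le> ln (opnorm (cp n x))"
    using opnorm_mv[of "cp n x" "V x"] v cp_ge1[of n x] by (subst ln_le_cancel_iff) auto
qed

text \<open>Superadditivity of the minimal growth over past fields turns a lower bound at one time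
  into a lower bound for the exponent.\<close>

lemma lyap_ge_growth:
  assumes n0: "1 \<le> n0" and g: "\<And>V. past_field V \<Longrightarrow> real n0 * c \<le> growth n0 V"
  shows "c \<le> lyap L (mu p)"
proof (rule lyap_ge)
  fix n :: nat assume n: "1 \<le> n"
  have it: "past_field V \<Longrightarrow> real (n0 * j) * c \<le> growth (n0 * j) V" for j V
  proof (induction j arbitrary: V)
    case 0
    then have "growth 0 V = E (\<lambda>x. 0)" unfolding growth_def by (simp add: past_fieldD(1))
    then show ?case by (simp add: E_const)
  next
    case (Suc j)
    have "real (n0 * Suc j) * c = real n0 * c + real (n0 * j) * c" by (simp add: algebra_simps)
    also have "\<dots> \<le> growth n0 V + growth (n0 * j) (push n0 V)"
      by (intro add_mono g Suc push_past)
    also have "\<dots> = growth (n0 + n0 * j) V" by (rule growth_add[OF Suc.prems, symmetric])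
    finally show ?case by simp
  qed
  let ?V = "\<lambda>x::sigma. axis 1 1 :: real^2"
  have V: "past_field ?V"
    unfolding past_field_def by (auto intro!: exI[of _ "{}"] fdep_const simp: norm_axis_1)
  have "real (n0 * n) * c \<le> mlog (n0 * n)" using it[OF V] growth_le_mlog[OF V] by (rule order_trans)
  also have "\<dots> \<le> real n0 * mlog n" using mlog_mult[of n n0] by (simp add: mult.commute)
  finally show "real n * c \<le> mlog n" using n0 by (simp add: mult.assoc)
qed

end

section \<open>Continuity of the exponent\<close>

lemma continuous_mat_mult:
  fixes F G :: "'a::topological_space \<Rightarrow> mat2"
  assumes "continuous_on A F" "continuous_on A G"
  shows "continuous_on A (\<lambda>t. F t ** G t)"
  unfolding matrix_matrix_mult_def by (intro continuous_intros continuous_on_vec_lambda continuous_on_component assms)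

lemma continuous_cp:
  assumes "\<And>x. continuous_on A (\<lambda>t. L t x)"
  shows "continuous_on A (\<lambda>t. cocycle_pow (L t) n x)"
proof (induction n)
  case (Suc n)
  show ?case using continuous_mat_mult[OF assms Suc] by simp
qed (simp add: continuous_on_const)

context coc
begin

text \<open>The sine of the angle between the image direction and \<open>S\<close> at the image
  point is below \<open>\<delta>\<close>; the norm on the right spares a normalisation.\<close>

definition aligned :: "nat \<Rightarrow> (sigma \<Rightarrow> real^2) \<Rightarrow> (sigma \<Rightarrow> real^2) \<Rightarrow> real \<Rightarrow> sigma \<Rightarrow> real" where
  "aligned r V S \<delta> x = of_bool (\<bar>cross (cp r x *v V x) (S ((shift ^^ r) x))\<bar>
      < \<delta> * norm (cp r x *v V x))"

lemma fut_fieldD: "fut_field S \<Longrightarrow> norm (S x) = 1" "fut_field S \<Longrightarrow> fd S"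
  unfolding fut_field_def using fdI by blast+

lemma aligned_fd: assumes "fd V" "fd S" shows "fd (aligned r V S \<delta>)"
proof -
  have "fd (\<lambda>x. (\<lambda>v s. of_bool (\<bar>cross v s\<bar> < \<delta> * norm v) :: real) (cp r x *v V x) (S ((shift ^^ r) x)))"
    by (intro fd_comp2[where h = "\<lambda>v s. of_bool (\<bar>cross v s\<bar> < \<delta> * norm v) :: real"]
        fd_comp2[where h = "(*v)", OF cp_fd] fd_shift assms)
  then show ?thesis unfolding aligned_def[abs_def] by simp
qed

lemma aligned_mono: "\<delta> \<le> \<delta>' \<Longrightarrow> aligned r V S \<delta> x \<le> aligned r V S \<delta>' x"
proof -
  assume "\<delta> \<le> \<delta>'"
  then have "\<delta> * norm (cp r x *v V x) \<le> \<delta>' * norm (cp r x *v V x)"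
    by (rule mult_right_mono) simp
  then show ?thesis unfolding aligned_def by auto
qed

lemma cdir_fut: "fut_field (\<lambda>y. cdir (cp n y))"
  unfolding fut_field_def
proof (intro conjI exI allI)
  show "fdep {- int K..<int n + int K} (\<lambda>y. cdir (cp n y))"
    by (rule fdep_comp[OF cp_dep])
qed (auto simp: cdir)

text \<open>A uniform finite-time form of the absence of atoms in stationary distributions of
  directions.\<close>

definition spread :: bool where
  "spread \<longleftrightarrow> (\<forall>\<epsilon>>0. \<exists>N \<delta>. \<delta> > 0 \<and> (\<forall>V S. past_field V \<longrightarrow> fut_field S \<longrightarrow> E (aligned N V S \<delta>) \<le> \<epsilon>))"

lemma growth_ge: assumes "past_field V" shows "- (real n * ln C) \<le> growth n V"
proof -
  have "E (\<lambda>x. - (real n * ln C)) \<le> growth n V"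
    unfolding growth_def
  proof (rule E_mono[OF fd_const growth_fd[OF past_fieldD(2)[OF assms]]])
    fix x
    have v: "norm (V x) = 1" by (rule past_fieldD(1)[OF assms])
    then have pos: "0 < norm (cp n x *v V x)" by (intro cp_norm_pos) auto
    have "1 \<le> opnorm (cp n x) * norm (cp n x *v V x)"
      using norm_le_opnorm_mv[OF cp_det, of "V x" n x] v by simp
    then have "0 \<le> ln (opnorm (cp n x) * norm (cp n x *v V x))" by simp
    also have "\<dots> = ln (opnorm (cp n x)) + ln (norm (cp n x *v V x))"
      using pos cp_ge1[of n x] by (subst ln_mult_pos) auto
    finally show "- (real n * ln C) \<le> ln (norm (cp n x *v V x))"
      using ln_cp_le[of n x] by linarith
  qed
  then show ?thesis by (simp add: E_const)
qed

text \<open>Where the pushed direction is not aligned with the one that the next \<open>n\<close>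
  steps contract most, it grows by the full norm times \<open>\<delta> / 2\<close>. Where it is
  aligned, its norm is still at least the inverse of that norm, so the loss is at most
  \<open>2 * real n * ln C\<close>.\<close>

lemma growth_push_ge:
  assumes V: "past_field V" and \<delta>: "0 < \<delta>" "\<delta> \<le> 1"
    and e: "E (aligned N V (\<lambda>y. cdir (cp n y)) \<delta>) \<le> \<epsilon>"
  shows "mlog n + ln (\<delta> / 2) - 2 * real n * ln C * \<epsilon> \<le> growth n (push N V)"
proof -
  let ?S = "\<lambda>y. cdir (cp n y)"
  let ?f = "(shift ^^ N)"
  note W = push_past[OF V, of N]
  have lnC: "0 \<le> ln C" using C1 by simp
  have fd1: "fd (aligned N V ?S \<delta>)" by (intro aligned_fd past_fieldD(2)[OF V] fut_fieldD(2)[OF cdir_fut])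
  have fd2: "fd (\<lambda>x. ln (opnorm (cp n (?f x))))" by (rule fd_shift[OF lnop_fd])
  let ?lhs = "\<lambda>x. (ln (opnorm (cp n (?f x))) + ln (\<delta> / 2)) - 2 * real n * ln C * aligned N V ?S \<delta> x"
  have fd3: "fd (\<lambda>x. ln (opnorm (cp n (?f x))) + ln (\<delta> / 2))"
    by (rule fd_comp2[OF fd2 fd_const])
  have fd4: "fd (\<lambda>x. 2 * real n * ln C * aligned N V ?S \<delta> x)" by (rule fd_comp[OF fd1])
  have "mlog n + ln (\<delta> / 2) - 2 * real n * ln C * \<epsilon> \<le> E ?lhs"
  proof -
    have "E ?lhs = mlog n + ln (\<delta> / 2) - 2 * real n * ln C * E (aligned N V ?S \<delta>)"
      using E_shift[OF lnop_fd, of n N]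
      by (subst E_diff[OF fd3 fd4], subst E_add[OF fd2 fd_const], subst E_cmult) (simp add: E_const mlog_def)
    moreover have "2 * real n * ln C * E (aligned N V ?S \<delta>) \<le> 2 * real n * ln C * \<epsilon>"
      using e lnC by (intro mult_left_mono) auto
    ultimately show ?thesis by linarith
  qed
  also have "\<dots> \<le> E (\<lambda>x. ln (norm (cp n (?f x) *v push N V (?f x))))"
  proof (rule E_mono[OF fd_comp2[OF fd3 fd4]])
    show "fd (\<lambda>x. ln (norm (cp n (?f x) *v push N V (?f x))))"
      by (rule fd_shift[OF growth_fd[OF past_fieldD(2)[OF W]]])
    fix x
    let ?B = "cp n (?f x)" and ?w = "push N V (?f x)"
    have nw: "norm ?w = 1" by (rule past_fieldD(1)[OF W])
    then have pos: "0 < norm (?B *v ?w)" by (intro cp_norm_pos) auto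
    have B1: "1 \<le> opnorm ?B" by (rule cp_ge1)
    have lnB: "0 \<le> ln (opnorm ?B)" "ln (opnorm ?B) \<le> real n * ln C" using B1 ln_cp_le by auto
    have ld: "ln (\<delta> / 2) \<le> 0" using \<delta> by (subst ln_le_zero_iff) auto
    show "?lhs x \<le> ln (norm (?B *v ?w))"
    proof (cases "\<bar>cross (cp N x *v V x) (?S (?f x))\<bar> < \<delta> * norm (cp N x *v V x)")
      case True
      have "1 \<le> opnorm ?B * norm (?B *v ?w)"
        using norm_le_opnorm_mv[OF cp_det, of ?w n "?f x"] nw by simp
      then have "0 \<le> ln (opnorm ?B * norm (?B *v ?w))" by simp
      also have "\<dots> = ln (opnorm ?B) + ln (norm (?B *v ?w))" using pos B1 by (subst ln_mult_pos) auto
      finally show ?thesis using True lnB ld by (simp add: aligned_def)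
    next
      case False
      let ?u = "cp N x *v V x"
      have "V x \<noteq> 0" using past_fieldD(1)[OF V, of x] by auto
      then have u: "norm ?u > 0" by (rule cp_norm_pos)
      have "\<delta> \<le> \<bar>cross ?w (?S (?f x))\<bar>"
        using False u by (simp add: push_shift sgn_div_norm cross_scale abs_mult field_simps)
      then have "opnorm ?B / 2 * \<delta> \<le> opnorm ?B / 2 * \<bar>cross ?w (?S (?f x))\<bar>"
        using B1 by (intro mult_left_mono) auto
      also have "\<dots> \<le> norm (?B *v ?w)" by (rule cdir)
      finally have "ln (opnorm ?B * (\<delta> / 2)) \<le> ln (norm (?B *v ?w))"
        using B1 \<delta> pos by (subst ln_le_cancel_iff) auto
      then have "ln (opnorm ?B) + ln (\<delta> / 2) \<le> ln (norm (?B *v ?w))"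
        using B1 \<delta> by (subst (asm) ln_mult_pos) auto
      then show ?thesis using False by (simp add: aligned_def)
    qed
  qed
  also have "\<dots> = growth n (push N V)"
    unfolding growth_def by (rule E_shift[OF growth_fd[OF past_fieldD(2)[OF W]]])
  finally show ?thesis .
qed

lemma spread_growth:
  assumes spread and \<epsilon>: "\<epsilon> > 0"
  shows "\<exists>n0\<ge>1. \<forall>V. past_field V \<longrightarrow> real n0 * (lyap L (mu p) - \<epsilon>) \<le> growth n0 V"
proof -
  let ?l = "lyap L (mu p)"
  have lnC: "0 \<le> ln C" using C1 by simp
  \<comment> \<open>Half of the allowed rate \<open>\<epsilon>\<close> pays for aligned points;
    \<open>n\<close> is then taken so large that the other half absorbs the first \<open>N\<close>
    steps and the constant \<open>ln (\<delta> / 2)\<close>.\<close>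
  define e where "e = \<epsilon> / (4 * (ln C + 1))"
  have e: "e > 0" "2 * ln C * e \<le> \<epsilon> / 2"
    using \<epsilon> lnC by (auto simp: e_def field_simps)
  obtain N \<delta>0 where \<delta>0: "\<delta>0 > 0" and sp: "\<And>V S. past_field V \<Longrightarrow> fut_field S \<Longrightarrow> E (aligned N V S \<delta>0) \<le> e"
    using assms(1) e(1) unfolding spread_def by blast
  define \<delta> where "\<delta> = min \<delta>0 1"
  have \<delta>: "0 < \<delta>" "\<delta> \<le> 1" using \<delta>0 by (auto simp: \<delta>_def)
  obtain n :: nat where n: "real n \<ge> 2 * (real N * ?l - ln (\<delta> / 2) + real N * ln C) / \<epsilon>" and n1: "1 \<le> n"
    by (metis real_arch_simple max.bounded_iff of_nat_le_iff of_nat_max)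
  have n2: "real n * (\<epsilon> / 2) \<ge> real N * ?l - ln (\<delta> / 2) + real N * ln C"
    using n \<epsilon> by (simp add: field_simps)
  show ?thesis
  proof (intro exI[of _ "N + n"] conjI allI impI)
    fix V assume V: "past_field V"
    have "E (aligned N V (\<lambda>y. cdir (cp n y)) \<delta>) \<le> E (aligned N V (\<lambda>y. cdir (cp n y)) \<delta>0)"
      by (intro E_mono aligned_fd past_fieldD(2)[OF V] fut_fieldD(2)[OF cdir_fut] aligned_mono) (simp add: \<delta>_def)
    also have "\<dots> \<le> e" by (rule sp[OF V cdir_fut])
    finally have "mlog n + ln (\<delta> / 2) - 2 * real n * ln C * e \<le> growth n (push N V)"
      by (rule growth_push_ge[OF V \<delta>])
    moreover have "- (real N * ln C) \<le> growth N V" by (rule growth_ge[OF V])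
    moreover have "real n * ?l \<le> mlog n" using lyap_le[OF n1] n1 by (simp add: field_simps)
    moreover have "real n * (2 * ln C * e) \<le> real n * (\<epsilon> / 2)" using e by (intro mult_left_mono) auto
    moreover have "0 \<le> real N * \<epsilon>" using \<epsilon> by simp
    ultimately show "real (N + n) * (?l - \<epsilon>) \<le> growth (N + n) V"
      unfolding growth_add[OF V] using n2 by (simp add: algebra_simps)
  qed (use n1 in simp)
qed

end

text \<open>Upper semicontinuity holds because the exponent is an infimum of continuous functions.
  For lower semicontinuity, \<open>spread_growth\<close> gives growth at rate \<open>?l - e\<close>
  at a single time for all past fields. This survives small changes of the finitely many matrices
  involved, and since \<open>past_field\<close> depends on \<open>K\<close> alone, the same fields
  serve every parameter in \<open>lyap_ge_growth\<close>.\<close>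

lemma (in bern) lyap_continuous:
  fixes L :: "real \<Rightarrow> sigma \<Rightarrow> mat2"
  assumes coc: "\<And>t. t \<in> {0..1} \<Longrightarrow> coc p (L t) K C"
    and cont: "\<And>x. continuous_on {0..1} (\<lambda>t. L t x)"
    and spr: "\<And>t. t \<in> {0..1} \<Longrightarrow> coc.spread p (L t) K"
  shows "continuous_on {0..1} (\<lambda>t. lyap (L t) (mu p))"
  unfolding continuous_on_def
proof (intro ballI order_tendstoI)
  fix t0 a :: real assume t0: "t0 \<in> {0..1}"
  interpret L0: coc p "L t0" K C by (rule coc[OF t0])
  have evt: "eventually (\<lambda>t. t \<in> {0..1}) (at t0 within {0..1})"
    by (auto simp: eventually_at_filter)
  {
    assume "lyap (L t0) (mu p) < a"
    then obtain n where n: "1 \<le> n" "L0.mlog n / real n < a"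
      unfolding L0.lyap_eq
      by (subst (asm) cINF_less_iff) (auto intro!: bdd_belowI[of _ 0] divide_nonneg_nonneg L0.mlog_nonneg)
    have Ut: "coc.mlog p (L t) n = E (\<lambda>x. ln (opnorm (cocycle_pow (L t) n x)))" if "t \<in> {0..1}" for t
      by (rule coc.mlog_def[OF coc[OF that]])
    let ?I = "{- int K..<int n + int K}"
    \<comment> \<open>Cut off outside the interval because \<open>E_cont\<close> wants the common
      window for every real parameter.\<close>
    define G where "G t x = (if t \<in> {0..1} then ln (opnorm (cocycle_pow (L t) n x)) else 0)" for t x
    have EG: "E (G t) = coc.mlog p (L t) n" if "t \<in> {0..1}" for t
    proof -
      have "G t = (\<lambda>x. ln (opnorm (cocycle_pow (L t) n x)))" unfolding G_def using that by (intro ext) auto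
      then show ?thesis by (simp add: Ut[OF that])
    qed
    have "continuous_on {0..1} (\<lambda>t. E (G t))"
    proof (rule E_cont[of ?I])
      show "fdep ?I (G t)" for t
      proof (cases "t \<in> {0..1}")
        case True
        then show ?thesis unfolding G_def
          using fdep_comp[OF coc.cp_dep[OF coc[OF True]], where h = "\<lambda>M. ln (opnorm M)"] by simp
      next
        case False
        then have "G t = (\<lambda>x. 0)" unfolding G_def by (intro ext) auto
        then show ?thesis by (simp add: fdep_const)
      qed
      fix x
      have "continuous_on {0..1} (\<lambda>t. ln (opnorm (cocycle_pow (L t) n x)))"
      proof (intro continuous_on_ln continuous_opnorm continuous_cp cont ballI)
        fix t :: real assume "t \<in> {0..1}"
        then show "opnorm (cocycle_pow (L t) n x) \<noteq> 0"
          using coc.cp_ge1[OF coc, of t n x] by auto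
      qed
      then show "continuous_on {0..1} (\<lambda>t. G t x)" by (subst continuous_on_cong[OF refl]) (auto simp: G_def)
    qed simp
    then have "((\<lambda>t. E (G t)) \<longlongrightarrow> E (G t0)) (at t0 within {0..1})" using t0 by (simp add: continuous_on_def)
    then have "((\<lambda>t. E (G t) / real n) \<longlongrightarrow> E (G t0) / real n) (at t0 within {0..1})"
      by (intro tendsto_intros) (use n in auto)
    moreover have "E (G t0) / real n < a" using n by (simp add: EG[OF t0])
    ultimately have "eventually (\<lambda>t. E (G t) / real n < a) (at t0 within {0..1})" by (rule order_tendstoD)
    with evt show "eventually (\<lambda>t. lyap (L t) (mu p) < a) (at t0 within {0..1})"
    proof eventually_elim
      case (elim t)
      have "lyap (L t) (mu p) \<le> coc.mlog p (L t) n / real n" by (rule coc.lyap_le[OF coc[OF elim(1)] n(1)])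
      with elim show ?case by (simp add: EG[OF elim(1)])
    qed
  next
    assume a: "a < lyap (L t0) (mu p)"
    let ?l = "lyap (L t0) (mu p)"
    define e where "e = (?l - a) / 3"
    have e: "e > 0" using a by (simp add: e_def)
    obtain n where n: "1 \<le> n" "\<And>V. L0.past_field V \<Longrightarrow> real n * (?l - e) \<le> L0.growth n V"
      using L0.spread_growth[OF spr[OF t0] e] by blast
    have C1: "1 \<le> C" by (rule L0.C1)
    \<comment> \<open>Unit vectors keep norm at least \<open>1 / C ^ n\<close>, so an error below
      \<open>\<eta>\<close> shrinks the norm at most by the factor
      \<open>exp (- real n * e)\<close>.\<close>
    define \<eta> where "\<eta> = (1 - exp (- real n * e)) / C ^ n"
    have \<eta>: "\<eta> > 0" using n e C1 by (auto simp: \<eta>_def intro!: divide_pos_pos)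
    let ?I = "{- int K..<int n + int K}"
    let ?dif = "\<lambda>t x. opnorm (cocycle_pow (L t) n x - cocycle_pow (L t0) n x)"
    have "eventually (\<lambda>t. ?dif t x < \<eta>) (at t0 within {0..1})" for x
    proof -
      have "continuous_on {0..1} (\<lambda>t. ?dif t x)"
        by (intro continuous_opnorm continuous_on_diff continuous_cp cont continuous_on_const)
      then have "((\<lambda>t. ?dif t x) \<longlongrightarrow> ?dif t0 x) (at t0 within {0..1})" using t0 unfolding continuous_on_def by blast
      moreover have "?dif t0 x < \<eta>" using \<eta> by (simp add: opnorm_def onorm_zero)
      ultimately show ?thesis by (rule order_tendstoD)
    qed
    then have "eventually (\<lambda>t. \<forall>S\<in>Pow ?I. ?dif t (\<lambda>i. i \<in> S) < \<eta>) (at t0 within {0..1})"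
      by (intro eventually_ball_finite) auto
    with evt show "eventually (\<lambda>t. a < lyap (L t) (mu p)) (at t0 within {0..1})"
    proof eventually_elim
      case (elim t)
      interpret Lt: coc p "L t" K C by (rule coc[OF elim(1)])
      have dif: "?dif t x < \<eta>" for x
      proof -
        let ?S = "{i\<in>?I. x i}"
        have "cocycle_pow (L t) n x = cocycle_pow (L t) n (\<lambda>i. i \<in> ?S)"
          by (rule fdepD[OF Lt.cp_dep]) auto
        moreover have "cocycle_pow (L t0) n x = cocycle_pow (L t0) n (\<lambda>i. i \<in> ?S)"
          by (rule fdepD[OF L0.cp_dep]) auto
        moreover have "?S \<in> Pow ?I" by auto
        ultimately show ?thesis using elim(2) by metis
      qed
      have "?l - 2 * e \<le> lyap (L t) (mu p)"
      proof (rule Lt.lyap_ge_growth[OF n(1)])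
        fix V assume V: "Lt.past_field V"
        note fV = Lt.past_fieldD(2)[OF V]
        have "real n * (?l - e) - real n * e \<le> L0.growth n V - real n * e" using n(2)[OF V] by simp
        also have "\<dots> = E (\<lambda>x. ln (norm (cocycle_pow (L t0) n x *v V x)) - real n * e)"
          unfolding L0.growth_def by (subst E_diff[OF L0.growth_fd[OF fV] fd_const]) (simp add: E_const)
        also have "\<dots> \<le> Lt.growth n V"
          unfolding Lt.growth_def
        proof (rule E_mono[OF fd_comp2[OF L0.growth_fd[OF fV] fd_const] Lt.growth_fd[OF fV]])
          fix x
          let ?M = "cocycle_pow (L t) n x" and ?Q = "cocycle_pow (L t0) n x"
          have v: "norm (V x) = 1" by (rule Lt.past_fieldD(1)[OF V])
          then have V0: "V x \<noteq> 0" by auto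
          have pos: "0 < norm (?Q *v V x)" "0 < norm (?M *v V x)"
            using L0.cp_norm_pos[OF V0] Lt.cp_norm_pos[OF V0] by auto
          have "1 \<le> opnorm ?Q * norm (?Q *v V x)"
            using norm_le_opnorm_mv[OF L0.cp_det, of "V x" n x] v by simp
          also have "\<dots> \<le> C ^ n * norm (?Q *v V x)" by (intro mult_right_mono L0.cp_le) simp
          finally have low: "1 / C ^ n \<le> norm (?Q *v V x)" using C1 by (simp add: field_simps)
          have "norm (?Q *v V x) \<le> norm (?M *v V x) + norm ((?M - ?Q) *v V x)"
            using norm_triangle_ineq4[of "?M *v V x" "(?M - ?Q) *v V x"]
            by (simp add: matrix_vector_mult_diff_rdistrib)
          also have "norm ((?M - ?Q) *v V x) \<le> \<eta>"
            using opnorm_mv[of "?M - ?Q" "V x"] dif[of x] unfolding v by linarith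
          also have "\<eta> = (1 - exp (- real n * e)) * (1 / C ^ n)" by (simp add: \<eta>_def)
          also have "\<dots> \<le> (1 - exp (- real n * e)) * norm (?Q *v V x)"
            using e by (intro mult_left_mono low) auto
          finally have "exp (- real n * e) * norm (?Q *v V x) \<le> norm (?M *v V x)"
            by (simp add: algebra_simps)
          then have "ln (exp (- real n * e) * norm (?Q *v V x)) \<le> ln (norm (?M *v V x))"
            using pos by (subst ln_le_cancel_iff) auto
          then show "ln (norm (?Q *v V x)) - real n * e \<le> ln (norm (?M *v V x))"
            using pos by (subst (asm) ln_mult_pos) auto
        qed
        finally show "real n * (?l - 2 * e) \<le> Lt.growth n V" by (simp add: algebra_simps)
      qed
      then show ?case using a by (simp add: e_def field_simps)
    qed
  }
qed

section \<open>Non-concentration of directions\<close>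

lemma quadratic_coeffs_zero:
  fixes x y z :: real
  assumes "a * x\<^sup>2 + b * x + c = 0" "a * y\<^sup>2 + b * y + c = 0" "a * z\<^sup>2 + b * z + c = 0"
    and "x \<noteq> y" "x \<noteq> z" "y \<noteq> z"
  shows "a = 0 \<and> b = 0 \<and> c = 0"
proof -
  have "(x - y) * (a * (x + y) + b) = 0" using assms(1,2) by algebra
  then have 1: "a * (x + y) + b = 0" using assms by simp
  have "(x - z) * (a * (x + z) + b) = 0" using assms(1,3) by algebra
  then have 2: "a * (x + z) + b = 0" using assms by simp
  have "a * (y - z) = 0" using 1 2 by algebra
  then have a: "a = 0" using assms by simp
  then have "b = 0" using 1 by simp
  with a show ?thesis using assms(1) by simp
qed

text \<open>Windows without adjacent zeros contain no marker of length at least 2, so there the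
  perturbed cocycle shows no shear. The randomness of such windows alone will spread all directions,
  whatever the cocycle does elsewhere.\<close>

locale plain = coc +
  fixes s n11 n12 n21 n22 :: real
  assumes s1: "s > 1"
    and nz: "n11 \<noteq> 0" "n12 \<noteq> 0" "n21 \<noteq> 0" "n22 \<noteq> 0"
    and plain: "(\<And>i. - int K \<le> i \<Longrightarrow> i < int K \<Longrightarrow> x i \<or> x (i + 1)) \<Longrightarrow>
       L x = (if x 0 then mk2 s 0 0 (1 / s) else mk2 n11 n12 n21 n22)"
begin

definition Dp :: "nat \<Rightarrow> mat2" where "Dp n = mk2 (s ^ n) 0 0 (1 / s ^ n)"
definition Nm :: mat2 where "Nm = mk2 n11 n12 n21 n22"

text \<open>\<open>Mj k j\<close> is the matrix of the word \<open>1\<^bsup>K+k-j\<^esup> 0 1\<^sup>j 0 1\<^sup>K\<close>; only the position of the first 0 depends on \<open>j\<close>.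
  That \<open>Mj k j\<close> maps one given direction to another is a quadratic equation for \<open>s\<^bsup>2j\<^esup>\<close>, so at most two
  of the \<open>k\<close> words can do this.\<close>

definition Mj :: "nat \<Rightarrow> nat \<Rightarrow> mat2" where
  "Mj k j = Dp K ** (Nm ** (Dp j ** (Nm ** Dp (K + (k - j)))))"

lemma cp_ones:
  "(\<And>\<tau>. \<tau> < n \<Longrightarrow> L ((shift ^^ \<tau>) y) = mk2 s 0 0 (1 / s)) \<Longrightarrow> cp n y = Dp n"
  by (induction n) (simp_all add: Dp_def mat1_mk2 mk2_mult)

lemma mv_nonzero:
  assumes "det M \<noteq> 0" "(v :: real^2) \<noteq> 0" shows "(M :: mat2) *v v \<noteq> 0"
proof
  assume "M *v v = 0"
  then have "cross (M *v v) (M *v w) = 0" for w by (simp add: cross_def)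
  then have c: "cross v w = 0" for w using assms by (simp add: cross_mv_mv)
  have "v$1 = 0" "v$2 = 0" using c[of "axis 2 1"] c[of "axis 1 1"] by (simp_all add: cross_def axis_def)
  then show False using assms(2) by (simp add: vec_eq_iff forall_2)
qed

lemma det_Nm: "det Nm = 1"
  using plain[of "\<lambda>i. i \<noteq> 0"] Ldet[of "\<lambda>i. i \<noteq> 0"] by (simp add: Nm_def)

lemma det_Dp: "det (Dp n) = 1"
  using s1 by (simp add: Dp_def)

lemma three_words:
  assumes w: "w \<noteq> 0" and z: "z \<noteq> 0"
    and j: "j1 \<noteq> j2" "j1 \<noteq> j3" "j2 \<noteq> j3" "j1 \<le> k" "j2 \<le> k" "j3 \<le> k"
    and c: "cross (Mj k j1 *v w) z = 0" "cross (Mj k j2 *v w) z = 0" "cross (Mj k j3 *v w) z = 0"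
  shows False
proof -
  \<comment> \<open>The number of ones in front of the last 0 does not depend on \<open>j\<close>.
    Expressed through \<open>\<omega>\<close> and \<open>\<zeta>\<close>, the condition therefore
    contains \<open>j\<close> only in the power \<open>s ^ (2 * j)\<close>.\<close>
  define \<omega> where "\<omega> = Dp (K + k) *v w"
  define \<zeta> where "\<zeta> = adj2 (Dp K ** Nm) *v z"
  have \<omega>0: "\<omega> \<noteq> 0" unfolding \<omega>_def by (rule mv_nonzero) (use w det_Dp in auto)
  have \<zeta>0: "\<zeta> \<noteq> 0" unfolding \<zeta>_def
    by (rule mv_nonzero) (use z s1 det_Dp[of K] det_Nm in \<open>auto simp: adj2_def det_2 Dp_def Nm_def algebra_simps\<close>)
  have q: "(n12 * \<omega>$2 * \<zeta>$2) * (s ^ (2 * j))\<^sup>2 + (n11 * \<omega>$1 * \<zeta>$2 - n22 * \<omega>$2 * \<zeta>$1) * s ^ (2 * j)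
       + (- n21 * \<omega>$1 * \<zeta>$1) = 0"
    if "j \<le> k" "cross (Mj k j *v w) z = 0" for j
  proof -
    define v where "v = s ^ j"
    have v: "v > 0" using s1 by (simp add: v_def)
    have vk: "s ^ (K + k) = s ^ (K + (k - j)) * v"
      using that by (simp add: v_def flip: power_add)
    have sK: "s ^ (K + (k - j)) > 0" using s1 by simp
    have v2: "s ^ (2 * j) = v * v" by (simp add: v_def mult_2 power_add)
    have w1: "w$1 * s ^ (K + (k - j)) = \<omega>$1 / v" and w2: "w$2 / s ^ (K + (k - j)) = \<omega>$2 * v"
      using v sK by (simp_all add: \<omega>_def Dp_def mv_nth vk)
    have "0 = cross (Dp K ** Nm *v (Dp j *v (Nm *v (Dp (K + (k - j)) *v w)))) z"
      using that(2) by (simp add: Mj_def matrix_vector_mul_assoc matrix_mul_assoc)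
    also have "\<dots> = cross (Dp j *v (Nm *v (Dp (K + (k - j)) *v w))) \<zeta>"
      unfolding \<zeta>_def by (rule cross_mv)
    also have "\<dots> = v * (n11 * (w$1 * s ^ (K + (k - j))) + n12 * (w$2 / s ^ (K + (k - j)))) * \<zeta>$2
        - (n21 * (w$1 * s ^ (K + (k - j))) + n22 * (w$2 / s ^ (K + (k - j)))) / v * \<zeta>$1"
      by (simp add: cross_def mv_nth Dp_def Nm_def v_def algebra_simps add_divide_distrib)
    also have "\<dots> = (n11 * \<omega>$1 + n12 * \<omega>$2 * (v * v)) * \<zeta>$2 - (n21 * \<omega>$1 / (v * v) + n22 * \<omega>$2) * \<zeta>$1"
      unfolding w1 w2 using v by (simp add: field_simps)
    finally have "0 = (v * v) * ((n11 * \<omega>$1 + n12 * \<omega>$2 * (v * v)) * \<zeta>$2 - (n21 * \<omega>$1 / (v * v) + n22 * \<omega>$2) * \<zeta>$1)"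
      by simp
    also have "\<dots> = (n12 * \<omega>$2 * \<zeta>$2) * (v * v)\<^sup>2 + (n11 * \<omega>$1 * \<zeta>$2 - n22 * \<omega>$2 * \<zeta>$1) * (v * v)
       + (- n21 * \<omega>$1 * \<zeta>$1)"
      using v by (simp add: field_simps power2_eq_square)
    finally show ?thesis unfolding v2 by simp
  qed
  have inj: "s ^ (2 * i) \<noteq> s ^ (2 * j)" if "i \<noteq> j" for i j :: nat
    using that s1 by (simp add: power_inject_exp)
  have "n12 * \<omega>$2 * \<zeta>$2 = 0 \<and> n11 * \<omega>$1 * \<zeta>$2 - n22 * \<omega>$2 * \<zeta>$1 = 0 \<and> - n21 * \<omega>$1 * \<zeta>$1 = 0"
    by (rule quadratic_coeffs_zero[OF q[OF j(4) c(1)] q[OF j(5) c(2)] q[OF j(6) c(3)] inj[OF j(1)] inj[OF j(2)] inj[OF j(3)]])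
  \<comment> \<open>The outer coefficients leave the cases that one vector vanishes or that
    \<open>\<omega>\<close> and \<open>\<zeta>\<close> lie on different axes; the middle coefficient
    excludes the latter.\<close>
  then have "\<omega>$2 = 0 \<or> \<zeta>$2 = 0" "\<omega>$1 = 0 \<or> \<zeta>$1 = 0" "n11 * \<omega>$1 * \<zeta>$2 = n22 * \<omega>$2 * \<zeta>$1"
    using nz by auto
  then have "\<omega> = 0 \<or> \<zeta> = 0" using nz by (auto simp: vec_eq_iff forall_2)
  then show False using \<omega>0 \<zeta>0 by simp
qed

text \<open>Compactness makes \<open>three_words\<close> quantitative: for each triple the sum of
  the three areas has a positive minimum over pairs of unit vectors, and below a third of it three
  areas cannot be small together.\<close>

lemma separation:
  "\<exists>\<delta>>0. \<forall>w z. norm w = 1 \<longrightarrow> norm z = 1 \<longrightarrow> card {j\<in>{1..k}. \<bar>cross (Mj k j *v w) z\<bar> < \<delta>} \<le> 2"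
proof -
  let ?T = "{T. T \<subseteq> {1..k} \<and> card T = 3}"
  let ?f = "\<lambda>T (w, z). \<Sum>j\<in>T. \<bar>cross (Mj k j *v w) z\<bar>"
  let ?X = "sphere (0::real^2) 1 \<times> sphere (0::real^2) 1"
  have "\<exists>d>0. \<forall>wz\<in>?X. d \<le> ?f T wz" if T: "T \<in> ?T" for T
  proof -
    have cont: "continuous_on ?X (?f T)"
      unfolding cross_def mv_nth case_prod_beta by (intro continuous_intros)
    obtain wz where wz: "wz \<in> ?X" "\<forall>y\<in>?X. ?f T wz \<le> ?f T y"
    proof -
      have "compact ?X" by (intro compact_Times) auto
      moreover have "?X \<noteq> {}"
        using norm_axis_1[where 'a = 2] by (auto intro!: exI[of _ "axis 1 1"])
      ultimately show ?thesis using continuous_attains_inf[OF _ _ cont] that by blast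
    qed
    obtain w z where [simp]: "wz = (w, z)" by fastforce
    have nz: "w \<noteq> 0" "z \<noteq> 0" using wz(1) by auto
    obtain j1 j2 j3 where j: "T = {j1, j2, j3}" "j1 \<noteq> j2" "j2 \<noteq> j3" "j1 \<noteq> j3"
      using T card_3_iff[of T] by auto
    have "?f T wz > 0"
    proof (rule ccontr)
      assume n: "\<not> ?thesis"
      have "(\<Sum>j\<in>T. \<bar>cross (Mj k j *v w) z\<bar>) \<ge> 0" by (rule sum_nonneg) simp
      with n have "(\<Sum>j\<in>T. \<bar>cross (Mj k j *v w) z\<bar>) = 0" by simp
      moreover have "finite T" using j by simp
      ultimately have "\<forall>j\<in>T. cross (Mj k j *v w) z = 0" by (simp add: sum_nonneg_eq_0_iff)
      then show False using three_words[OF nz, of j1 j2 j3 k] j T by auto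
    qed
    with wz show ?thesis by blast
  qed
  then have "\<forall>T\<in>?T. \<exists>d>0. \<forall>wz\<in>?X. d \<le> ?f T wz" by blast
  from bchoice[OF this] obtain d where "\<forall>T\<in>?T. 0 < d T \<and> (\<forall>wz\<in>?X. d T \<le> ?f T wz)" ..
  then have d: "\<And>T. T \<in> ?T \<Longrightarrow> d T > 0" "\<And>T wz. T \<in> ?T \<Longrightarrow> wz \<in> ?X \<Longrightarrow> d T \<le> ?f T wz"
    by blast+
  have finT: "finite ?T" by (rule finite_subset[of _ "Pow {1..k}"]) auto
  define \<delta> where "\<delta> = Min (insert 1 (d ` ?T)) / 3"
  have \<delta>: "\<delta> > 0" using d(1) finT by (auto simp: \<delta>_def)
  have \<delta>T: "3 * \<delta> \<le> d T" if "T \<in> ?T" for T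
    using that finT by (auto simp: \<delta>_def)
  show ?thesis
  proof (intro exI[of _ \<delta>] conjI allI impI \<delta>)
    fix w z :: "real^2" assume n: "norm w = 1" "norm z = 1"
    show "card {j\<in>{1..k}. \<bar>cross (Mj k j *v w) z\<bar> < \<delta>} \<le> 2"
    proof (rule ccontr)
      assume "\<not> ?thesis"
      then have "3 \<le> card {j\<in>{1..k}. \<bar>cross (Mj k j *v w) z\<bar> < \<delta>}" by simp
      then obtain T where T: "T \<subseteq> {j\<in>{1..k}. \<bar>cross (Mj k j *v w) z\<bar> < \<delta>}" "card T = 3"
        by (rule obtain_subset_with_card_n)
      then have TT: "T \<in> ?T" by auto
      have "T \<noteq> {}" "finite T" using T(2) by (auto intro: card_ge_0_finite)
      then have "?f T (w, z) < (\<Sum>j\<in>T. \<delta>)" using T by (simp only: prod.case) (intro sum_strict_mono, auto)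
      also have "\<dots> = 3 * \<delta>" using T by simp
      also have "\<dots> \<le> d T" by (rule \<delta>T[OF TT])
      also have "\<dots> \<le> ?f T (w, z)" by (rule d(2)[OF TT]) (use n in auto)
      finally show False by simp
    qed
  qed
qed

text \<open>The block lasts \<open>2 * K + 1\<close> steps before the word,
  \<open>2 * K + k + 2\<close> steps along it and \<open>2 * K + 1\<close> steps after it. The
  windows of the middle steps then lie inside \<open>Jb\<close>, while those of the outer steps miss
  both zeros of \<open>word\<close>.\<close>

definition blk :: "nat \<Rightarrow> nat" where "blk k = 6 * K + k + 4"

text \<open>Starts just beyond the coordinates up to r + K, which a past field and the first
  \<open>r\<close> matrices may see, and stops just before those seen by a future field at time r +
  blk k.\<close>

definition Jb :: "nat \<Rightarrow> nat \<Rightarrow> int set" where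
  "Jb r k = {int r + int K + 1 ..< int r + int (blk k) - int K}"

definition word :: "nat \<Rightarrow> nat \<Rightarrow> nat \<Rightarrow> int set" where
  "word r k j = Jb r k - {int r + 3 * int K + 1 + int k - int j, int r + 3 * int K + int k + 2}"

lemma finite_Jb: "finite (Jb r k)" by (simp add: Jb_def)

lemma card_Jb: "card (Jb r k) = 4 * K + k + 3"
  by (simp add: Jb_def blk_def)

lemma word_inj: "inj_on (word r k) {1..k}"
proof (rule inj_onI)
  fix i j assume ij: "i \<in> {1..k}" "j \<in> {1..k}" "word r k i = word r k j"
  have "int r + 3 * int K + 1 + int k - int i \<in> Jb r k" using ij by (auto simp: Jb_def blk_def)
  moreover have "int r + 3 * int K + 1 + int k - int i \<notin> word r k i" by (simp add: word_def)
  ultimately have "int r + 3 * int K + 1 + int k - int i \<in> {int r + 3 * int K + 1 + int k - int j, int r + 3 * int K + int k + 2}"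
    unfolding ij(3) by (simp add: word_def)
  then show "i = j" using ij by auto
qed

text \<open>As \<open>j\<close> is at least 1, the two zeros are not adjacent, and
  \<open>plain\<close> applies at every step of the word.\<close>

lemma cp_word:
  assumes j: "1 \<le> j" "j \<le> k"
  shows "cp (2 * K + k + 2) ((shift ^^ (r + 2 * K + 1)) (overwrite (Jb r k) (word r k j) x)) = Mj k j"
proof -
  define y where "y = (shift ^^ (r + 2 * K + 1)) (overwrite (Jb r k) (word r k j) x)"
  have y: "y i = (i \<noteq> int K + int k - int j \<and> i \<noteq> int K + int k + 1)" if "- int K \<le> i" "i \<le> 3 * int K + int k + 1" for i
  proof -
    have "y i = overwrite (Jb r k) (word r k j) x (i + int (r + 2 * K + 1))" unfolding y_def shift_pow by (rule refl)
    then show ?thesis using that j by (auto simp: overwrite_def word_def Jb_def blk_def)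
  qed
  have Ly: "L ((shift ^^ \<tau>) y) = (if \<tau> \<noteq> K + (k - j) \<and> \<tau> \<noteq> K + k + 1 then mk2 s 0 0 (1 / s) else Nm)"
    if "\<tau> < 2 * K + k + 2" for \<tau>
  proof -
    have "L ((shift ^^ \<tau>) y) = (if (shift ^^ \<tau>) y 0 then mk2 s 0 0 (1 / s) else mk2 n11 n12 n21 n22)"
    proof (rule plain)
      fix i assume i: "- int K \<le> i" "i < int K"
      have "y (i + int \<tau>) = (i + int \<tau> \<noteq> int K + int k - int j \<and> i + int \<tau> \<noteq> int K + int k + 1)"
        by (rule y) (use i that in auto)
      moreover have "y (i + int \<tau> + 1) = (i + int \<tau> + 1 \<noteq> int K + int k - int j \<and> i + int \<tau> + 1 \<noteq> int K + int k + 1)"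
        by (rule y) (use i that in auto)
      ultimately show "(shift ^^ \<tau>) y i \<or> (shift ^^ \<tau>) y (i + 1)"
        using j by (auto simp: shift_pow algebra_simps)
    qed
    moreover have "(shift ^^ \<tau>) y 0 = (int \<tau> \<noteq> int K + int k - int j \<and> int \<tau> \<noteq> int K + int k + 1)"
      using y[of "int \<tau>"] that by (simp add: shift_pow)
    moreover have "(int \<tau> \<noteq> int K + int k - int j) = (\<tau> \<noteq> K + (k - j))" "(int \<tau> \<noteq> int K + int k + 1) = (\<tau> \<noteq> K + k + 1)"
      using j by auto
    ultimately show ?thesis by (simp add: Nm_def)
  qed
  have sh: "(shift ^^ m) ((shift ^^ n) y) = (shift ^^ (n + m)) y" for m n
    by (simp add: shift_pow algebra_simps)
  have e: "2 * K + k + 2 = (K + (k - j)) + (1 + (j + (1 + K)))" using j by simp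
  have 1: "cp (K + (k - j)) y = Dp (K + (k - j))"
    by (rule cp_ones) (use Ly j in auto)
  have 2: "cp 1 ((shift ^^ (K + (k - j))) y) = Nm"
    using Ly[of "K + (k - j)"] j by simp
  have 3: "cp j ((shift ^^ 1) ((shift ^^ (K + (k - j))) y)) = Dp j"
    by (rule cp_ones) (use Ly j in \<open>auto simp only: sh\<close>, auto)
  have 4: "cp 1 ((shift ^^ j) ((shift ^^ 1) ((shift ^^ (K + (k - j))) y))) = Nm"
  proof -
    have "K + (k - j) + 1 + j = K + k + 1" using j by simp
    then show ?thesis using Ly[of "K + k + 1"] unfolding sh by simp
  qed
  have 5: "cp K ((shift ^^ 1) ((shift ^^ j) ((shift ^^ 1) ((shift ^^ (K + (k - j))) y)))) = Dp K"
    by (rule cp_ones) (use Ly j in \<open>auto simp only: sh\<close>, auto)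
  show ?thesis
    unfolding y_def[symmetric] e
    by (simp only: cp_add[of L "K + (k - j)" "1 + (j + (1 + K))"] cp_add[of L 1 "j + (1 + K)"]
        cp_add[of L j "1 + K"] cp_add[of L 1 K] 1 2 3 4 5 Mj_def matrix_mul_assoc)
qed

section \<open>Alignment probabilities under resampling of a block\<close>

lemma opnorm_adj_mv: "norm (v :: real^2) = 1 \<Longrightarrow> 1 \<le> opnorm (cp n x) * norm (adj2 (cp n x) *v v)"
  using opnorm_mv[of "cp n x" "adj2 (cp n x) *v v"] mv_adj2[of "cp n x" v]
  by (simp add: cp_det)

lemma adj_nz: "norm (v :: real^2) = 1 \<Longrightarrow> adj2 (cp n x) *v v \<noteq> 0"
  using opnorm_adj_mv[of v n x] by auto

lemma cp_nz: "v \<noteq> 0 \<Longrightarrow> cp n x *v v \<noteq> 0"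
  using cp_norm_pos[of v n x] by simp

lemma norm_adj_ge: assumes "norm (v :: real^2) = 1" shows "1 / C ^ n \<le> norm (adj2 (cp n x) *v v)"
proof -
  have "1 \<le> opnorm (cp n x) * norm (adj2 (cp n x) *v v)" by (rule opnorm_adj_mv[OF assms])
  also have "\<dots> \<le> C ^ n * norm (adj2 (cp n x) *v v)" by (intro mult_right_mono cp_le) simp
  finally show ?thesis using C1 by (simp add: field_simps)
qed

text \<open>By \<open>cross_mv\<close>, alignment after a product can be tested before it against
  the direction pulled back by the adjugate. Comparing norms costs \<open>C ^ l\<close> for the
  image vector and \<open>C ^ n\<close> for the pulled direction.\<close>

lemma pull_cross:
  assumes S: "norm (S :: real^2) = 1" and \<delta>: "0 \<le> \<delta>"
    and c: "\<bar>cross (cp n y *v w) S\<bar> < \<delta> * m" "m \<le> C ^ l * norm w"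
  shows "\<bar>cross w (sgn (adj2 (cp n y) *v S))\<bar> < \<delta> * C ^ (l + n) * norm w"
proof -
  let ?a = "adj2 (cp n y) *v S"
  have Cn: "C ^ n > 0" "C ^ l > 0" using C1 by auto
  have a: "1 / C ^ n \<le> norm ?a" by (rule norm_adj_ge[OF S])
  then have a0: "norm ?a > 0" using Cn by (smt (verit) divide_pos_pos)
  have i: "inverse (norm ?a) \<le> C ^ n" using a a0 Cn by (simp add: field_simps)
  have "\<bar>cross w ?a\<bar> < \<delta> * m" using c(1) by (simp add: cross_mv)
  also have "\<dots> \<le> \<delta> * (C ^ l * norm w)" using c(2) \<delta> by (rule mult_left_mono)
  finally have lt: "\<bar>cross w ?a\<bar> < \<delta> * C ^ l * norm w" by simp
  have "\<bar>cross w (sgn ?a)\<bar> = inverse (norm ?a) * \<bar>cross w ?a\<bar>"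
    by (simp add: sgn_div_norm cross_scale abs_mult)
  also have "\<dots> \<le> C ^ n * \<bar>cross w ?a\<bar>" using i by (rule mult_right_mono) simp
  also have "\<dots> < C ^ n * (\<delta> * C ^ l * norm w)" using lt Cn by simp
  finally show ?thesis by (simp add: power_add algebra_simps)
qed

text \<open>Whatever is written in the block, alignment after it forces alignment before it with
  another future field at a coarser scale. Hence no word can make the probability worse than the
  uniform bound at time \<open>r\<close>.\<close>

lemma aligned_pull:
  assumes V: "past_field V" and S: "fut_field S" and \<delta>: "0 \<le> \<delta>"
  shows "\<exists>S'. fut_field S' \<and> (\<forall>x. aligned (r + blk k) V S \<delta> (overwrite (Jb r k) \<omega> x) \<le> aligned r V S' (\<delta> * C ^ (2 * blk k)) x)"
proof -
  obtain I where I: "finite I" "I \<subseteq> {- int K..}" "fdep I S" and nS: "\<And>x. norm (S x) = 1"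
    using S unfolding fut_field_def by blast
  obtain I' where I': "I' \<subseteq> {..int K}" "fdep I' V" and nV: "\<And>x. norm (V x) = 1"
    using V unfolding past_field_def by blast
  let ?o = "overwrite (Jb r k) \<omega>"
  define B where "B x = cp (blk k) ((shift ^^ r) (?o x))" for x
  define T where "T x = sgn (adj2 (B x) *v S ((shift ^^ (r + blk k)) (?o x)))" for x
  define S' where "S' y = T (\<lambda>i. y (i - int r))" for y
  have S'x: "S' ((shift ^^ r) x) = T x" for x by (simp add: S'_def shift_pow)
  let ?I = "{int r - int K..<int r + int (blk k) + int K} \<union> (\<lambda>i. i + int (r + blk k)) ` I"
  have fB: "fdep ?I B" unfolding B_def[abs_def]
  proof (rule fdepI)
    fix x x' :: sigma assume eq: "\<And>i. i \<in> ?I \<Longrightarrow> x i = x' i"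
    show "cp (blk k) ((shift ^^ r) (?o x)) = cp (blk k) ((shift ^^ r) (?o x'))"
      by (rule fdepD[OF cp_dep]) (simp add: shift_pow overwrite_def eq)
  qed
  have fS: "fdep ?I (\<lambda>x. S ((shift ^^ (r + blk k)) (?o x)))"
  proof (rule fdepI)
    fix x x' :: sigma assume eq: "\<And>i. i \<in> ?I \<Longrightarrow> x i = x' i"
    show "S ((shift ^^ (r + blk k)) (?o x)) = S ((shift ^^ (r + blk k)) (?o x'))"
      by (rule fdepD[OF I(3)]) (simp add: shift_pow overwrite_def eq del: of_nat_add)
  qed
  have fT: "fdep ?I T" unfolding T_def[abs_def]
    by (rule fdep_comp2[OF fB fS, where h = "\<lambda>B s. sgn (adj2 B *v s)"])
  have "fdep ((\<lambda>i. i - int r) ` ?I) S'"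
    unfolding S'_def by (rule fdepI, rule fdepD[OF fT]) blast
  moreover have "(\<lambda>i. i - int r) ` ?I \<subseteq> {- int K..}" using I(2) by force
  moreover have "finite ((\<lambda>i. i - int r) ` ?I)" using I(1) by simp
  moreover have "norm (S' y) = 1" for y
  proof -
    have "adj2 (B x) *v S ((shift ^^ (r + blk k)) (?o x)) \<noteq> 0" for x
      unfolding B_def by (rule adj_nz[OF nS])
    then show ?thesis by (simp add: S'_def T_def norm_sgn)
  qed
  ultimately have "fut_field S'" unfolding fut_field_def by blast
  moreover have "aligned (r + blk k) V S \<delta> (?o x) \<le> aligned r V S' (\<delta> * C ^ (2 * blk k)) x" for x
  proof (cases "\<bar>cross (cp (r + blk k) (?o x) *v V (?o x)) (S ((shift ^^ (r + blk k)) (?o x)))\<bar>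
      < \<delta> * norm (cp (r + blk k) (?o x) *v V (?o x))")
    case True
    let ?w = "cp r x *v V x"
    have "cp r (?o x) = cp r x"
      by (rule fdep_overwrite_same[OF cp_dep]) (auto simp: Jb_def)
    moreover have "V (?o x) = V x"
      by (rule fdep_overwrite_same[OF I'(2)]) (use I'(1) in \<open>auto simp: Jb_def\<close>)
    ultimately have e: "cp (r + blk k) (?o x) *v V (?o x) = B x *v ?w"
      by (simp add: cp_add B_def matrix_vector_mul_assoc)
    have "norm (B x *v ?w) \<le> opnorm (B x) * norm ?w" by (rule opnorm_mv)
    also have "\<dots> \<le> C ^ blk k * norm ?w" unfolding B_def by (intro mult_right_mono cp_le) simp
    finally have "norm (B x *v ?w) \<le> C ^ blk k * norm ?w" .
    from pull_cross[OF nS \<delta> _ this[unfolded B_def], of "blk k" "(shift ^^ r) (?o x)" "(shift ^^ (r + blk k)) (?o x)" ]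
    have "\<bar>cross ?w (T x)\<bar> < \<delta> * C ^ (2 * blk k) * norm ?w"
      using True unfolding e by (simp add: B_def T_def mult_2)
    then show ?thesis by (simp add: aligned_def S'x)
  qed (simp add: aligned_def)
  ultimately show ?thesis by blast
qed

text \<open>With \<open>x\<close> fixed outside the block, the words differ only through
  \<open>Mj k j\<close>: the incoming direction \<open>F *v w\<close> and the pulled-back target
  \<open>z\<close> are the same for all of them, so \<open>separation\<close> applies.\<close>

lemma words_le2:
  assumes V: "past_field V" and S: "fut_field S" and \<delta>: "0 \<le> \<delta>"
    and sep: "\<And>w z. norm w = 1 \<Longrightarrow> norm z = 1 \<Longrightarrow> card {j\<in>{1..k}. \<bar>cross (Mj k j *v w) z\<bar> < \<delta>1} \<le> 2"
    and small: "\<delta> * C ^ (2 * blk k) \<le> \<delta>1"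
  shows "(\<Sum>j\<in>{1..k}. aligned (r + blk k) V S \<delta> (overwrite (Jb r k) (word r k j) x)) \<le> 2"
proof -
  obtain I where I: "finite I" "I \<subseteq> {- int K..}" "fdep I S" and nS: "\<And>x. norm (S x) = 1"
    using S unfolding fut_field_def by blast
  obtain I' where I': "I' \<subseteq> {..int K}" "fdep I' V" and nV: "\<And>x. norm (V x) = 1"
    using V unfolding past_field_def by blast
  let ?J = "Jb r k"
  let ?o = "\<lambda>j. overwrite ?J (word r k j) x"
  \<comment> \<open>The windows of the outer parts miss the zeros, so filling the block with ones
    gives the same \<open>F\<close> and \<open>G\<close> as every word.\<close>
  let ?base = "overwrite ?J ?J x"
  define F where "F = cp (2 * K + 1) ((shift ^^ r) ?base)"
  define y where "y = (shift ^^ (r + 4 * K + k + 3)) ?base"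
  define G where "G = cp (2 * K + 1) y"
  define w where "w = cp r x *v V x"
  define t where "t = S ((shift ^^ (r + blk k)) x)"
  have "V x \<noteq> 0" using nV[of x] by auto
  then have w0: "w \<noteq> 0" unfolding w_def by (rule cp_nz)
  then have Fw0: "F *v w \<noteq> 0" unfolding F_def by (rule cp_nz)
  have t1: "norm t = 1" by (simp add: t_def nS)
  define z where "z = sgn (adj2 G *v t)"
  have "adj2 G *v t \<noteq> 0"
    unfolding G_def by (rule adj_nz[OF t1])
  then have z1: "norm z = 1" by (simp add: z_def norm_sgn)
  have key: "\<bar>cross (Mj k j *v sgn (F *v w)) z\<bar> < \<delta>1"
    if j: "j \<in> {1..k}" and e: "aligned (r + blk k) V S \<delta> (?o j) \<noteq> 0" for j
  proof -
    have j': "1 \<le> j" "j \<le> k" using j by auto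
    have st: "S ((shift ^^ (r + blk k)) (?o j)) = t"
      unfolding t_def by (rule fdepD[OF I(3)]) (use I(2) in \<open>auto simp: shift_pow overwrite_def Jb_def\<close>)
    have "cp r (?o j) = cp r x"
      by (rule fdep_overwrite_same[OF cp_dep]) (auto simp: Jb_def)
    moreover have "V (?o j) = V x"
      by (rule fdep_overwrite_same[OF I'(2)]) (use I'(1) in \<open>auto simp: Jb_def\<close>)
    ultimately have w': "cp r (?o j) *v V (?o j) = w" by (simp add: w_def)
    have F': "cp (2 * K + 1) ((shift ^^ r) (?o j)) = F"
      unfolding F_def
      by (rule fdepD[OF cp_dep]) (use j' in \<open>auto simp: shift_pow overwrite_def word_def\<close>)
    have G': "cp (2 * K + 1) ((shift ^^ (r + 4 * K + k + 3)) (?o j)) = G"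
      unfolding G_def y_def
      by (rule fdepD[OF cp_dep]) (use j' in \<open>auto simp only: shift_pow overwrite_def word_def\<close>, auto)
    have sh: "(shift ^^ m) ((shift ^^ n) u) = (shift ^^ (n + m)) u" for m n u
      by (simp add: shift_pow algebra_simps)
    have "r + blk k = r + ((2 * K + 1) + ((2 * K + k + 2) + (2 * K + 1)))" by (simp add: blk_def)
    moreover have "r + (2 * K + 1) = r + 2 * K + 1" by simp
    moreover have "r + 2 * K + 1 + (2 * K + k + 2) = r + 4 * K + k + 3" by simp
    ultimately have B: "cp (r + blk k) (?o j) *v V (?o j) = G *v (Mj k j *v (F *v w))"
      by (simp only: cp_add[of L r "(2 * K + 1) + ((2 * K + k + 2) + (2 * K + 1))"]
          cp_add[of L "2 * K + 1" "(2 * K + k + 2) + (2 * K + 1)"] cp_add[of L "2 * K + k + 2" "2 * K + 1"] sh F' G' cp_word[OF j'] matrix_vector_mul_assoc[symmetric] w')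
    have "norm (G *v (Mj k j *v (F *v w))) \<le> opnorm G * norm (Mj k j *v (F *v w))" by (rule opnorm_mv)
    also have "\<dots> \<le> C ^ (2 * K + 1) * norm (Mj k j *v (F *v w))" unfolding G_def by (intro mult_right_mono cp_le) simp
    finally have n: "norm (G *v (Mj k j *v (F *v w))) \<le> C ^ (2 * K + 1) * norm (Mj k j *v (F *v w))" .
    have "\<bar>cross (Mj k j *v (F *v w)) z\<bar> < \<delta> * C ^ ((2 * K + 1) + (2 * K + 1)) * norm (Mj k j *v (F *v w))"
      unfolding z_def G_def
      by (rule pull_cross[OF t1 \<delta> _ n[unfolded G_def]]) (use e in \<open>auto simp: aligned_def B st G_def split: if_splits\<close>)
    also have "norm (Mj k j *v (F *v w)) \<le> C ^ (2 * K + k + 2) * norm (F *v w)"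
    proof -
      have "opnorm (Mj k j) \<le> C ^ (2 * K + k + 2)"
        using cp_le[of "2 * K + k + 2" "(shift ^^ (r + 2 * K + 1)) (?o j)"] unfolding cp_word[OF j'] .
      then show ?thesis using opnorm_mv[of "Mj k j" "F *v w"]
        by (meson mult_right_mono norm_ge_zero order_trans)
    qed
    finally have "\<bar>cross (Mj k j *v (F *v w)) z\<bar> < \<delta> * C ^ ((2 * K + 1) + (2 * K + 1)) * (C ^ (2 * K + k + 2) * norm (F *v w))"
      using \<delta> C1 by (simp add: mult_left_mono)
    also have "\<dots> = \<delta> * C ^ blk k * norm (F *v w)"
    proof -
      have "C ^ ((2 * K + 1) + (2 * K + 1)) * C ^ (2 * K + k + 2) = C ^ blk k"
        unfolding blk_def power_add[symmetric] by (rule arg_cong[where f = "\<lambda>n. C ^ n"]) simp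
      then show ?thesis by (metis mult.assoc)
    qed
    also have "\<dots> \<le> \<delta>1 * norm (F *v w)"
    proof (rule mult_right_mono)
      have "\<delta> * C ^ blk k \<le> \<delta> * C ^ (2 * blk k)" using C1 \<delta> by (intro mult_left_mono power_increasing) auto
      with small show "\<delta> * C ^ blk k \<le> \<delta>1" by linarith
    qed simp
    finally have "\<bar>cross (Mj k j *v (F *v w)) z\<bar> < \<delta>1 * norm (F *v w)" .
    then show ?thesis using Fw0
      by (simp add: sgn_div_norm matrix_vector_mult_scaleR cross_scale abs_mult field_simps)
  qed
  have "(\<Sum>j\<in>{1..k}. aligned (r + blk k) V S \<delta> (?o j)) \<le> (\<Sum>j\<in>{1..k}. of_bool (\<bar>cross (Mj k j *v sgn (F *v w)) z\<bar> < \<delta>1))"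
  proof (rule sum_mono)
    fix j assume "j \<in> {1..k}"
    then show "aligned (r + blk k) V S \<delta> (?o j) \<le> of_bool (\<bar>cross (Mj k j *v sgn (F *v w)) z\<bar> < \<delta>1)"
      using key[of j] by (auto simp: aligned_def)
  qed
  also have "\<dots> = real (card {j\<in>{1..k}. \<bar>cross (Mj k j *v sgn (F *v w)) z\<bar> < \<delta>1})"
    by (simp add: of_bool_def sum.If_cases Int_def)
  also have "\<dots> \<le> 2" using sep[of "sgn (F *v w)" z] Fw0 z1 by (simp add: norm_sgn)
  finally show ?thesis .
qed

text \<open>Each word has weight at least \<open>c\<close>. Taking weight \<open>c\<close> from each
  of the \<open>k\<close> words costs at most \<open>2 * c\<close>, since on average at most two of
  them are aligned; the remaining mass \<open>1 - real k * c\<close> pays the old bound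
  \<open>q\<close>.\<close>

lemma spread_step:
  assumes V: "past_field V" and S: "fut_field S" and \<delta>: "0 \<le> \<delta>"
    and sep: "\<And>w z. norm w = 1 \<Longrightarrow> norm z = 1 \<Longrightarrow> card {j\<in>{1..k}. \<bar>cross (Mj k j *v w) z\<bar> < \<delta>1} \<le> 2"
    and small: "\<delta> * C ^ (2 * blk k) \<le> \<delta>1"
    and q: "\<And>S'. fut_field S' \<Longrightarrow> E (aligned r V S' (\<delta> * C ^ (2 * blk k))) \<le> q"
    and c: "c = min p (1 - p) ^ (4 * K + k + 3)"
  shows "E (aligned (r + blk k) V S \<delta>) \<le> (1 - real k * c) * q + 2 * c"
proof -
  let ?J = "Jb r k" and ?n = "r + blk k"
  define Y where "Y = word r k ` {1..k}"
  have Y: "Y \<subseteq> Pow ?J" by (auto simp: Y_def word_def)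
  have finY: "finite Y" by (simp add: Y_def)
  have cardY: "card Y = k" unfolding Y_def by (subst card_image[OF word_inj]) simp
  have c0: "c > 0" using p0 p1 by (simp add: c)
  define P where "P \<omega> = E (\<lambda>x. aligned ?n V S \<delta> (overwrite ?J \<omega> x))" for \<omega>
  have fde: "fd (aligned ?n V S \<delta>)" by (intro aligned_fd past_fieldD(2)[OF V] fut_fieldD(2)[OF S])
  have Pq: "P \<omega> \<le> q" for \<omega>
  proof -
    obtain S' where S': "fut_field S'" "\<And>x. aligned ?n V S \<delta> (overwrite ?J \<omega> x) \<le> aligned r V S' (\<delta> * C ^ (2 * blk k)) x"
      using aligned_pull[OF V S \<delta>] by metis
    have "P \<omega> \<le> E (aligned r V S' (\<delta> * C ^ (2 * blk k)))"
      unfolding P_def by (intro E_mono S' fd_overwrite[OF fde] aligned_fd past_fieldD(2)[OF V] fut_fieldD(2)[OF S'(1)])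
    with q[OF S'(1)] show ?thesis by linarith
  qed
  have PY: "(\<Sum>\<omega>\<in>Y. P \<omega>) \<le> 2"
  proof -
    have "(\<Sum>\<omega>\<in>Y. P \<omega>) = (\<Sum>j\<in>{1..k}. P (word r k j))"
      unfolding Y_def by (subst sum.reindex[OF word_inj]) simp
    also have "\<dots> = E (\<lambda>x. \<Sum>j\<in>{1..k}. aligned ?n V S \<delta> (overwrite ?J (word r k j) x))"
      unfolding P_def by (rule E_sum[symmetric]) (rule fd_overwrite[OF fde])
    also have "\<dots> \<le> E (\<lambda>x. 2)"
      by (intro E_mono fd_sum fd_overwrite[OF fde] fd_const words_le2[OF V S \<delta> sep small])
    finally show ?thesis by (simp add: E_const)
  qed
  have wc: "c \<le> wt ?J \<omega>" for \<omega> using wt_ge[OF finite_Jb, of r k \<omega>] by (simp add: c card_Jb)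
  have "E (aligned ?n V S \<delta>) = (\<Sum>\<omega>\<in>Pow ?J. wt ?J \<omega> * P \<omega>)"
    unfolding P_def by (rule E_overwrite[OF fde finite_Jb])
  also have "\<dots> = (\<Sum>\<omega>\<in>Pow ?J. (wt ?J \<omega> - (if \<omega> \<in> Y then c else 0)) * P \<omega> + (if \<omega> \<in> Y then c * P \<omega> else 0))"
    by (intro sum.cong) (auto simp: algebra_simps)
  also have "\<dots> = (\<Sum>\<omega>\<in>Pow ?J. (wt ?J \<omega> - (if \<omega> \<in> Y then c else 0)) * P \<omega>) + c * (\<Sum>\<omega>\<in>Y. P \<omega>)"
  proof -
    have "(\<Sum>\<omega>\<in>Pow ?J. if \<omega> \<in> Y then c * P \<omega> else 0) = (\<Sum>\<omega>\<in>Y. c * P \<omega>)"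
      using Y finite_Jb by (subst sum.inter_restrict[symmetric]) (auto simp: Int_absorb1)
    then show ?thesis by (simp add: sum.distrib sum_distrib_left)
  qed
  also have "\<dots> \<le> (\<Sum>\<omega>\<in>Pow ?J. (wt ?J \<omega> - (if \<omega> \<in> Y then c else 0)) * q) + c * 2"
    by (intro add_mono sum_mono mult_left_mono Pq PY) (use wc c0 wt_pos in \<open>auto simp: less_imp_le\<close>)
  also have "(\<Sum>\<omega>\<in>Pow ?J. (wt ?J \<omega> - (if \<omega> \<in> Y then c else 0)) * q) = (1 - real k * c) * q"
  proof -
    have "(\<Sum>\<omega>\<in>Pow ?J. if \<omega> \<in> Y then c else 0) = (\<Sum>\<omega>\<in>Y. c)"
      using Y finite_Jb by (subst sum.inter_restrict[symmetric]) (auto simp: Int_absorb1)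
    then show ?thesis
      by (simp add: sum_distrib_right[symmetric] sum_subtractf wt_sum[OF finite_Jb] cardY)
  qed
  finally show ?thesis by simp
qed

theorem spread: spread
  unfolding spread_def
proof (intro allI impI)
  fix \<epsilon> :: real assume \<epsilon>: "\<epsilon> > 0"
  obtain k :: nat where k: "real k \<ge> 4 / \<epsilon>" "k \<ge> 1"
    by (metis real_arch_simple max.bounded_iff of_nat_le_iff of_nat_max)
  have k2: "2 / real k \<le> \<epsilon> / 2" using k \<epsilon> by (simp add: field_simps)
  obtain \<delta>1 where \<delta>1: "\<delta>1 > 0"
    and sep: "\<And>w z. norm w = 1 \<Longrightarrow> norm z = 1 \<Longrightarrow> card {j\<in>{1..k}. \<bar>cross (Mj k j *v w) z\<bar> < \<delta>1} \<le> 2"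
    using separation[of k] by blast
  define c where "c = min p (1 - p) ^ (4 * K + k + 3)"
  have c0: "c > 0" using p0 p1 by (simp add: c_def)
  have kc: "real k * c \<le> 1"
  proof -
    have "real k * c = (\<Sum>\<omega>\<in>word 0 k ` {1..k}. c)"
      using card_image[OF word_inj, of 0 k] by simp
    also have "\<dots> \<le> (\<Sum>\<omega>\<in>word 0 k ` {1..k}. wt (Jb 0 k) \<omega>)"
      using wt_ge[OF finite_Jb, of 0 k] by (intro sum_mono) (simp add: c_def card_Jb)
    also have "\<dots> \<le> (\<Sum>\<omega>\<in>Pow (Jb 0 k). wt (Jb 0 k) \<omega>)"
      by (intro sum_mono2) (auto simp: finite_Jb word_def less_imp_le[OF wt_pos])
    finally show ?thesis by (simp add: wt_sum[OF finite_Jb])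
  qed
  \<comment> \<open>The recursion of \<open>spread_step\<close> contracts by
    \<open>1 - real k * c\<close> towards its fixed point \<open>2 / real k\<close>, while
    \<open>\<delta>\<close> shrinks from round to round.\<close>
  have *: "\<exists>\<delta>>0. \<forall>V S. past_field V \<longrightarrow> fut_field S \<longrightarrow> E (aligned (R * blk k) V S \<delta>) \<le> (1 - real k * c) ^ R + 2 / real k" for R
  proof (induction R)
    case 0
    have "E (aligned 0 V S 1) \<le> 1" if "past_field V" "fut_field S" for V S
    proof -
      have "E (aligned 0 V S 1) \<le> E (\<lambda>x. 1)"
        by (intro E_mono aligned_fd fd_const past_fieldD(2)[OF that(1)] fut_fieldD(2)[OF that(2)]) (simp add: aligned_def)
      then show ?thesis by (simp add: E_const)
    qed
    then show ?case by (intro exI[of _ 1]) (force intro: add_increasing2)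
  next
    case (Suc R)
    then obtain \<delta>0 where \<delta>0: "\<delta>0 > 0" "\<And>V S. past_field V \<Longrightarrow> fut_field S \<Longrightarrow>
        E (aligned (R * blk k) V S \<delta>0) \<le> (1 - real k * c) ^ R + 2 / real k" by blast
    define \<delta> where "\<delta> = min \<delta>0 \<delta>1 / C ^ (2 * blk k)"
    have Cp: "C ^ (2 * blk k) > 0" using C1 by simp
    have \<delta>: "\<delta> > 0" "\<delta> * C ^ (2 * blk k) = min \<delta>0 \<delta>1" using \<delta>0(1) \<delta>1 Cp C1 by (auto simp: \<delta>_def)
    show ?case
    proof (intro exI[of _ \<delta>] conjI allI impI \<delta>(1))
      fix V S assume V: "past_field V" and S: "fut_field S"
      have "E (aligned (R * blk k + blk k) V S \<delta>) \<le> (1 - real k * c) * ((1 - real k * c) ^ R + 2 / real k) + 2 * c"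
      proof (rule spread_step[OF V S less_imp_le[OF \<delta>(1)] sep _ _ c_def])
        fix S' assume S': "fut_field S'"
        have "E (aligned (R * blk k) V S' (\<delta> * C ^ (2 * blk k))) \<le> E (aligned (R * blk k) V S' \<delta>0)"
          unfolding \<delta>(2) by (intro E_mono aligned_fd past_fieldD(2)[OF V] fut_fieldD(2)[OF S'] aligned_mono) simp
        with \<delta>0(2)[OF V S'] show "E (aligned (R * blk k) V S' (\<delta> * C ^ (2 * blk k))) \<le> (1 - real k * c) ^ R + 2 / real k"
          by linarith
      qed (use \<delta> in auto)
      also have "\<dots> = (1 - real k * c) ^ Suc R + 2 / real k" using k by (simp add: field_simps)
      finally show "E (aligned (Suc R * blk k) V S \<delta>) \<le> (1 - real k * c) ^ Suc R + 2 / real k"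
        by (simp add: add.commute)
    qed
  qed
  have "0 < real k * c" using k c0 by simp
  then have "(\<lambda>R. (1 - real k * c) ^ R) \<longlonglongrightarrow> 0" using kc by (intro LIMSEQ_power_zero) auto
  then have "eventually (\<lambda>R. (1 - real k * c) ^ R < \<epsilon> / 2) sequentially"
    by (rule order_tendstoD) (use \<epsilon> in simp)
  then obtain R where R: "(1 - real k * c) ^ R < \<epsilon> / 2" by (auto simp: eventually_sequentially)
  obtain \<delta> where "\<delta> > 0" "\<And>V S. past_field V \<Longrightarrow> fut_field S \<Longrightarrow> E (aligned (R * blk k) V S \<delta>) \<le> (1 - real k * c) ^ R + 2 / real k"
    using *[of R] by blast
  moreover have "(1 - real k * c) ^ R + 2 / real k \<le> \<epsilon>" using R k2 by linarith
  ultimately show "\<exists>N \<delta>. \<delta> > 0 \<and> (\<forall>V S. past_field V \<longrightarrow> fut_field S \<longrightarrow> E (aligned N V S \<delta>) \<le> \<epsilon>)"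
    by (meson order_trans)
qed

end

section \<open>The perturbed cocycle\<close>

text \<open>One number bounds both parts of the Hoelder norm, which is easier to carry through sums
  and products.\<close>

definition hsm :: "real \<Rightarrow> real \<Rightarrow> (sigma \<Rightarrow> mat2) \<Rightarrow> bool" where
  "hsm \<alpha> e F \<longleftrightarrow> (\<forall>x. opnorm (F x) \<le> e) \<and> (\<forall>x y. opnorm (F x - F y) \<le> e * sdist x y powr \<alpha>)"

lemma sdist_pos: "x \<noteq> y \<Longrightarrow> sdist x y > 0"
  by (simp add: sdist_def)

text \<open>The disagreement at \<open>i\<close> bounds the set under \<open>GREATEST\<close>, so
  that the greatest element exists.\<close>

lemma sdist_ge:
  assumes "x i \<noteq> y i" "\<bar>i\<bar> \<le> int k"
  shows "sdist x y \<ge> 2 powr (- real k)"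
proof -
  let ?P = "\<lambda>N::nat. \<forall>n. \<bar>n\<bar> < int N \<longrightarrow> x n = y n"
  have b: "N \<le> k" if "?P N" for N
  proof (rule ccontr)
    assume "\<not> N \<le> k"
    then have "\<bar>i\<bar> < int N" using assms(2) by simp
    with that assms(1) show False by blast
  qed
  have "?P (Greatest ?P)"
    by (rule GreatestI_nat[of ?P 0 k]) (use b in auto)
  then have "Greatest ?P \<le> k" by (rule b)
  moreover have "x \<noteq> y" using assms by auto
  ultimately show ?thesis by (simp add: sdist_def)
qed

text \<open>Values can differ only at distance at least \<open>2 powr (- real k)\<close>. The sizes
  of all shears below are dictated by this factor.\<close>

lemma hsm_local:
  assumes \<alpha>: "\<alpha> > 0" and F: "fdep {- int k..int k} F" and M: "\<And>x. opnorm (F x) \<le> M"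
  shows "hsm \<alpha> (2 * M * 2 powr (\<alpha> * real k)) F"
proof -
  have M0: "0 \<le> M" using opnorm_nonneg M by (rule order_trans)
  have p1: "1 \<le> 2 powr (\<alpha> * real k)" using \<alpha> by (intro ge_one_powr_ge_zero) auto
  have MM: "M \<le> 2 * M * 2 powr (\<alpha> * real k)"
    using mult_mono[of 1 2 "M * 1" "M * 2 powr (\<alpha> * real k)"] M0 p1 mult_left_mono[OF p1 M0] by simp
  have "opnorm (F x - F y) \<le> 2 * M * 2 powr (\<alpha> * real k) * sdist x y powr \<alpha>" for x y
  proof (cases "F x = F y")
    case True
    then show ?thesis using M0 by (simp add: opnorm_def onorm_zero)
  next
    case False
    then obtain i where i: "i \<in> {- int k..int k}" "x i \<noteq> y i" using F unfolding fdep_def by blast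
    have "2 powr (- real k) \<le> sdist x y" by (rule sdist_ge[of x i]) (use i in auto)
    then have "(2 powr (- real k)) powr \<alpha> \<le> sdist x y powr \<alpha>" using \<alpha> by (intro powr_mono2) auto
    moreover have "2 powr (\<alpha> * real k) * (2 powr (- real k)) powr \<alpha> = 1"
      by (simp add: powr_powr flip: powr_add)
    ultimately have "1 \<le> 2 powr (\<alpha> * real k) * sdist x y powr \<alpha>"
      by (metis mult_left_mono powr_ge_zero)
    then have "2 * M * 1 \<le> 2 * M * (2 powr (\<alpha> * real k) * sdist x y powr \<alpha>)"
      using M0 by (intro mult_left_mono) auto
    moreover have "opnorm (F x - F y) \<le> M + M" using opnorm_diff[of "F x" "F y"] M[of x] M[of y] by linarith
    ultimately show ?thesis by (simp add: mult.assoc)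
  qed
  then show ?thesis unfolding hsm_def using M MM by (meson order_trans)
qed

lemma hsm_mono: "hsm \<alpha> e F \<Longrightarrow> e \<le> e' \<Longrightarrow> hsm \<alpha> e' F"
  unfolding hsm_def by (meson mult_right_mono order_trans powr_ge_zero)

lemma hsm_nonneg: "hsm \<alpha> e F \<Longrightarrow> 0 \<le> e"
  unfolding hsm_def using opnorm_nonneg order_trans by blast

lemma hsm_add:
  assumes "hsm \<alpha> a F" "hsm \<alpha> b G" shows "hsm \<alpha> (a + b) (\<lambda>x. F x + G x)"
  unfolding hsm_def
proof (intro conjI allI)
  fix x y
  show "opnorm (F x + G x) \<le> a + b"
    using opnorm_add[of "F x" "G x"] assms unfolding hsm_def by (meson add_mono order_trans)
  have "opnorm ((F x - F y) + (G x - G y)) \<le> a * sdist x y powr \<alpha> + b * sdist x y powr \<alpha>"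
    using opnorm_add[of "F x - F y" "G x - G y"] assms unfolding hsm_def by (meson add_mono order_trans)
  then show "opnorm (F x + G x - (F y + G y)) \<le> (a + b) * sdist x y powr \<alpha>"
    by (simp add: algebra_simps)
qed

lemma hsm_mult:
  assumes F: "hsm \<alpha> a F" and G: "hsm \<alpha> b G" shows "hsm \<alpha> (2 * a * b) (\<lambda>x. F x ** G x)"
  unfolding hsm_def
proof (intro conjI allI)
  fix x y
  have ab: "0 \<le> a" "0 \<le> b" using F G hsm_nonneg by auto
  have Fx: "opnorm (F x) \<le> a" for x using F unfolding hsm_def by blast
  have Gx: "opnorm (G x) \<le> b" for x using G unfolding hsm_def by blast
  let ?d = "sdist x y powr \<alpha>"
  have "opnorm (F x ** G x) \<le> a * b"
    using opnorm_mult[of "F x" "G x"] mult_mono[OF Fx[of x] Gx[of x] ab(1) opnorm_nonneg] by linarith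
  then show "opnorm (F x ** G x) \<le> 2 * a * b" using ab mult_nonneg_nonneg[OF ab] by linarith
  have eq: "F x ** G x - F y ** G y = F x ** (G x - G y) + (F x - F y) ** G y"
    by (rule mat2_eqI) (simp_all add: algebra_simps)
  have "opnorm (F x ** G x - F y ** G y) \<le> opnorm (F x) * opnorm (G x - G y) + opnorm (F x - F y) * opnorm (G y)"
    using opnorm_add[of "F x ** (G x - G y)" "(F x - F y) ** G y"] opnorm_mult[of "F x" "G x - G y"]
      opnorm_mult[of "F x - F y" "G y"] unfolding eq by linarith
  also have "\<dots> \<le> a * (b * ?d) + (a * ?d) * b"
    using F G unfolding hsm_def by (intro add_mono mult_mono Fx Gx opnorm_nonneg) (use ab in auto)
  finally show "opnorm (F x ** G x - F y ** G y) \<le> 2 * a * b * ?d" by (simp add: algebra_simps)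
qed

lemma hsm_near:
  assumes FA: "hsm \<alpha> e (\<lambda>x. F x - A x)" and A: "hsm \<alpha> a A" and G: "hsm \<alpha> h (\<lambda>x. H x - mat 1)" and e: "e \<le> 1"
  shows "hsm \<alpha> (e + 2 * (a + 1) * h) (\<lambda>x. F x ** H x - A x)"
proof -
  have "hsm \<alpha> (e + a) (\<lambda>x. (F x - A x) + A x)" by (rule hsm_add[OF FA A])
  then have "hsm \<alpha> (a + 1) F" by (simp add: hsm_mono e)
  from hsm_add[OF FA hsm_mult[OF this G]]
  have "hsm \<alpha> (e + 2 * (a + 1) * h) (\<lambda>x. (F x - A x) + F x ** (H x - mat 1))" .
  moreover have "(F x - A x) + F x ** (H x - mat 1) = F x ** H x - A x" for x
    by (rule mat2_eqI) (simp_all add: mat_def algebra_simps)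
  ultimately show ?thesis by simp
qed

lemma hsm_holder: "hsm \<alpha> e F \<Longrightarrow> holder \<alpha> F"
  unfolding hsm_def holder_def by (auto intro!: bdd_aboveI)

lemma hsm_holder_norm:
  assumes F: "hsm \<alpha> e F" shows "holder_norm \<alpha> F \<le> 2 * e"
proof -
  have "(SUP x. opnorm (F x)) \<le> e" using F unfolding hsm_def by (intro cSUP_least) auto
  moreover have "(SUP xy \<in> {(x, y). x \<noteq> y}. opnorm (F (fst xy) - F (snd xy)) / sdist (fst xy) (snd xy) powr \<alpha>) \<le> e"
  proof (rule cSUP_least)
    have "((\<lambda>_. True), (\<lambda>_. False)) \<in> {(x, y). x \<noteq> (y :: sigma)}" by (auto simp: fun_eq_iff)
    then show "{(x, y). x \<noteq> (y :: sigma)} \<noteq> {}" by blast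
    fix xy :: "sigma \<times> sigma" assume "xy \<in> {(x, y). x \<noteq> y}"
    then have "sdist (fst xy) (snd xy) powr \<alpha> > 0" using sdist_pos by force
    then show "opnorm (F (fst xy) - F (snd xy)) / sdist (fst xy) (snd xy) powr \<alpha> \<le> e"
      using F unfolding hsm_def by (simp add: divide_le_eq)
  qed
  ultimately show ?thesis unfolding holder_norm_def by linarith
qed

section \<open>Markers, shears and the family of cocycles\<close>

definition step :: "bool \<Rightarrow> real" where "step b = (if b then 1 else -1)"

text \<open>\<open>i\<close> is the first zero. The leading 1 makes markers with different starts
  disjoint; as the run may go on, a long marker is also a short one.\<close>

definition marker :: "nat \<Rightarrow> sigma \<Rightarrow> int \<Rightarrow> bool" where
  "marker m x i \<longleftrightarrow> x (i - 1) \<and> (\<forall>j\<in>{i..<i + int m}. \<not> x j)"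

text \<open>Logarithm to base \<open>s\<close> of the factor by which the diagonal cocycle has
  stretched the horizontal axis during the last \<open>\<tau>\<close> steps.\<close>

definition height :: "sigma \<Rightarrow> nat \<Rightarrow> real" where "height x \<tau> = (\<Sum>i<\<tau>. step (x (- int i - 1)))"

definition lsh :: "real \<Rightarrow> mat2" where "lsh g = mk2 1 0 g 1"
definition ush :: "real \<Rightarrow> mat2" where "ush g = mk2 1 g 0 1"

locale constr =
  fixes s \<gamma> :: real and m d T :: nat
  assumes s1: "1 < s" and m2: "2 \<le> m" and md: "m < d" and dT: "d < T" and \<gamma>0: "0 < \<gamma>"
begin

text \<open>Each zero multiplies slopes by s^2, so the tilted axis reaches slope 1 exactly after the
  \<open>m\<close> zeros that were looked at.\<close>

definition g1 :: "sigma \<Rightarrow> real" where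
  "g1 x = (if marker m x 0 then s powr (- 2 * real m) else 0)"

text \<open>The sign decides whether the shear of \<open>g1\<close> is undone or, after a long marker, completed to a swap.\<close>

definition g2 :: "sigma \<Rightarrow> real" where
  "g2 x = (if marker m x (- int T) \<and> \<gamma> * real T \<le> height x T
     then (if marker d x (- int T) then 1 else -1) * s powr (- 2 * (real m + height x T)) else 0)"

text \<open>After \<open>d\<close> zeros the tilted axis has slope s^(2(d-m)); an upper shear by
  minus the inverse slope makes it vertical.\<close>

definition up :: "sigma \<Rightarrow> real" where
  "up x = (if marker d x (- int d) then - (s powr (- 2 * (real d - real m))) else 0)"

text \<open>At symbol 0 this is \<open>lsh \<eta> ** ush \<eta>\<close>: determinant 1, and all
  entries positive for positive \<open>\<eta>\<close>.\<close>

definition noise :: "real \<Rightarrow> sigma \<Rightarrow> mat2" where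
  "noise \<eta> x = (if x 0 then mat 1 else mk2 1 \<eta> \<eta> (1 + \<eta>\<^sup>2))"

definition Lc :: "real \<Rightarrow> real \<Rightarrow> sigma \<Rightarrow> mat2" where
  "Lc t \<eta> x = A_sig s x ** lsh (t * g1 x) ** lsh (t * g2 x) ** ush (t * up x) ** noise \<eta> x"

lemma A_sig_mk2: "A_sig s x = mk2 (s powr step (x 0)) 0 0 (s powr (- step (x 0)))"
  using s1 by (simp add: A_sig_def diag2_mk2 step_def powr_minus_divide)

lemma marker_dep: "{i - 1..<i + int k} \<subseteq> I \<Longrightarrow> i - 1 \<in> I \<Longrightarrow> fdep I (\<lambda>x. marker k x i)"
  unfolding marker_def by (rule fdepI) (auto simp: subset_iff)

lemma height_dep: "{- int \<tau>..<0} \<subseteq> I \<Longrightarrow> fdep I (\<lambda>x. height x \<tau>)"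
  unfolding height_def by (rule fdepI, rule sum.cong) (auto simp: subset_iff)

lemma g1_dep: "fdep {- int m..int m} g1"
  unfolding g1_def[abs_def]
  by (rule fdep_comp[OF marker_dep, where h = "\<lambda>b. if b then s powr (- 2 * real m) else 0"]) (use m2 in auto)

lemma g2_dep: "fdep {- int (T + 1)..int (T + 1)} g2"
proof (rule fdepI)
  fix x y :: sigma assume eq: "\<And>i. i \<in> {- int (T + 1)..int (T + 1)} \<Longrightarrow> x i = y i"
  have C: "marker k x (- int T) = marker k y (- int T)" if "k \<le> T" for k
    by (rule fdepD[OF marker_dep[where I = "{- int (T + 1)..int (T + 1)}"]]) (use that eq in auto)
  have "marker m x (- int T) = marker m y (- int T)" "marker d x (- int T) = marker d y (- int T)"
    using md dT by (auto intro!: C)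
  moreover have "height x T = height y T"
    by (rule fdepD[OF height_dep[where I = "{- int (T + 1)..int (T + 1)}"]]) (use eq in auto)
  ultimately
  show "g2 x = g2 y" by (simp add: g2_def)
qed

lemma up_dep: "fdep {- int (d + 1)..int (d + 1)} up"
  unfolding up_def[abs_def]
  by (rule fdep_comp[OF marker_dep, where h = "\<lambda>b. if b then - (s powr (- 2 * (real d - real m))) else 0"]) (use m2 in auto)

lemma g1_le: "\<bar>g1 x\<bar> \<le> s powr (- 2 * real m)"
  by (simp add: g1_def)

lemma g2_le: "\<bar>g2 x\<bar> \<le> s powr (- 2 * \<gamma> * real T)"
proof (cases "marker m x (- int T) \<and> \<gamma> * real T \<le> height x T")
  case True
  then have "\<bar>g2 x\<bar> = s powr (- 2 * (real m + height x T))" by (simp add: g2_def abs_mult)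
  also have "\<dots> \<le> s powr (- 2 * \<gamma> * real T)" using s1 True by (intro powr_mono) auto
  finally show ?thesis .
qed (auto simp: g2_def)

lemma up_le: "\<bar>up x\<bar> \<le> s powr (- 2 * (real d - real m))"
  by (simp add: up_def)

lemma small1: "\<bar>g1 x\<bar> \<le> 1" "\<bar>g2 x\<bar> \<le> 1" "\<bar>up x\<bar> \<le> 1"
proof -
  have *: "s powr (- y) \<le> 1" if "0 \<le> y" for y :: real
    using s1 that powr_mono[of "- y" 0 s] by simp
  show "\<bar>g1 x\<bar> \<le> 1" using g1_le[of x] *[of "2 * real m"] by simp
  show "\<bar>g2 x\<bar> \<le> 1" using g2_le[of x] *[of "2 * \<gamma> * real T"] \<gamma>0 by simp
  show "\<bar>up x\<bar> \<le> 1" using up_le[of x] *[of "2 * (real d - real m)"] md by simp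
qed

lemma lsh_op: "opnorm (lsh g) \<le> 2 + \<bar>g\<bar>" unfolding lsh_def using opnorm_mk2_le[of 1 0 g 1] by simp
lemma ush_op: "opnorm (ush g) \<le> 2 + \<bar>g\<bar>" unfolding ush_def using opnorm_mk2_le[of 1 g 0 1] by simp
lemma lsh_op1: "opnorm (lsh g - mat 1) \<le> \<bar>g\<bar>"
  unfolding lsh_def mat1_mk2 mk2_diff using opnorm_mk2_le[of "1-1" "0-0" "g-0" "1-1"] by simp
lemma ush_op1: "opnorm (ush g - mat 1) \<le> \<bar>g\<bar>"
  unfolding ush_def mat1_mk2 mk2_diff using opnorm_mk2_le[of "1-1" "g-0" "0-0" "1-1"] by simp

lemma noise_op1: assumes "0 \<le> \<eta>" "\<eta> \<le> 1" shows "opnorm (noise \<eta> x - mat 1) \<le> 3 * \<eta>"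
proof -
  have "\<eta>\<^sup>2 \<le> \<eta>" using assms by (simp add: power2_eq_square mult_left_le)
  then show ?thesis
    using opnorm_mk2_le[of "1-1" "\<eta>-0" "\<eta>-0" "1+\<eta>\<^sup>2-1"] assms
    by (auto simp: noise_def mat1_mk2 mk2_diff opnorm_def onorm_zero)
qed

lemma A_sig_op: "opnorm (A_sig s x) \<le> 2 * s"
proof -
  have "s powr step (x 0) \<le> s powr 1" "s powr (- step (x 0)) \<le> s powr 1"
    by (intro powr_mono; use s1 in \<open>simp add: step_def\<close>)+
  then have "s powr step (x 0) \<le> s" "s powr (- step (x 0)) \<le> s" using s1 by auto
  then show ?thesis using opnorm_mk2_le[of "s powr step (x 0)" 0 0 "s powr (- step (x 0))"]
    unfolding A_sig_mk2 by simp
qed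

definition CL :: real where "CL = 2 * s * 3 * 3 * 3 * 5"
definition KL :: nat where "KL = T + 1"

lemma Lc_op:
  assumes t: "0 \<le> t" "t \<le> 1" and \<eta>: "0 \<le> \<eta>" "\<eta> \<le> 1"
  shows "opnorm (Lc t \<eta> x) \<le> CL"
proof -
  have tb: "\<bar>t * g\<bar> \<le> 1" if "\<bar>g\<bar> \<le> 1" for g using t that by (simp add: abs_mult mult_le_one)
  have 1: "opnorm (lsh (t * g1 x)) \<le> 3" "opnorm (lsh (t * g2 x)) \<le> 3" "opnorm (ush (t * up x)) \<le> 3"
    using lsh_op[of "t * g1 x"] lsh_op[of "t * g2 x"] ush_op[of "t * up x"] tb[OF small1(1)[of x]] tb[OF small1(2)[of x]] tb[OF small1(3)[of x]]
    by linarith+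
  have "opnorm (mat 1 :: mat2) \<le> 2" using opnorm_mk2_le[of 1 0 0 1] by (simp add: mat1_mk2)
  then have 2: "opnorm (noise \<eta> x) \<le> 5"
    using opnorm_add[of "noise \<eta> x - mat 1" "mat 1"] noise_op1[OF \<eta>, of x] \<eta> by simp
  have mm: "opnorm (M ** N) \<le> a * b" if "opnorm M \<le> a" "opnorm N \<le> b" for M N a b
    using opnorm_mult[of M N] mult_mono[OF that order_trans[OF opnorm_nonneg that(1)] opnorm_nonneg] by linarith
  show ?thesis unfolding Lc_def CL_def by (intro mm A_sig_op 1 2)
qed

lemma Lc_det: "det (Lc t \<eta> x) = 1"
  using s1 by (simp add: Lc_def det_mul A_sig_mk2 lsh_def ush_def noise_def power2_eq_square algebra_simps flip: powr_add)

lemma Lc_dep: "fdep {- int KL..int KL} (Lc t \<eta>)"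
proof (rule fdepI)
  fix x y :: sigma assume eq: "\<And>i. i \<in> {- int KL..int KL} \<Longrightarrow> x i = y i"
  have "g1 x = g1 y" by (rule fdepD[OF g1_dep]) (use eq md dT in \<open>auto simp: KL_def\<close>)
  moreover have "g2 x = g2 y" by (rule fdepD[OF g2_dep]) (use eq md dT in \<open>auto simp: KL_def\<close>)
  moreover have "up x = up y" by (rule fdepD[OF up_dep]) (use eq md dT in \<open>auto simp: KL_def\<close>)
  moreover have "x 0 = y 0" by (rule eq) simp
  ultimately show "Lc t \<eta> x = Lc t \<eta> y" by (simp add: Lc_def A_sig_def noise_def)
qed

lemma Lc_plain:
  assumes "\<And>i. - int KL \<le> i \<Longrightarrow> i < int KL \<Longrightarrow> x i \<or> x (i + 1)"
  shows "Lc t \<eta> x = (if x 0 then mk2 s 0 0 (1 / s) else mk2 (1 / s) (\<eta> / s) (s * \<eta>) (s * (1 + \<eta>\<^sup>2)))"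
proof -
  have nc: "\<not> marker k x i" if "2 \<le> k" "- int KL \<le> i" "i < int KL" for k i
    using assms[OF that(2,3)] that(1) by (auto simp: marker_def)
  have "g1 x = 0" "g2 x = 0" "up x = 0"
    using nc[of m 0] nc[of m "- int T"] nc[of d "- int d"] m2 md dT by (auto simp: g1_def g2_def up_def KL_def)
  then show ?thesis
    using s1 by (simp add: Lc_def lsh_def ush_def noise_def A_sig_def diag2_mk2 mk2_mult mat1_mk2)
qed

lemma Lc_cont: "continuous_on A (\<lambda>t. Lc t \<eta> x)" "continuous_on A (\<lambda>\<eta>. Lc t \<eta> x)"
proof -
  have mk: "continuous_on A (\<lambda>t. mk2 (a t) (b t) (c t) (e t))"
    if "continuous_on A a" "continuous_on A b" "continuous_on A c" "continuous_on A e" for a b c e :: "real \<Rightarrow> real"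
    unfolding mk2_def
  proof (intro continuous_on_vec_lambda)
    fix i j :: 2
    show "continuous_on A (\<lambda>t. if i = 1 then if j = 1 then a t else b t else if j = 1 then c t else e t)"
      by (cases "i = 1"; cases "j = 1"; simp add: that)
  qed
  show "continuous_on A (\<lambda>t. Lc t \<eta> x)"
    unfolding Lc_def lsh_def ush_def by (intro continuous_mat_mult mk continuous_intros)
  have "continuous_on A (\<lambda>\<eta>. noise \<eta> x)"
    unfolding noise_def by (cases "x 0") (auto intro!: mk continuous_intros)
  then show "continuous_on A (\<lambda>\<eta>. Lc t \<eta> x)"
    unfolding Lc_def by (intro continuous_mat_mult continuous_intros)
qed

lemma Lc_near:
  assumes \<alpha>: "\<alpha> > 0" and t: "0 \<le> t" "t \<le> 1" and \<eta>: "0 \<le> \<eta>" "\<eta> \<le> 1"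
    and A: "hsm \<alpha> a A" and e0: "hsm \<alpha> e (\<lambda>x. A_sig s x - A x)"
    and h1: "2 * s powr (- 2 * real m) * 2 powr (\<alpha> * real m) \<le> h1"
    and h2: "2 * s powr (- 2 * \<gamma> * real T) * 2 powr (\<alpha> * real (T + 1)) \<le> h2"
    and h3: "2 * s powr (- 2 * (real d - real m)) * 2 powr (\<alpha> * real (d + 1)) \<le> h3"
    and h4: "6 * \<eta> \<le> h4"
    and le1: "e + 2 * (a + 1) * (h1 + h2 + h3 + h4) \<le> 1"
  shows "hsm \<alpha> (e + 2 * (a + 1) * (h1 + h2 + h3 + h4)) (\<lambda>x. Lc t \<eta> x - A x)"
proof -
  have a0: "0 \<le> a" by (rule hsm_nonneg[OF A])
  have tb: "\<bar>t * g\<bar> \<le> \<bar>g\<bar>" for g using t by (simp add: abs_mult mult_left_le_one_le)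
  have k1: "hsm \<alpha> h1 (\<lambda>x. lsh (t * g1 x) - mat 1)"
    by (rule hsm_mono[OF hsm_local[OF \<alpha> _ order_trans[OF lsh_op1 order_trans[OF tb g1_le]]] h1])
       (rule fdep_comp[OF g1_dep])
  have k2: "hsm \<alpha> h2 (\<lambda>x. lsh (t * g2 x) - mat 1)"
    by (rule hsm_mono[OF hsm_local[OF \<alpha> _ order_trans[OF lsh_op1 order_trans[OF tb g2_le]]] h2])
       (rule fdep_comp[OF g2_dep])
  have k3: "hsm \<alpha> h3 (\<lambda>x. ush (t * up x) - mat 1)"
    by (rule hsm_mono[OF hsm_local[OF \<alpha> _ order_trans[OF ush_op1 order_trans[OF tb up_le]]] h3])
       (rule fdep_comp[OF up_dep])
  have "fdep {- int 0..int 0} (\<lambda>x. noise \<eta> x - mat 1)" by (rule fdepI) (auto simp: noise_def)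
  from hsm_local[OF \<alpha> this noise_op1[OF \<eta>]]
  have k4: "hsm \<alpha> h4 (\<lambda>x. noise \<eta> x - mat 1)" by (rule hsm_mono) (use h4 in simp)
  have nn: "0 \<le> h1" "0 \<le> h2" "0 \<le> h3" "0 \<le> h4" using k1 k2 k3 k4 hsm_nonneg by auto
  let ?c = "2 * (a + 1)"
  have c: "0 \<le> ?c * h1" "0 \<le> ?c * h2" "0 \<le> ?c * h3" "0 \<le> ?c * h4" using nn a0 by auto
  have le: "e + ?c * h1 + ?c * h2 + ?c * h3 + ?c * h4 \<le> 1" using le1 by (simp add: algebra_simps)
  have "hsm \<alpha> (e + ?c * h1 + ?c * h2 + ?c * h3 + ?c * h4) (\<lambda>x. Lc t \<eta> x - A x)"
    unfolding Lc_def
    by (intro hsm_near k1 k2 k3 k4 A e0) (use le c in linarith)+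
  then show ?thesis by (simp add: algebra_simps)
qed

end

section \<open>Good orbits\<close>

context constr
begin

text \<open>The present size of the shear made \<open>\<tau>\<close> steps ago: conjugation by the
  diagonal steps since then rescales it by \<open>height\<close>. The flag says that the end of a
  long marker has been passed, which reverses the sign.\<close>

definition shear :: "bool \<Rightarrow> sigma \<Rightarrow> nat \<Rightarrow> real" where
  "shear b x \<tau> = (if marker m x (- int \<tau>) then (if b then -1 else 1) * s powr (- 2 * (real m + height x \<tau>)) else 0)"

text \<open>The state before the step at \<open>x\<close>: at \<tau> = 0 the shear \<open>g1\<close>
  is yet to come, at \<tau> = d the upper shear is, so the sign is still positive, and at \<tau> = T
  the correction \<open>g2\<close> is, so the term still counts.\<close>

definition pending :: "sigma \<Rightarrow> real" where
  "pending x = (\<Sum>\<tau>\<in>{1..T}. shear (marker d x (- int \<tau>) \<and> d < \<tau>) x \<tau>)"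

definition beta :: real where "beta = s powr (2 * (real d - real m))"

text \<open>Origin of the swap: the upper shear by \<open>- 1 / beta\<close> after the lower shear
  by \<open>beta\<close> equals the lower shear by \<open>- beta\<close> after this matrix.\<close>

definition flip :: "sigma \<Rightarrow> mat2" where
  "flip x = (if marker d x (- int d) then mk2 0 (- 1 / beta) beta 0 else mat 1)"

text \<open>The first condition lets \<open>g2\<close> act. The second leaves \<open>beta\<close> as
  the only pending shear when a long marker ends; any other would make the upper shear miss the
  vertical.\<close>

definition good :: "sigma \<Rightarrow> bool" where
  "good x \<longleftrightarrow> \<gamma> * real T \<le> height x T \<and> (\<forall>\<tau>\<in>{d<..T}. \<not> (marker d x (- int d) \<and> marker m x (- int \<tau>)))"

lemma marker_shift: "marker k (shift x) i = marker k x (i + 1)"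
  unfolding marker_def shift_def
proof (intro conj_cong iffI ballI)
  fix j assume "\<forall>j\<in>{i..<i + int k}. \<not> x (j + 1)" "j \<in> {i + 1..<i + 1 + int k}"
  then show "\<not> x j" by (auto dest: bspec[of _ _ "j - 1"])
qed auto

lemma marker_shift_pow: "marker k ((shift ^^ n) x) i = marker k x (i + int n)"
proof (induction n arbitrary: i)
  case (Suc n)
  then show ?case by (simp add: marker_shift algebra_simps)
qed simp

lemma height_shift: "height (shift x) (Suc \<tau>) = step (x 0) + height x \<tau>"
  unfolding height_def sum.lessThan_Suc_shift shift_def
  by (intro arg_cong2[where f = "(+)"] sum.cong refl arg_cong[where f = step] arg_cong[where f = x]) auto

lemma marker_mono: "k \<le> l \<Longrightarrow> marker l x i \<Longrightarrow> marker k x i"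
  by (auto simp: marker_def)

lemma height_zeros: assumes "marker d x (- int d)" "\<tau> \<le> d" shows "height x \<tau> = - real \<tau>"
proof -
  have "height x \<tau> = (\<Sum>i<\<tau>. - 1)"
    unfolding height_def
  proof (rule sum.cong[OF refl])
    fix i assume "i \<in> {..<\<tau>}"
    then have "- int i - 1 \<in> {- int d..<- int d + int d}" using assms(2) by auto
    then have "\<not> x (- int i - 1)" using assms(1) unfolding marker_def by blast
    then show "step (x (- int i - 1)) = - 1" by (simp add: step_def)
  qed
  then show ?thesis by (simp add: sum_negf)
qed

lemma pending_shift_sum:
  "pending (shift x) = s powr (- 2 * step (x 0)) * (\<Sum>\<tau><T. shear (marker d x (- int \<tau>) \<and> d \<le> \<tau>) x \<tau>)"
proof -
  have "pending (shift x) = (\<Sum>\<tau><T. shear (marker d (shift x) (- int (Suc \<tau>)) \<and> d < Suc \<tau>) (shift x) (Suc \<tau>))"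
    unfolding pending_def by (rule sum.reindex_bij_witness[of _ Suc "\<lambda>\<tau>. \<tau> - 1"]) auto
  also have "\<dots> = (\<Sum>\<tau><T. s powr (- 2 * step (x 0)) * shear (marker d x (- int \<tau>) \<and> d \<le> \<tau>) x \<tau>)"
  proof (intro sum.cong refl)
    fix \<tau>
    have "s powr (- 2 * (real m + (step (x 0) + height x \<tau>))) = s powr (- 2 * step (x 0)) * s powr (- 2 * (real m + height x \<tau>))"
      by (simp add: algebra_simps flip: powr_add)
    then show "(shear (marker d (shift x) (- int (Suc \<tau>)) \<and> d < Suc \<tau>) (shift x) (Suc \<tau>))
     = s powr (- 2 * step (x 0)) * shear (marker d x (- int \<tau>) \<and> d \<le> \<tau>) x \<tau>"
      by (simp add: shear_def marker_shift height_shift less_Suc_eq_le)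
  qed
  finally show ?thesis by (simp add: sum_distrib_left)
qed

text \<open>The sum for the next point gains the term \<tau> = 0, which is \<open>g1 x\<close>, and
  loses the term \<tau> = T, which is \<open>- g2 x\<close>; the diagonal step rescales the
  rest.\<close>

lemma pending_shift_normal:
  assumes "\<not> marker d x (- int d)" and ty: "\<gamma> * real T \<le> height x T"
  shows "pending (shift x) = s powr (- 2 * step (x 0)) * (pending x + g1 x + g2 x)"
proof -
  define h where "h \<tau> = shear (marker d x (- int \<tau>) \<and> d < \<tau>) x \<tau>" for \<tau>
  have "(\<Sum>\<tau><T. shear (marker d x (- int \<tau>) \<and> d \<le> \<tau>) x \<tau>) = (\<Sum>\<tau><T. h \<tau>)"
  proof (intro sum.cong refl)
    fix \<tau>
    have "(marker d x (- int \<tau>) \<and> d \<le> \<tau>) = (marker d x (- int \<tau>) \<and> d < \<tau>)"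
      using assms(1) by (auto simp: le_less)
    then show "shear (marker d x (- int \<tau>) \<and> d \<le> \<tau>) x \<tau> = h \<tau>"
      by (simp add: h_def)
  qed
  also have "\<dots> = h 0 + (\<Sum>\<tau>\<in>{1..<T}. h \<tau>)"
    using dT by (simp add: lessThan_atLeast0 sum.atLeast_Suc_lessThan)
  also have "(\<Sum>\<tau>\<in>{1..<T}. h \<tau>) = pending x - h T"
  proof -
    have "{1..T} = insert T {1..<T}" using dT by auto
    then show ?thesis by (simp add: pending_def h_def)
  qed
  also have "h 0 = g1 x" by (simp add: h_def shear_def g1_def height_def)
  also have "h T = - g2 x" using ty dT by (simp add: h_def shear_def g2_def)
  finally show ?thesis unfolding pending_shift_sum by (simp add: algebra_simps)
qed

lemma bottom_no_cand:
  assumes "marker d x (- int d)" "\<tau> < d"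
  shows "\<not> marker m x (- int \<tau>)"
proof
  assume "marker m x (- int \<tau>)"
  then have "x (- int \<tau> - 1)" by (simp add: marker_def)
  moreover have "- int \<tau> - 1 \<in> {- int d..<- int d + int d}" using assms(2) by auto
  ultimately show False using assms(1) unfolding marker_def by blast
qed

text \<open>No marker starts inside the run of zeros, and \<open>good\<close> excludes older ones.
  So \<tau> = d is the only term; its sign changes at the next point because the flag tests
  \<open>d < \<tau>\<close>.\<close>

lemma bottom_sums:
  assumes b: "marker d x (- int d)" and g: "good x"
  shows "pending x = beta" "pending (shift x) = - (s powr (- 2 * step (x 0)) * beta)" "g1 x = 0" "g2 x = 0"
proof -
  have nc: "\<not> marker m x (- int \<tau>)" if "\<tau> \<noteq> d" "\<tau> \<le> T" for \<tau>
    using bottom_no_cand[OF b, of \<tau>] g b that unfolding good_def by (cases "\<tau> < d") auto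
  have cm: "marker m x (- int d)" using marker_mono[OF _ b] md by simp
  have hd: "s powr (- 2 * (real m + height x d)) = beta"
    using height_zeros[OF b, of d] by (simp add: beta_def algebra_simps)
  have "pending x = (\<Sum>\<tau>\<in>{d}. shear (marker d x (- int \<tau>) \<and> d < \<tau>) x \<tau>)"
    unfolding pending_def by (rule sum.mono_neutral_right) (use md dT nc in \<open>auto simp: shear_def\<close>)
  then show "pending x = beta" using cm hd by (simp add: shear_def)
  have "(\<Sum>\<tau><T. shear (marker d x (- int \<tau>) \<and> d \<le> \<tau>) x \<tau>) =
     (\<Sum>\<tau>\<in>{d}. shear (marker d x (- int \<tau>) \<and> d \<le> \<tau>) x \<tau>)"
    by (rule sum.mono_neutral_right) (use md dT nc in \<open>auto simp: shear_def\<close>)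
  then show "pending (shift x) = - (s powr (- 2 * step (x 0)) * beta)"
    unfolding pending_shift_sum using cm hd b by (simp add: shear_def)
  show "g1 x = 0" "g2 x = 0" using nc[of 0] nc[of T] md dT by (auto simp: g1_def g2_def)
qed

text \<open>The function \<open>pending\<close> records the shears that have been applied but not yet undone: conjugated
  by \<open>lsh (pending x)\<close>, the cocycle becomes monomial as long as the orbit is good.\<close>

lemma good_step:
  assumes g: "good x"
  shows "Lc 1 0 x ** lsh (pending x) = lsh (pending (shift x)) ** A_sig s x ** flip x"
proof -
  have noise: "noise 0 x = mat 1" by (simp add: noise_def mat1_mk2)
  have sp: "s powr step (x 0) > 0" using s1 by simp
  have i: "s powr (- step (x 0)) = s powr (- 2 * step (x 0)) * s powr step (x 0)"
    by (simp flip: powr_add)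
  show ?thesis
  proof (cases "marker d x (- int d)")
    case True
    have b0: "beta > 0" using s1 by (simp add: beta_def)
    have u: "up x = - 1 / beta" using True by (simp add: up_def beta_def powr_minus_divide[symmetric] algebra_simps)
    show ?thesis
      unfolding Lc_def noise flip_def bottom_sums[OF True g] u A_sig_mk2 lsh_def ush_def mat1_mk2
      using True b0 by (simp add: mk2_mult) (simp add: i)
  next
    case False
    then have u: "up x = 0" by (simp add: up_def)
    have c: "pending (shift x) = s powr (- 2 * step (x 0)) * (pending x + g1 x + g2 x)"
      by (rule pending_shift_normal[OF False]) (use g good_def in auto)
    show ?thesis
      unfolding Lc_def noise flip_def c u A_sig_mk2 lsh_def ush_def mat1_mk2
      using False by (simp add: mk2_mult) (simp add: i algebra_simps)
  qed
qed

section \<open>The monomial cocycle and its logarithmic size\<close>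

fun Mono :: "nat \<Rightarrow> sigma \<Rightarrow> mat2" where
  "Mono 0 x = mat 1"
| "Mono (Suc n) x = A_sig s ((shift ^^ n) x) ** flip ((shift ^^ n) x) ** Mono n x"

lemma good_orbit:
  assumes "\<And>t. t < n \<Longrightarrow> good ((shift ^^ t) x)"
  shows "cocycle_pow (Lc 1 0) n x ** lsh (pending x) = lsh (pending ((shift ^^ n) x)) ** Mono n x"
  using assms
proof (induction n)
  case (Suc n)
  let ?y = "(shift ^^ n) x"
  have "cocycle_pow (Lc 1 0) (Suc n) x ** lsh (pending x) = Lc 1 0 ?y ** (cocycle_pow (Lc 1 0) n x ** lsh (pending x))"
    by (simp add: matrix_mul_assoc)
  also have "\<dots> = Lc 1 0 ?y ** lsh (pending ?y) ** Mono n x"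
    using Suc by (simp add: matrix_mul_assoc)
  also have "\<dots> = lsh (pending (shift ?y)) ** (A_sig s ?y ** flip ?y ** Mono n x)"
    unfolding good_step[OF Suc.prems[OF lessI]] by (simp add: matrix_mul_assoc)
  finally show ?case by simp
qed simp

text \<open>Logarithm to base \<open>s\<close> of the modulus of the nonzero entry in the first row.
  A flip exchanges the rows, hence the reversed sign. The guard \<open>d < t\<close> admits only
  markers inside the nonnegative coordinates, so that \<open>rho x t\<close> sees just the symbols
  from 0 to t - 1.\<close>

fun rho :: "sigma \<Rightarrow> nat \<Rightarrow> real" where
  "rho x 0 = 0"
| "rho x (Suc t) = step (x (int t)) +
     (if d < t \<and> marker d x (int t - int d) then - rho x t - 2 * (real d - real m) else rho x t)"

definition is_mono :: "real \<Rightarrow> mat2 \<Rightarrow> bool" where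
  "is_mono r M \<longleftrightarrow> (M$1$2 = 0 \<and> M$2$1 = 0 \<and> \<bar>M$1$1\<bar> = s powr r \<and> \<bar>M$2$2\<bar> = s powr (- r)) \<or>
     (M$1$1 = 0 \<and> M$2$2 = 0 \<and> \<bar>M$1$2\<bar> = s powr r \<and> \<bar>M$2$1\<bar> = s powr (- r))"

lemma is_mono_op: assumes "is_mono r M" shows "opnorm M \<le> 2 * s powr \<bar>r\<bar>"
proof -
  have "s powr r \<le> s powr \<bar>r\<bar>" "s powr (- r) \<le> s powr \<bar>r\<bar>" using s1 by (auto intro!: powr_mono)
  then show ?thesis using opnorm_entries[of M] assms unfolding is_mono_def by auto
qed

lemma is_mono_A: "is_mono r M \<Longrightarrow> is_mono (step (x 0) + r) (A_sig s x ** M)"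
  unfolding is_mono_def A_sig_mk2 by (auto simp: abs_mult powr_add algebra_simps powr_diff powr_minus_divide)

lemma is_mono_flip: "is_mono r M \<Longrightarrow> is_mono (- r - 2 * (real d - real m)) (mk2 0 (- 1 / beta) beta 0 ** M)"
proof -
  have b: "beta > 0" "s powr (- r - 2 * (real d - real m)) = s powr (- r) / beta"
     "s powr (- (- r - 2 * (real d - real m))) = beta * s powr r"
  proof -
    show "beta > 0" "s powr (- r - 2 * (real d - real m)) = s powr (- r) / beta"
      using s1 by (simp_all add: beta_def powr_diff)
    show "s powr (- (- r - 2 * (real d - real m))) = beta * s powr r"
      unfolding beta_def powr_add[symmetric] by (rule arg_cong[where f = "\<lambda>y. s powr y"]) simp
  qed
  show "is_mono r M \<Longrightarrow> ?thesis"
    unfolding is_mono_def b(2,3) using b(1) by (auto simp: abs_mult)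
qed

lemma Mono_rho:
  assumes "\<And>t. t \<le> d \<Longrightarrow> \<not> marker d x (int t - int d)"
  shows "is_mono (rho x n) (Mono n x)"
proof (induction n)
  case 0
  show ?case using s1 by (simp add: is_mono_def mat_def)
next
  case (Suc n)
  have flip: "flip ((shift ^^ n) x) = (if marker d x (int n - int d) then mk2 0 (- 1 / beta) beta 0 else mat 1)"
    unfolding flip_def marker_shift_pow by (simp add: algebra_simps)
  have "is_mono (if d < n \<and> marker d x (int n - int d) then - rho x n - 2 * (real d - real m) else rho x n)
      (flip ((shift ^^ n) x) ** Mono n x)"
    using is_mono_flip[OF Suc] Suc assms[of n] unfolding flip by (cases "d < n") auto
  from is_mono_A[OF this, of "(shift ^^ n) x"] show ?case
    by (simp add: shift_pow matrix_mul_assoc)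
qed

text \<open>The first two clauses make \<open>pending\<close> vanish at both ends, so the
  conjugation in \<open>good_orbit\<close> disappears; the first also rules out the flips that the
  guard in \<open>rho\<close> ignores.\<close>

definition nice :: "nat \<Rightarrow> sigma \<Rightarrow> bool" where
  "nice n x \<longleftrightarrow> (\<forall>i\<in>{- int T..0}. \<not> marker m x i) \<and> (\<forall>i\<in>{int n - int T..<int n}. \<not> marker m x i)
     \<and> (\<forall>t<n. good ((shift ^^ t) x))"

lemma pending_zero: "(\<And>i. - int T \<le> i \<Longrightarrow> i < 0 \<Longrightarrow> \<not> marker m x i) \<Longrightarrow> pending x = 0"
  unfolding pending_def by (intro sum.neutral) (auto simp: shear_def)

lemma nice_norm:
  assumes "nice n x" shows "opnorm (cocycle_pow (Lc 1 0) n x) \<le> 2 * s powr \<bar>rho x n\<bar>"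
proof -
  have 0: "pending x = 0" by (rule pending_zero) (use assms in \<open>auto simp: nice_def\<close>)
  have 1: "pending ((shift ^^ n) x) = 0"
    by (rule pending_zero) (use assms in \<open>auto simp: nice_def marker_shift_pow\<close>)
  have l0: "lsh 0 = mat 1" by (simp add: lsh_def mat1_mk2)
  have "cocycle_pow (Lc 1 0) n x = Mono n x"
    using good_orbit[of n x] assms unfolding 0 1 l0 by (simp add: nice_def)
  moreover have "is_mono (rho x n) (Mono n x)"
  proof (rule Mono_rho)
    fix t assume "t \<le> d"
    then have "int t - int d \<in> {- int T..0}" using dT by auto
    then have "\<not> marker m x (int t - int d)" using assms by (auto simp: nice_def)
    then show "\<not> marker d x (int t - int d)" using marker_mono[of m d] md by auto
  qed
  ultimately show ?thesis using is_mono_op by simp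
qed

lemma rho_dep: "fdep {0..<int t} (\<lambda>x. rho x t)"
proof (induction t)
  case 0
  show ?case by (simp add: fdep_const)
next
  case (Suc t)
  show ?case
  proof (rule fdepI)
    fix x y :: sigma assume eq: "\<And>i. i \<in> {0..<int (Suc t)} \<Longrightarrow> x i = y i"
    have "rho x t = rho y t" by (rule fdepD[OF Suc]) (use eq in auto)
    moreover have "(d < t \<and> marker d x (int t - int d)) = (d < t \<and> marker d y (int t - int d))"
    proof (rule conj_cong[OF refl])
      assume "d < t"
      then show "marker d x (int t - int d) = marker d y (int t - int d)"
        by (intro fdepD[OF marker_dep[where I = "{0..<int (Suc t)}"]]) (use eq in auto)
    qed
    moreover have "x (int t) = y (int t)" by (rule eq) simp
    ultimately show "rho x (Suc t) = rho y (Suc t)" by simp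
  qed
qed

lemma rho_bound: "\<bar>rho x t\<bar> \<le> (1 + 2 * real d) * real t"
proof (induction t)
  case (Suc t)
  have "\<bar>rho x (Suc t)\<bar> \<le> 1 + (\<bar>rho x t\<bar> + 2 * real d)"
    using md by (auto simp: step_def)
  with Suc show ?case by (simp add: algebra_simps)
qed simp

lemma L0_entries:
  assumes \<eta>: "0 \<le> \<eta>"
  shows "s powr (\<Sum>t<n. step (x (int t))) \<le> cocycle_pow (Lc 0 \<eta>) n x $1$1 \<and>
     0 \<le> cocycle_pow (Lc 0 \<eta>) n x $1$2 \<and> 0 \<le> cocycle_pow (Lc 0 \<eta>) n x $2$1 \<and> 0 \<le> cocycle_pow (Lc 0 \<eta>) n x $2$2"
proof (induction n)
  case 0
  show ?case using s1 by (simp add: mat_def)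
next
  case (Suc n)
  let ?P = "cocycle_pow (Lc 0 \<eta>) n x" and ?y = "(shift ^^ n) x"
  define k where "k = (if ?y 0 then 0 else \<eta>)"
  have k: "0 \<le> k" using \<eta> by (simp add: k_def)
  have L: "Lc 0 \<eta> ?y = mk2 (s powr step (?y 0)) (s powr step (?y 0) * k) (s powr (- step (?y 0)) * k) (s powr (- step (?y 0)) * (1 + k\<^sup>2))"
    by (simp add: Lc_def A_sig_mk2 lsh_def ush_def noise_def k_def mat1_mk2 mk2_mult)
  have P: "s powr (\<Sum>t<n. step (x (int t))) \<le> ?P$1$1" "0 \<le> ?P$1$2" "0 \<le> ?P$2$1" "0 \<le> ?P$2$2" using Suc by auto
  have P0: "0 \<le> ?P$1$1" using P(1) by (meson order_trans powr_ge_zero)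
  have "s powr (\<Sum>t<Suc n. step (x (int t))) = s powr step (?y 0) * s powr (\<Sum>t<n. step (x (int t)))"
    by (simp add: shift_pow powr_add)
  also have "\<dots> \<le> s powr step (?y 0) * ?P$1$1" using P(1) by (intro mult_left_mono) auto
  also have "\<dots> \<le> s powr step (?y 0) * ?P$1$1 + s powr step (?y 0) * k * ?P$2$1" using P k by simp
  finally have 1: "s powr (\<Sum>t<Suc n. step (x (int t))) \<le> cocycle_pow (Lc 0 \<eta>) (Suc n) x $1$1" by (simp add: L)
  with P P0 k show ?case by (simp add: L)
qed

end

section \<open>Probability of good orbits\<close>

lemma (in bern) E_step: "E (\<lambda>x. step (x i)) = 2 * p - 1"
  using E_coord[of i 1 "-1"] by (simp add: step_def)

lemma (in bern) E_marker: "E (\<lambda>x. of_bool (marker k x i)) = p * (1 - p) ^ k"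
proof -
  let ?J = "insert (i - 1) {i..<i + int k}"
  have dep: "fdep ?J (\<lambda>x. of_bool (marker k x i) :: real)"
    by (rule fdepI) (auto simp: marker_def)
  have eq: "marker k (\<lambda>j. j \<in> S) i \<longleftrightarrow> S = {i - 1}" if "S \<subseteq> ?J" for S
    using that by (auto simp: marker_def)
  have "E (\<lambda>x. of_bool (marker k x i)) = (\<Sum>S\<in>Pow ?J. wt ?J S * of_bool (marker k (\<lambda>j. j \<in> S) i))"
    by (rule E_repr(2)[OF _ dep]) simp
  also have "\<dots> = (\<Sum>S\<in>Pow ?J. if S = {i - 1} then wt ?J S else 0)"
    by (intro sum.cong refl) (use eq in auto)
  also have "\<dots> = wt ?J {i - 1}" by (subst sum.delta) auto
  also have "\<dots> = p * (\<Prod>j\<in>{i..<i + int k}. 1 - p)"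
    unfolding wt_def by (subst prod.insert) (auto intro!: prod.cong)
  finally show ?thesis by simp
qed

lemma (in bern) marker_fd: "fd (\<lambda>x. marker k x i)"
  by (rule fdI[of "insert (i - 1) {i..<i + int k}"], simp, rule fdepI) (auto simp: marker_def)

lemma (in bern) height_fd: "fd (\<lambda>x. height x \<tau>)"
  by (rule fdI[of "{- int \<tau>..<0}"], simp, unfold height_def, rule fdepI, rule sum.cong) auto

lemma (in bern) height_mgf:
  assumes z: "0 < z" shows "E (\<lambda>x. z powr height x \<tau>) = (p * z + (1 - p) / z) ^ \<tau>"
proof (induction \<tau>)
  case 0
  show ?case using z by (simp add: height_def E_const)
next
  case (Suc \<tau>)
  have "E (\<lambda>x. z powr height x (Suc \<tau>)) = E (\<lambda>x. z powr step (x (- int \<tau> - 1)) * z powr height x \<tau>)"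
    by (simp add: height_def powr_add mult.commute)
  also have "\<dots> = E (\<lambda>x. z powr step (x (- int \<tau> - 1))) * E (\<lambda>x. z powr height x \<tau>)"
  proof (rule E_indep[where I = "{- int \<tau> - 1}" and J = "{- int \<tau>..<0}"])
    show "fd (\<lambda>x. z powr height x \<tau>)" by (rule fd_comp[OF height_fd])
    show "fdep {- int \<tau>..<0} (\<lambda>x. z powr height x \<tau>)"
      unfolding height_def by (rule fdepI, rule arg_cong[where f = "\<lambda>y. z powr y"], rule sum.cong) auto
  qed (auto simp: fdep_def)
  also have "E (\<lambda>x. z powr step (x (- int \<tau> - 1))) = p * z + (1 - p) / z"
    using E_coord[of "- int \<tau> - 1" z "1 / z"] z by (simp add: step_def if_distrib powr_minus_divide cong: if_cong)
  finally show ?case using Suc by simp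
qed

lemma (in bern) height_chernoff:
  assumes z: "0 < z" "z < 1"
  shows "E (\<lambda>x. of_bool (height x T < \<gamma> * real T)) \<le> (z powr (- \<gamma>) * (p * z + (1 - p) / z)) ^ T"
proof -
  have "E (\<lambda>x. of_bool (height x T < \<gamma> * real T)) \<le> E (\<lambda>x. z powr (- \<gamma> * real T) * z powr height x T)"
  proof (rule E_mono)
    fix x
    have "1 \<le> z powr (height x T - \<gamma> * real T)" if "height x T < \<gamma> * real T"
      using powr_mono'[of "height x T - \<gamma> * real T" 0 z] that z by simp
    then show "of_bool (height x T < \<gamma> * real T) \<le> z powr (- \<gamma> * real T) * z powr height x T"
      by (auto simp: powr_add[symmetric])
  qed (rule fd_comp[OF height_fd] )+
  also have "\<dots> = z powr (- \<gamma> * real T) * (p * z + (1 - p) / z) ^ T"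
    by (simp add: E_cmult height_mgf[OF z(1)])
  also have "z powr (- \<gamma> * real T) = (z powr (- \<gamma>)) ^ T"
    using z by (simp add: powr_powr flip: powr_realpow)
  finally show ?thesis by (simp add: power_mult_distrib)
qed

section \<open>Moments of the logarithmic size and probability of bad orbits\<close>

locale pconstr = bern + constr
begin

definition q :: real where "q = p * (1 - p) ^ d"
definition qc :: real where "qc = p * (1 - p) ^ m"

lemma q_pos: "0 < q" "q \<le> 1" "0 < qc"
proof -
  show "0 < q" "0 < qc" using p0 p1 by (auto simp: q_def qc_def)
  have "(1 - p) ^ d \<le> 1" using p0 p1 by (intro power_le_one) auto
  then show "q \<le> 1" using p0 p1 mult_mono[of p 1 "(1 - p) ^ d" 1] by (simp add: q_def)
qed

definition bot :: "sigma \<Rightarrow> nat \<Rightarrow> bool" where "bot x t \<longleftrightarrow> d < t \<and> marker d x (int t - int d)"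

text \<open>The value between the possible flip and the diagonal matrix at time \<open>t\<close>. It
  is determined by the symbols before \<open>t\<close> and so independent of the step taken at
  \<open>t\<close>.\<close>

definition rho_after :: "sigma \<Rightarrow> nat \<Rightarrow> real" where
  "rho_after x t = (if bot x t then - rho x t - 2 * (real d - real m) else rho x t)"

lemma rho_Suc: "rho x (Suc t) = step (x (int t)) + rho_after x t"
  by (simp add: rho_after_def bot_def)

lemma bot_dep: "fdep {0..<int t} (\<lambda>x. bot x t)"
proof (cases "d < t")
  case True
  then show ?thesis unfolding bot_def by (simp, intro marker_dep) auto
qed (simp add: bot_def fdep_const)

lemma rho_after_dep: "fdep {0..<int t} (\<lambda>x. rho_after x t)"
  unfolding rho_after_def
  by (rule fdep_comp2[OF bot_dep rho_dep, where h = "\<lambda>b r. if b then - r - 2 * (real d - real m) else r"])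

lemma rho_fd: "fd (\<lambda>x. rho x t)" by (rule fdI[OF _ rho_dep]) simp
lemma rho_after_fd: "fd (\<lambda>x. rho_after x t)" by (rule fdI[OF _ rho_after_dep]) simp
lemma bot_fd: "fd (\<lambda>x. of_bool (bot x t) :: real)" by (rule fd_comp[OF fdI[OF _ bot_dep]]) simp
lemma step_fd: "fd (\<lambda>x. step (x i))" by (rule fd_comp[OF fd_coord])

definition mean_rho :: "nat \<Rightarrow> real" where "mean_rho t = E (\<lambda>x. rho x t)"

lemma mean_rho_Suc: "mean_rho (Suc t) = (2 * p - 1) + E (\<lambda>x. rho_after x t)"
  unfolding mean_rho_def rho_Suc by (simp add: E_add[OF step_fd rho_after_fd] E_step)

text \<open>A marker \<open>1 0\<^sup>d\<close> that ends at time \<open>t\<close> excludes any other flip of the sign during its run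
  of zeros.\<close>

lemma rho_at_bot:
  assumes "bot x t" shows "rho x t = rho_after x (t - d - 1) + 1 - real d"
proof -
  define a where "a = t - d - 1"
  have t: "t = Suc a + d" using assms by (simp add: bot_def a_def)
  have C: "marker d x (int a + 1)" using assms by (simp add: bot_def t algebra_simps)
  then have xa: "x (int a)" and z: "\<And>i. int a < i \<Longrightarrow> i \<le> int a + int d \<Longrightarrow> \<not> x i"
    by (auto simp: marker_def)
  have "rho x (Suc a + k) = rho_after x a + 1 - real k" if "k \<le> d" for k
    using that
  proof (induction k)
    case 0
    show ?case using xa rho_Suc[of x a] by (simp add: step_def)
  next
    case (Suc k)
    let ?s = "Suc a + k"
    have "\<not> bot x ?s"
    proof
      assume "bot x ?s"
      then have "\<forall>j\<in>{int ?s - int d..<int ?s}. \<not> x j" by (auto simp: bot_def marker_def)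
      moreover have "int a \<in> {int ?s - int d..<int ?s}" using Suc.prems by auto
      ultimately show False using xa by blast
    qed
    then have "rho_after x ?s = rho x ?s" by (simp add: rho_after_def)
    moreover have "step (x (int ?s)) = - 1" using z[of "int ?s"] Suc.prems by (simp add: step_def)
    ultimately show ?case using Suc rho_Suc[of x ?s] by simp
  qed
  from this[OF order_refl] show ?thesis unfolding t[symmetric] unfolding a_def .
qed

lemma E_bot: "E (\<lambda>x. of_bool (bot x t)) \<le> q"
proof (cases "d < t")
  case True
  then show ?thesis by (simp add: bot_def E_marker q_def)
next
  case False
  then show ?thesis using q_pos by (simp add: bot_def E_const)
qed

lemma mean_rho_early: "t \<le> d \<Longrightarrow> mean_rho (Suc t) = mean_rho t + (2 * p - 1)"
  unfolding mean_rho_Suc by (simp add: rho_after_def bot_def mean_rho_def)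

definition c1 :: real where "c1 = (2 * p - 1) + 2 * q * (2 * p - 2 + real m)"

text \<open>A flip adds \<open>- 2 * rho x t\<close> and a constant. By \<open>rho_at_bot\<close>,
  \<open>rho x t\<close> is then determined by the symbols before the marker, which are independent
  of it. The correction to the mean is therefore \<open>q\<close> times a mean at the earlier time
  \<open>t - d\<close>.\<close>

lemma mean_rho_late: assumes "d < t" shows "mean_rho (Suc t) = mean_rho t - 2 * q * mean_rho (t - d) + c1"
proof -
  define a where "a = t - d - 1"
  have Sa: "Suc a = t - d" using assms by (simp add: a_def)
  let ?G = "\<lambda>x. 2 * (rho_after x a + 1 - real d) + 2 * (real d - real m)"
  have fG: "fd ?G" by (rule fd_comp[OF rho_after_fd])
  have dG: "fdep {0..<int a} ?G" by (rule fdep_comp[OF rho_after_dep])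
  have bt: "bot x t = marker d x (int a + 1)" for x
  proof -
    have "int t - int d = int a + 1" using assms by (simp add: a_def)
    then show ?thesis using assms by (simp add: bot_def)
  qed
  have dC: "fdep {int a..<int t} (\<lambda>x. of_bool (bot x t) :: real)"
    unfolding bt by (rule fdep_comp[OF marker_dep]) (use assms in \<open>auto simp: a_def\<close>)
  have eq: "rho_after x t = rho x t - of_bool (bot x t) * ?G x" for x
    using rho_at_bot[of x t] by (auto simp: rho_after_def a_def)
  have "E (\<lambda>x. of_bool (bot x t) * ?G x) = E (\<lambda>x. of_bool (bot x t)) * E ?G"
    by (rule E_indep[OF _ dC fG dG]) auto
  also have "E (\<lambda>x. of_bool (bot x t)) = q" unfolding bt E_marker by (simp add: q_def)
  also have "E ?G = 2 * E (\<lambda>x. rho_after x a) + (2 * (1 - real d) + 2 * (real d - real m))"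
  proof -
    have "E ?G = E (\<lambda>x. 2 * rho_after x a + (2 * (1 - real d) + 2 * (real d - real m)))"
      by (rule arg_cong[where f = E]) (simp add: algebra_simps)
    also have "\<dots> = E (\<lambda>x. 2 * rho_after x a) + E (\<lambda>x. 2 * (1 - real d) + 2 * (real d - real m))"
      by (rule E_add[OF fd_comp[OF rho_after_fd] fd_const])
    finally show ?thesis by (simp add: E_cmult E_const)
  qed
  also have "E (\<lambda>x. rho_after x a) = mean_rho (t - d) - (2 * p - 1)" using mean_rho_Suc[of a] unfolding Sa by simp
  finally have 1: "E (\<lambda>x. of_bool (bot x t) * ?G x) = q * (2 * (mean_rho (t - d) - (2 * p - 1)) + (2 * (1 - real d) + 2 * (real d - real m)))" .
  have "E (\<lambda>x. rho_after x t) = mean_rho t - E (\<lambda>x. of_bool (bot x t) * ?G x)"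
    unfolding eq mean_rho_def by (rule E_diff[OF rho_fd fd_comp2[OF bot_fd fG]])
  then show ?thesis unfolding mean_rho_Suc 1 c1_def by (simp add: algebra_simps)
qed

text \<open>The delay recursion of \<open>mean_rho_late\<close> is damped: increments are bounded by 10 as long as the bound
  \<open>4 / q\<close> holds, so replacing the delayed value by the current one costs only \<open>20qd \<le> 6\<close>.\<close>

lemma mean_rho_bound:
  assumes qd: "q * real d \<le> 3 / 10"
  shows "\<bar>mean_rho t\<bar> \<le> 4 / q"
proof -
  have q: "0 < q" "q \<le> 1" by (rule q_pos)+
  have qm: "0 \<le> q * real m" "q * real m \<le> 3 / 10"
  proof -
    have "q * real m \<le> q * real d" using q md by (intro mult_left_mono) auto
    then show "q * real m \<le> 3 / 10" using qd by (rule order_trans)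
  qed (use q in simp)
  have "2 * q * (2 * p - 2 + real m) \<le> 2 * (q * real m)"
    using q p1 mult_left_mono[of "2 * p - 2 + real m" "real m" "2 * q"] by simp
  moreover have "0 \<le> 2 * q * (2 * p - 2 + real m)" using q p0 m2 by simp
  ultimately have c1: "\<bar>c1\<bar> \<le> 2" using qm p0 p1 unfolding c1_def by linarith
  have q2: "q \<le> 1 / 2"
  proof -
    have "q * 2 \<le> q * real d" using m2 md q by (intro mult_left_mono) auto
    then show ?thesis using qd by simp
  qed
  have inc: "\<bar>mean_rho (Suc t) - mean_rho t\<bar> \<le> 10" if "\<And>s. s \<le> t \<Longrightarrow> \<bar>mean_rho s\<bar> \<le> 4 / q" for t
  proof (cases "d < t")
    case True
    have "\<bar>2 * q * mean_rho (t - d)\<bar> = 2 * q * \<bar>mean_rho (t - d)\<bar>" using q by (simp add: abs_mult)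
    also have "\<dots> \<le> 2 * q * (4 / q)" using that[of "t - d"] q by (intro mult_left_mono) auto
    also have "\<dots> = 8" using q by simp
    finally show ?thesis using mean_rho_late[OF True] c1 by linarith
  next
    case False
    then show ?thesis using mean_rho_early[of t] p0 p1 by simp
  qed
  have early: "\<bar>mean_rho t\<bar> \<le> real t" if "t \<le> Suc d" for t
    using that
  proof (induction t)
    case 0
    show ?case by (simp add: mean_rho_def E_const)
  next
    case (Suc t)
    then show ?case using mean_rho_early[of t] p0 p1 by auto
  qed
  show ?thesis
  proof (induction t rule: less_induct)
    case (less t)
    show ?case
    proof (cases "t \<le> Suc d")
      case True
      have "q * real t \<le> q * (real d + 1)" using True q by (intro mult_left_mono) auto
      also have "\<dots> \<le> 4" using qd q by (simp add: algebra_simps)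
      finally have "real t \<le> 4 / q" using q by (simp add: field_simps)
      with early[OF True] show ?thesis by linarith
    next
      case False
      then obtain u where u: "t = Suc u" "d < u" by (cases t) auto
      have yl: "\<bar>mean_rho s\<bar> \<le> 4 / q" if "s \<le> u" for s using less[of s] that u by simp
      define v where "v = u - d"
      have uv: "u = v + d" using u by (simp add: v_def)
      have "\<bar>mean_rho (v + k) - mean_rho v\<bar> \<le> 10 * real k" if "k \<le> d" for k
        using that
      proof (induction k)
        case (Suc k)
        have "\<bar>mean_rho (Suc (v + k)) - mean_rho (v + k)\<bar> \<le> 10"
          by (rule inc, rule yl) (use Suc.prems uv in auto)
        moreover have "\<bar>mean_rho (v + k) - mean_rho v\<bar> \<le> 10 * real k" using Suc by simp
        ultimately show ?case by (simp add: abs_le_iff)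
      qed simp
      from this[of d] have dif: "\<bar>mean_rho u - mean_rho (u - d)\<bar> \<le> 10 * real d" by (simp add: uv)
      \<comment> \<open>The damping yields 8, which pays 6 for the delay and 2 for
        \<open>c1\<close>, so the induction closes.\<close>
      have "mean_rho t = (1 - 2 * q) * mean_rho u + 2 * q * (mean_rho u - mean_rho (u - d)) + c1"
        unfolding u(1) mean_rho_late[OF u(2)] by (simp add: algebra_simps)
      moreover have "\<bar>(1 - 2 * q) * mean_rho u\<bar> \<le> (1 - 2 * q) * (4 / q)"
        unfolding abs_mult by (intro mult_mono yl) (use q2 in auto)
      moreover have "(1 - 2 * q) * (4 / q) = 4 / q - 8" using q by (simp add: field_simps)
      moreover have "\<bar>2 * q * (mean_rho u - mean_rho (u - d))\<bar> \<le> 6"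
      proof -
        have "\<bar>2 * q * (mean_rho u - mean_rho (u - d))\<bar> = 2 * q * \<bar>mean_rho u - mean_rho (u - d)\<bar>" using q by (simp add: abs_mult)
        also have "\<dots> \<le> 2 * q * (10 * real d)" using dif q by (intro mult_left_mono) auto
        finally show ?thesis using qd by simp
      qed
      ultimately show ?thesis using c1 by linarith
    qed
  qed
qed

text \<open>The step is independent of \<open>rho_after\<close>, so the mixed term is the drift
  times a mean, which \<open>mean_rho_bound\<close> keeps of order 1/q instead of n. At long markers
  the crude \<open>rho_bound\<close> suffices, being weighted by their probability
  \<open>q\<close>.\<close>

lemma rho_sq:
  assumes qd: "q * real d \<le> 3 / 10" and t: "t \<le> n"
  shows "E (\<lambda>x. (rho x t)\<^sup>2) \<le> real t * (3 + 8 / q + q * (12 * (real d)\<^sup>2 * real n + 4 * (real d)\<^sup>2))"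
  using t
proof (induction t)
  case 0
  show ?case by (simp add: E_const)
next
  case (Suc t)
  let ?B = "12 * (real d)\<^sup>2 * real n + 4 * (real d)\<^sup>2"
  let ?b = "real d - real m"
  have frp: "fd (\<lambda>x. (rho_after x t)\<^sup>2)" by (rule fd_comp[OF rho_after_fd])
  have fr: "fd (\<lambda>x. (rho x t)\<^sup>2)" by (rule fd_comp[OF rho_fd])
  have sq: "(rho x (Suc t))\<^sup>2 = (1 + 2 * (step (x (int t)) * rho_after x t)) + (rho_after x t)\<^sup>2" for x
  proof -
    have "(step (x (int t)))\<^sup>2 = 1" by (simp add: step_def)
    then show ?thesis unfolding rho_Suc by (simp add: power2_sum)
  qed
  have fm: "fd (\<lambda>x. step (x (int t)) * rho_after x t)" by (rule fd_comp2[OF step_fd rho_after_fd])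
  have "E (\<lambda>x. step (x (int t)) * rho_after x t) = E (\<lambda>x. step (x (int t))) * E (\<lambda>x. rho_after x t)"
    by (rule E_indep[where I = "{int t}" and J = "{0..<int t}", OF _ _ rho_after_fd rho_after_dep]) (auto simp: fdep_def)
  also have "\<dots> = (2 * p - 1) * (mean_rho (Suc t) - (2 * p - 1))" by (simp add: E_step mean_rho_Suc)
  also have "\<dots> \<le> 1 * (4 / q + 1)"
  proof -
    have "\<bar>(2 * p - 1) * (mean_rho (Suc t) - (2 * p - 1))\<bar> \<le> 1 * (4 / q + 1)"
      unfolding abs_mult using mean_rho_bound[OF qd, of "Suc t"] p0 p1 by (intro mult_mono) auto
    then show ?thesis by linarith
  qed
  finally have m: "E (\<lambda>x. step (x (int t)) * rho_after x t) \<le> 4 / q + 1" by simp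
  have "E (\<lambda>x. (rho_after x t)\<^sup>2) \<le> E (\<lambda>x. (rho x t)\<^sup>2 + ?B * of_bool (bot x t))"
  proof (rule E_mono[OF frp fd_comp2[OF fr fd_comp[OF bot_fd]]])
    fix x
    have b: "0 \<le> ?b" "?b \<le> real d" using md by auto
    have r: "\<bar>rho x t\<bar> \<le> (1 + 2 * real d) * real n"
      by (rule order_trans[OF rho_bound mult_left_mono]) (use Suc.prems in auto)
    have "(- rho x t - 2 * ?b)\<^sup>2 = (rho x t)\<^sup>2 + 4 * ?b * rho x t + 4 * ?b\<^sup>2"
      by (simp add: power2_eq_square algebra_simps)
    also have "4 * ?b * rho x t \<le> 4 * (real d * ((1 + 2 * real d) * real n))"
    proof -
      have "?b * rho x t \<le> ?b * \<bar>rho x t\<bar>" using b by (intro mult_left_mono) auto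
      also have "\<dots> \<le> real d * ((1 + 2 * real d) * real n)" using b r by (intro mult_mono) auto
      finally show ?thesis unfolding mult.assoc by (rule mult_left_mono) simp
    qed
    also have "real d * ((1 + 2 * real d) * real n) \<le> 3 * (real d)\<^sup>2 * real n"
    proof -
      have "real d * 1 \<le> real d * real d" using md by (intro mult_left_mono) auto
      then have "real d * (1 + 2 * real d) \<le> 3 * (real d)\<^sup>2" by (simp add: power2_eq_square algebra_simps)
      then have "real d * (1 + 2 * real d) * real n \<le> 3 * (real d)\<^sup>2 * real n"
        by (rule mult_right_mono) simp
      then show ?thesis by (simp only: mult.assoc)
    qed
    also have "4 * ?b\<^sup>2 \<le> 4 * (real d)\<^sup>2" using b by (simp add: power_mono)
    finally have "(- rho x t - 2 * ?b)\<^sup>2 \<le> (rho x t)\<^sup>2 + ?B" by simp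
    then show "(rho_after x t)\<^sup>2 \<le> (rho x t)\<^sup>2 + ?B * of_bool (bot x t)" by (simp add: rho_after_def)
  qed
  also have "\<dots> = E (\<lambda>x. (rho x t)\<^sup>2) + ?B * E (\<lambda>x. of_bool (bot x t))"
    by (simp add: E_add[OF fr fd_comp[OF bot_fd]] E_cmult)
  also have "?B * E (\<lambda>x. of_bool (bot x t)) \<le> ?B * q" by (intro mult_left_mono E_bot) auto
  finally have s: "E (\<lambda>x. (rho_after x t)\<^sup>2) \<le> E (\<lambda>x. (rho x t)\<^sup>2) + ?B * q" by simp
  have "E (\<lambda>x. (rho x (Suc t))\<^sup>2) = E (\<lambda>x. 1 + 2 * (step (x (int t)) * rho_after x t)) + E (\<lambda>x. (rho_after x t)\<^sup>2)"
    unfolding sq by (rule E_add[OF fd_comp[OF fm] frp])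
  also have "E (\<lambda>x. 1 + 2 * (step (x (int t)) * rho_after x t)) = 1 + 2 * E (\<lambda>x. step (x (int t)) * rho_after x t)"
    by (simp only: E_add[OF fd_const fd_comp[OF fm]] E_cmult E_const)
  finally have 1: "E (\<lambda>x. (rho x (Suc t))\<^sup>2) = 1 + 2 * E (\<lambda>x. step (x (int t)) * rho_after x t) + E (\<lambda>x. (rho_after x t)\<^sup>2)" .
  have "E (\<lambda>x. (rho x (Suc t))\<^sup>2) \<le> 1 + 2 * (4 / q + 1) + (E (\<lambda>x. (rho x t)\<^sup>2) + ?B * q)"
    unfolding 1 by (intro add_mono mult_left_mono m s order_refl) simp
  also have "\<dots> = E (\<lambda>x. (rho x t)\<^sup>2) + (3 + 8 / q + q * ?B)" by simp
  also have "\<dots> \<le> real t * (3 + 8 / q + q * ?B) + (3 + 8 / q + q * ?B)" using Suc by simp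
  also have "\<dots> = real (Suc t) * (3 + 8 / q + q * ?B)" by (simp add: algebra_simps add_divide_distrib)
  finally show ?case .
qed

text \<open>The arithmetic-geometric mean inequality for \<open>\<bar>rho x n\<bar>\<close> and
  \<open>real n * e\<close>, in place of Cauchy-Schwarz.\<close>

lemma rho_abs:
  assumes qd: "q * real d \<le> 3 / 10" and n: "1 \<le> n" and e: "0 < e"
  shows "E (\<lambda>x. \<bar>rho x n\<bar>) \<le> (3 + 8 / q + q * (12 * (real d)\<^sup>2 * real n + 4 * (real d)\<^sup>2)) / (2 * e) + real n * e / 2"
proof -
  let ?c = "1 / (2 * real n * e)"
  let ?W = "3 + 8 / q + q * (12 * (real d)\<^sup>2 * real n + 4 * (real d)\<^sup>2)"
  have ne: "0 < real n * e" using n e by simp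
  have fr: "fd (\<lambda>x. ?c * (rho x n)\<^sup>2)" by (rule fd_comp[OF rho_fd])
  have "E (\<lambda>x. \<bar>rho x n\<bar>) \<le> E (\<lambda>x. ?c * (rho x n)\<^sup>2 + real n * e / 2)"
  proof (rule E_mono[OF fd_comp[OF rho_fd] fd_comp2[OF fr fd_const]])
    fix x
    have "0 \<le> (\<bar>rho x n\<bar> - real n * e)\<^sup>2" by simp
    then have "2 * \<bar>rho x n\<bar> * (real n * e) \<le> (rho x n)\<^sup>2 + (real n * e)\<^sup>2" by (simp add: power2_diff)
    then have "\<bar>rho x n\<bar> \<le> ((rho x n)\<^sup>2 + (real n * e)\<^sup>2) / (2 * (real n * e))"
      using ne by (subst pos_le_divide_eq) (auto simp: mult_ac less_imp_le)
    also have "\<dots> = ?c * (rho x n)\<^sup>2 + real n * e / 2"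
      using n e by (simp add: field_simps power2_eq_square)
    finally show "\<bar>rho x n\<bar> \<le> ?c * (rho x n)\<^sup>2 + real n * e / 2" .
  qed
  also have "\<dots> = ?c * E (\<lambda>x. (rho x n)\<^sup>2) + real n * e / 2"
    by (simp only: E_add[OF fr fd_const] E_cmult E_const)
  also have "?c * E (\<lambda>x. (rho x n)\<^sup>2) \<le> ?c * (real n * ?W)"
    by (intro mult_left_mono rho_sq[OF qd]) (use n e in \<open>auto simp: zero_le_mult_iff\<close>)
  also have "?c * (real n * ?W) = ?W / (2 * e)" using n e by simp
  finally show ?thesis by simp
qed

text \<open>If the words overlap, the 1 of the later marker lies in the zeros of the earlier one and
  the event is empty; otherwise they occupy disjoint coordinates.\<close>

lemma E_two_markers:
  assumes "d < \<tau>" shows "E (\<lambda>x. of_bool (marker d x (i - int d) \<and> marker m x (i - int \<tau>))) \<le> q * qc"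
proof (cases "\<tau> \<le> d + m")
  case True
  have "\<not> (marker d x (i - int d) \<and> marker m x (i - int \<tau>))" for x
  proof
    assume "marker d x (i - int d) \<and> marker m x (i - int \<tau>)"
    then have "x (i - int d - 1)" "\<forall>j\<in>{i - int \<tau>..<i - int \<tau> + int m}. \<not> x j" by (auto simp: marker_def)
    moreover have "i - int d - 1 \<in> {i - int \<tau>..<i - int \<tau> + int m}" using True assms by auto
    ultimately show False by blast
  qed
  then have "(\<lambda>x. of_bool (marker d x (i - int d) \<and> marker m x (i - int \<tau>)) :: real) = (\<lambda>x. 0)"
    by (intro ext) simp
  then show ?thesis using q_pos by (simp add: E_const)
next
  case False
  have "E (\<lambda>x. of_bool (marker d x (i - int d)) * of_bool (marker m x (i - int \<tau>))) =
      E (\<lambda>x. of_bool (marker d x (i - int d))) * E (\<lambda>x. of_bool (marker m x (i - int \<tau>)))"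
    by (rule E_indep[where I = "{i - int d - 1..<i}" and J = "{i - int \<tau> - 1..<i - int \<tau> + int m}"])
       (use False in \<open>auto intro!: fd_comp[OF marker_fd] fdep_comp[OF marker_dep]\<close>)
  then show ?thesis by (simp add: E_marker q_def qc_def of_bool_conj)
qed

lemma not_nice_iff:
  "\<not> nice n x \<longleftrightarrow> (\<exists>i\<in>{- int T..0}. marker m x i) \<or> (\<exists>i\<in>{int n - int T..<int n}. marker m x i)
     \<or> (\<exists>t\<in>{..<n}. height ((shift ^^ t) x) T < \<gamma> * real T)
     \<or> (\<exists>(t, \<tau>)\<in>{..<n} \<times> {d<..T}. marker d x (int t - int d) \<and> marker m x (int t - int \<tau>))"
  by (auto simp: nice_def good_def marker_shift_pow not_le)

lemma bad_fd:
  "fd (\<lambda>x. height ((shift ^^ t) x) T < \<gamma> * real T)"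
  "fd (\<lambda>x. case u of (t, \<tau>) \<Rightarrow> marker d x (int t - int d) \<and> marker m x (int t - int \<tau>))"
proof -
  show "fd (\<lambda>x. height ((shift ^^ t) x) T < \<gamma> * real T)"
    by (rule fd_shift[OF fd_comp[OF height_fd, where h = "\<lambda>h. h < \<gamma> * real T"]])
  show "fd (\<lambda>x. case u of (t, \<tau>) \<Rightarrow> marker d x (int t - int d) \<and> marker m x (int t - int \<tau>))"
    unfolding case_prod_beta by (rule fd_comp2[OF marker_fd marker_fd])
qed

lemma nice_fd: "fd (\<lambda>x. of_bool (\<not> nice n x) :: real)"
  unfolding not_nice_iff
  by (intro fd_comp[where h = of_bool] fd_comp2[where h = "(\<or>)"] fd_bex bad_fd marker_fd) simp_all

text \<open>A union bound. Short markers count only near the two ends and before a long marker;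
  since others are harmless, the last term has size n q T qc, which stays small for n of order
  m/q.\<close>

lemma bad_prob:
  assumes z: "0 < z" "z < 1"
  shows "E (\<lambda>x. of_bool (\<not> nice n x)) \<le> (2 * real T + 1) * qc
     + real n * (z powr (- \<gamma>) * (p * z + (1 - p) / z)) ^ T + real n * real T * (q * qc)"
proof -
  let ?\<theta> = "(z powr (- \<gamma>) * (p * z + (1 - p) / z)) ^ T"
  have h: "E (\<lambda>x. of_bool (height ((shift ^^ t) x) T < \<gamma> * real T)) \<le> ?\<theta>" for t
    using E_shift[OF fd_comp[OF height_fd], of "\<lambda>h. of_bool (h < \<gamma> * real T)" t T] height_chernoff[OF z] by simp
  have "E (\<lambda>x. of_bool (\<not> nice n x)) \<le> (\<Sum>i\<in>{- int T..0}. E (\<lambda>x. of_bool (marker m x i)))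
     + ((\<Sum>i\<in>{int n - int T..<int n}. E (\<lambda>x. of_bool (marker m x i)))
     + ((\<Sum>t<n. E (\<lambda>x. of_bool (height ((shift ^^ t) x) T < \<gamma> * real T)))
     + (\<Sum>u\<in>{..<n} \<times> {d<..T}. E (\<lambda>x. of_bool (case u of (t, \<tau>) \<Rightarrow> marker d x (int t - int d) \<and> marker m x (int t - int \<tau>))))))"
    unfolding not_nice_iff
    by (intro order_trans[OF E_or] add_mono E_bex fd_bex bad_fd marker_fd fd_comp2[where h = "(\<or>)"]) auto
  also have "\<dots> \<le> (real T + 1) * qc + (real T * qc + (real n * ?\<theta> + real n * real T * (q * qc)))"
  proof (intro add_mono)
    show "(\<Sum>t<n. E (\<lambda>x. of_bool (height ((shift ^^ t) x) T < \<gamma> * real T))) \<le> real n * ?\<theta>"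
      using sum_mono[OF h, of "\<lambda>t. t" "{..<n}"] by simp
    have "(\<Sum>u\<in>{..<n} \<times> {d<..T}. E (\<lambda>x. of_bool (case u of (t, \<tau>) \<Rightarrow> marker d x (int t - int d) \<and> marker m x (int t - int \<tau>))))
        \<le> (\<Sum>u\<in>{..<n} \<times> {d<..T}. q * qc)"
      by (intro sum_mono) (auto intro!: E_two_markers)
    also have "\<dots> = real n * real (T - d) * (q * qc)" by (simp add: card_cartesian_product)
    also have "\<dots> \<le> real n * real T * (q * qc)"
      using q_pos by (intro mult_left_mono mult_right_mono) auto
    finally show "(\<Sum>u\<in>{..<n} \<times> {d<..T}. E (\<lambda>x. of_bool (case u of (t, \<tau>) \<Rightarrow> marker d x (int t - int d) \<and> marker m x (int t - int \<tau>))))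
        \<le> real n * real T * (q * qc)" .
  qed (simp_all add: E_marker qc_def)
  finally show ?thesis by (simp add: algebra_simps)
qed

lemma coc_Lc: "0 \<le> t \<Longrightarrow> t \<le> 1 \<Longrightarrow> 0 \<le> \<eta> \<Longrightarrow> \<eta> \<le> 1 \<Longrightarrow> coc p (Lc t \<eta>) KL CL"
  by unfold_locales (auto intro: Lc_dep Lc_det Lc_op)

lemma mlog_upper:
  assumes qd: "q * real d \<le> 3 / 10" and n: "1 \<le> n" and e: "0 < e" and z: "0 < z" "z < 1"
  shows "coc.mlog p (Lc 1 0) n \<le> ln 2
     + ln s * ((3 + 8 / q + q * (12 * (real d)\<^sup>2 * real n + 4 * (real d)\<^sup>2)) / (2 * e) + real n * e / 2)
     + real n * ln CL * ((2 * real T + 1) * qc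
     + real n * (z powr (- \<gamma>) * (p * z + (1 - p) / z)) ^ T + real n * real T * (q * qc))"
proof -
  interpret c: coc p "Lc 1 0" KL CL by (rule coc_Lc) auto
  have fr: "fd (\<lambda>x. ln s * \<bar>rho x n\<bar>)" by (rule fd_comp[OF rho_fd])
  have fr2: "fd (\<lambda>x. ln 2 + ln s * \<bar>rho x n\<bar>)" by (rule fd_comp[OF rho_fd])
  have fb: "fd (\<lambda>x. (real n * ln CL) * of_bool (\<not> nice n x))" by (rule fd_comp[OF nice_fd])
  have lnC: "0 \<le> ln CL" using c.C1 by simp
  have "c.mlog n \<le> E (\<lambda>x. (ln 2 + ln s * \<bar>rho x n\<bar>) + (real n * ln CL) * of_bool (\<not> nice n x))"
    unfolding c.mlog_def
  proof (rule E_mono[OF c.lnop_fd fd_comp2[OF fr2 fb]])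
    fix x
    show "ln (opnorm (cocycle_pow (Lc 1 0) n x)) \<le> (ln 2 + ln s * \<bar>rho x n\<bar>) + (real n * ln CL) * of_bool (\<not> nice n x)"
    proof (cases "nice n x")
      case True
      have "ln (opnorm (cocycle_pow (Lc 1 0) n x)) \<le> ln (2 * s powr \<bar>rho x n\<bar>)"
        using nice_norm[OF True] c.cp_ge1[of n x] by (intro ln_mono) auto
      also have "\<dots> = ln 2 + ln s * \<bar>rho x n\<bar>" using s1 by (simp add: ln_mult_pos ln_powr)
      finally show ?thesis using True by simp
    next
      case False
      have "0 \<le> ln 2 + ln s * \<bar>rho x n\<bar>" using s1 by (intro add_nonneg_nonneg mult_nonneg_nonneg) auto
      then show ?thesis using False c.ln_cp_le[of n x] by simp
    qed
  qed
  also have "\<dots> = (ln 2 + ln s * E (\<lambda>x. \<bar>rho x n\<bar>)) + (real n * ln CL) * E (\<lambda>x. of_bool (\<not> nice n x))"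
    by (simp only: E_add[OF fr2 fb] E_add[OF fd_const fr] E_cmult E_const)
  also have "\<dots> \<le> (ln 2 + ln s * ((3 + 8 / q + q * (12 * (real d)\<^sup>2 * real n + 4 * (real d)\<^sup>2)) / (2 * e) + real n * e / 2))
     + (real n * ln CL) * ((2 * real T + 1) * qc
     + real n * (z powr (- \<gamma>) * (p * z + (1 - p) / z)) ^ T + real n * real T * (q * qc))"
    using s1 lnC by (intro add_mono mult_left_mono rho_abs[OF qd n e] bad_prob[OF z]) auto
  finally show ?thesis by simp
qed

lemma lyap_lower:
  assumes "0 \<le> \<eta>" "\<eta> \<le> 1" shows "(2 * p - 1) * ln s \<le> lyap (Lc 0 \<eta>) (mu p)"
proof -
  interpret c: coc p "Lc 0 \<eta>" KL CL by (rule coc_Lc) (use assms in auto)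
  show ?thesis
  proof (rule c.lyap_ge)
    fix n :: nat assume "1 \<le> n"
    have fs: "fd (\<lambda>x. \<Sum>t<n. step (x (int t)))" by (intro fd_sum step_fd)
    have "E (\<lambda>x. ln s * (\<Sum>t<n. step (x (int t)))) \<le> c.mlog n"
      unfolding c.mlog_def
    proof (rule E_mono[OF fd_comp[OF fs] c.lnop_fd])
      fix x
      have "s powr (\<Sum>t<n. step (x (int t))) \<le> opnorm (cocycle_pow (Lc 0 \<eta>) n x)"
        using L0_entries[OF assms(1), where n = n and x = x] opnorm_entry11[of "cocycle_pow (Lc 0 \<eta>) n x"] by linarith
      then have "ln (s powr (\<Sum>t<n. step (x (int t)))) \<le> ln (opnorm (cocycle_pow (Lc 0 \<eta>) n x))"
        using s1 by (intro ln_mono) auto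
      then show "ln s * (\<Sum>t<n. step (x (int t))) \<le> ln (opnorm (cocycle_pow (Lc 0 \<eta>) n x))"
        using s1 by (simp add: ln_powr mult.commute)
    qed
    moreover have "E (\<lambda>x. ln s * (\<Sum>t<n. step (x (int t)))) = ln s * (real n * (2 * p - 1))"
      by (simp add: E_cmult E_sum[OF step_fd] E_step)
    ultimately show "real n * ((2 * p - 1) * ln s) \<le> c.mlog n" by (simp add: algebra_simps)
  qed
qed

end

section \<open>Choice of the parameters\<close>

lemma n_pow_tendsto_0:
  assumes "0 < (c :: real)" "c < 1" shows "(\<lambda>m. real m * c ^ m) \<longlonglongrightarrow> 0"
  using powser_times_n_limit_0[of c] assms by simp

lemma n2_pow_tendsto_0:
  assumes "0 < (c :: real)" "c < 1" shows "(\<lambda>m. (real m)\<^sup>2 * c ^ m) \<longlonglongrightarrow> 0"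
proof -
  have "(\<lambda>m. (real m * (sqrt c) ^ m)\<^sup>2) \<longlonglongrightarrow> 0\<^sup>2"
    by (intro tendsto_power n_pow_tendsto_0) (use assms in auto)
  moreover have "(real m * (sqrt c) ^ m)\<^sup>2 = (real m)\<^sup>2 * c ^ m" for m
  proof -
    have "((sqrt c) ^ m)\<^sup>2 = ((sqrt c)\<^sup>2) ^ m" by (simp only: power_mult[symmetric] mult.commute)
    then show ?thesis using assms by (simp add: power_mult_distrib)
  qed
  ultimately show ?thesis by simp
qed

lemma exp_neg_tendsto_0:
  assumes "(a :: real) < 0" shows "(\<lambda>m. k * exp (a * real m)) \<longlonglongrightarrow> 0"
proof -
  have "(\<lambda>m. k * exp a ^ m) \<longlonglongrightarrow> k * 0"
    by (intro tendsto_mult tendsto_const LIMSEQ_power_zero) (use assms in auto)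
  then show ?thesis by (simp add: exp_of_nat_mult[symmetric] mult.commute)
qed

text \<open>The logarithmic derivative of the Chernoff factor at \<open>z = 1\<close> is \<open>2p - 1 - \<gamma> > 0\<close>.\<close>

lemma chernoff_factor:
  assumes "\<gamma> < 2 * p - (1 :: real)"
  shows "\<exists>z. 0 < z \<and> z < 1 \<and> z powr (- \<gamma>) * (p * z + (1 - p) / z) < 1"
proof -
  define f where "f u = exp (\<gamma> * u) * (p * exp (- u) + (1 - p) * exp u)" for u
  have "(f has_real_derivative (\<gamma> - (2 * p - 1))) (at 0)"
    unfolding f_def by (auto intro!: derivative_eq_intros)
  from DERIV_neg_dec_right[OF this] assms obtain e where e: "e > 0" "\<And>h. 0 < h \<Longrightarrow> h < e \<Longrightarrow> f h < f 0"
    by auto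
  have "f (e / 2) < 1" using e(2)[of "e/2"] e(1) by (simp add: f_def)
  moreover have "exp (- (e/2)) powr (- \<gamma>) = exp (\<gamma> * (e/2))" by (simp add: powr_def)
  moreover have "(1 - p) / exp (- (e/2)) = (1 - p) * exp (e/2)" by (simp add: exp_minus field_simps)
  ultimately show ?thesis using e(1)
    by (intro exI[of _ "exp (- (e/2))"]) (simp add: f_def)
qed

context pconstr
begin

lemma mlog_cont_noise:
  assumes "coc.mlog p (Lc 1 0) n < c"
  shows "\<exists>e>0. \<forall>\<eta>. 0 \<le> \<eta> \<longrightarrow> \<eta> \<le> 1 \<longrightarrow> \<eta> < e \<longrightarrow> coc.mlog p (Lc 1 \<eta>) n < c"
proof -
  \<comment> \<open>Clamping lets \<open>coc_Lc\<close> apply to every real argument of the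
    continuous function.\<close>
  let ?c = "\<lambda>\<eta>::real. max 0 (min 1 \<eta>)"
  have coc: "coc p (Lc 1 (?c \<eta>)) KL CL" for \<eta> by (rule coc_Lc) auto
  define F where "F \<eta> x = ln (opnorm (cocycle_pow (Lc 1 (?c \<eta>)) n x))" for \<eta> x
  have EF: "E (F \<eta>) = coc.mlog p (Lc 1 (?c \<eta>)) n" for \<eta>
    by (simp add: F_def[abs_def] coc.mlog_def[OF coc])
  have "continuous_on UNIV (\<lambda>\<eta>. E (F \<eta>))"
  proof (rule E_cont)
    show "fdep {- int KL..<int n + int KL} (F \<eta>)" for \<eta>
      unfolding F_def by (rule fdep_comp[OF coc.cp_dep[OF coc]])
    show "continuous_on UNIV (\<lambda>\<eta>. F \<eta> x)" for x
      unfolding F_def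
    proof (intro continuous_on_ln continuous_opnorm continuous_cp ballI)
      show "continuous_on UNIV (\<lambda>\<eta>. Lc 1 (?c \<eta>) x)" for x
        by (rule continuous_on_compose2[OF Lc_cont(2)[of UNIV]]) (auto intro!: continuous_intros)
      show "opnorm (cocycle_pow (Lc 1 (?c \<eta>)) n x) \<noteq> 0" for \<eta>
        using coc.cp_ge1[OF coc, of \<eta> n x] by auto
    qed
  qed simp
  then have "isCont (\<lambda>\<eta>. E (F \<eta>)) 0" by (simp add: continuous_on_eq_continuous_at)
  then have "((\<lambda>\<eta>. E (F \<eta>)) \<longlongrightarrow> E (F 0)) (at 0)" by (simp add: isCont_def)
  moreover have "E (F 0) < c" using assms by (simp add: EF)
  ultimately have "eventually (\<lambda>\<eta>. E (F \<eta>) < c) (at 0)" by (rule order_tendstoD)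
  then obtain e where e: "e > 0" "\<And>\<eta>. \<eta> \<noteq> 0 \<Longrightarrow> \<bar>\<eta>\<bar> < e \<Longrightarrow> E (F \<eta>) < c"
    by (auto simp: eventually_at dist_real_def)
  show ?thesis
  proof (intro exI[of _ e] conjI allI impI e(1))
    fix \<eta> :: real assume \<eta>: "0 \<le> \<eta>" "\<eta> \<le> 1" "\<eta> < e"
    then have "?c \<eta> = \<eta>" by auto
    moreover have "E (F \<eta>) < c" using e(2)[of \<eta>] \<eta> \<open>E (F 0) < c\<close> by (cases "\<eta> = 0") auto
    ultimately show "coc.mlog p (Lc 1 \<eta>) n < c" using EF[of \<eta>] by simp
  qed
qed

lemma lyap_ivt:
  assumes \<eta>: "0 < \<eta>" "\<eta> \<le> 1"
    and lo: "lyap (Lc 1 \<eta>) (mu p) \<le> \<kappa>" and hi: "\<kappa> \<le> (2 * p - 1) * ln s"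
  shows "\<exists>t. 0 \<le> t \<and> t \<le> 1 \<and> lyap (Lc t \<eta>) (mu p) = \<kappa>"
proof -
  have coc: "coc p (Lc t \<eta>) KL CL" if "t \<in> {0..1}" for t by (rule coc_Lc) (use that \<eta> in auto)
  have "continuous_on {0..1} (\<lambda>t. lyap (Lc t \<eta>) (mu p))"
  proof (rule lyap_continuous[OF coc Lc_cont(1)])
    fix t :: real assume t: "t \<in> {0..1}"
    interpret c: coc p "Lc t \<eta>" KL CL by (rule coc[OF t])
    have n0: "1 + \<eta>\<^sup>2 \<noteq> 0" by (smt (verit) zero_le_power2)
    \<comment> \<open>Positivity of the noise enters here: for \<eta> = 0 the off-diagonal entries
      vanish and directions need not spread.\<close>
    interpret pl: plain p "Lc t \<eta>" KL CL s "1 / s" "\<eta> / s" "s * \<eta>" "s * (1 + \<eta>\<^sup>2)"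
      by unfold_locales (use s1 \<eta> n0 Lc_plain in auto)
    show "c.spread" by (rule pl.spread)
  qed
  from IVT2'[OF _ _ _ this, of \<kappa>] show ?thesis
    using lyap_lower[of \<eta>] \<eta> lo hi by force
qed

text \<open>In time \<open>n \<approx> m / q\<close> the axes are swapped many times, while a bad event remains unlikely.\<close>

lemma lyap_small:
  assumes qd: "q * real d \<le> 3 / 10" and e: "0 < e" and z: "0 < z" "z < 1" and m: "1 \<le> real m"
    and \<theta>: "\<theta> = z powr (- \<gamma>) * (p * z + (1 - p) / z)" "0 \<le> \<theta>"
    and B: "ln 2 / real m + ln s * ((11 / real m + 16 * (q * (real d)\<^sup>2)) / (2 * e)) + ln s * e / 2
      + ln CL * ((2 * real T + 1) * qc + 2 * real m / q * \<theta> ^ T + 2 * real m * real T * qc) < \<kappa>"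
  shows "\<exists>n\<ge>1. coc.mlog p (Lc 1 0) n / real n < \<kappa>"
proof -
  have q: "0 < q" "q \<le> 1" "0 < qc" by (rule q_pos)+
  interpret c: coc p "Lc 1 0" KL CL by (rule coc_Lc) auto
  have lnC: "0 \<le> ln CL" and lns: "0 \<le> ln s" using c.C1 s1 by auto
  define n where "n = nat \<lceil>real m / q\<rceil>"
  have mq: "real m \<le> real m / q" using q m by (simp add: field_simps mult_left_le_one_le)
  have n_ge: "real m / q \<le> real n" unfolding n_def by linarith
  have n_le: "real n \<le> 2 * real m / q"
  proof -
    have "real n \<le> real m / q + 1" unfolding n_def using mq m by linarith
    also have "\<dots> \<le> 2 * real m / q" using mq m by simp
    finally show ?thesis .
  qed
  have n1: "1 \<le> n" using n_ge mq m by linarith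
  have n0: "0 < real n" using n1 by simp
  have inv: "1 / real n \<le> q / real m"
    using n_ge q m n0 by (simp add: field_simps)
  let ?W = "3 + 8 / q + q * (12 * (real d)\<^sup>2 * real n + 4 * (real d)\<^sup>2)"
  let ?P = "(2 * real T + 1) * qc + real n * \<theta> ^ T + real n * real T * (q * qc)"
  have "c.mlog n \<le> ln 2 + ln s * (?W / (2 * e) + real n * e / 2) + real n * ln CL * ?P"
    using mlog_upper[OF qd n1 e z] unfolding \<theta>(1) .
  then have "c.mlog n / real n \<le> (ln 2 + ln s * (?W / (2 * e) + real n * e / 2) + real n * ln CL * ?P) / real n"
    using n0 by (intro divide_right_mono) auto
  also have "\<dots> = ln 2 * (1 / real n) + ln s * (?W * (1 / real n) / (2 * e)) + ln s * e / 2 + ln CL * ?P"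
    using n0 e by (simp add: field_simps)
  also have "\<dots> \<le> ln 2 / real m + ln s * ((11 / real m + 16 * (q * (real d)\<^sup>2)) / (2 * e)) + ln s * e / 2
      + ln CL * ((2 * real T + 1) * qc + 2 * real m / q * \<theta> ^ T + 2 * real m * real T * qc)"
  proof (intro add_mono mult_left_mono divide_right_mono order_refl)
    have "q / real m \<le> 1 / real m" using q by (intro divide_right_mono) auto
    then have "1 / real n \<le> 1 / real m" using inv by linarith
    then have "ln 2 * (1 / real n) \<le> ln 2 * (1 / real m)" by (intro mult_left_mono) auto
    then show "ln 2 * (1 / real n) \<le> ln 2 / real m" by simp
    have "(3 + 8 / q) * (1 / real n) \<le> (3 + 8 / q) * (q / real m)"
      using inv q by (intro mult_left_mono) auto
    also have "\<dots> = (3 + 8 / q) * q / real m" by simp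
    also have "(3 + 8 / q) * q = 3 * q + 8" using q by (simp add: distrib_right)
    also have "(3 * q + 8) / real m \<le> 11 / real m" using q m by (intro divide_right_mono) auto
    finally have 1: "(3 + 8 / q) * (1 / real n) \<le> 11 / real m" .
    have "q * (12 * (real d)\<^sup>2 * real n + 4 * (real d)\<^sup>2) \<le> q * (12 * (real d)\<^sup>2 * real n + 4 * (real d)\<^sup>2 * real n)"
      using q n1 by (intro mult_left_mono add_left_mono) (auto simp: mult_le_cancel_left1)
    then have "q * (12 * (real d)\<^sup>2 * real n + 4 * (real d)\<^sup>2) * (1 / real n) \<le>
        q * (12 * (real d)\<^sup>2 * real n + 4 * (real d)\<^sup>2 * real n) * (1 / real n)"
      by (rule mult_right_mono) simp
    also have "\<dots> = 16 * (q * (real d)\<^sup>2)" using n0 by (simp add: field_simps)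
    finally have 2: "q * (12 * (real d)\<^sup>2 * real n + 4 * (real d)\<^sup>2) * (1 / real n) \<le> 16 * (q * (real d)\<^sup>2)" .
    show "?W * (1 / real n) \<le> 11 / real m + 16 * (q * (real d)\<^sup>2)"
      using 1 2 by (simp only: distrib_right)
    show "real n * \<theta> ^ T \<le> 2 * real m / q * \<theta> ^ T" using n_le \<theta>(2) by (intro mult_right_mono) auto
    have "real n * q \<le> 2 * real m" using n_le q by (simp add: field_simps)
    then have "(real n * q) * (real T * qc) \<le> (2 * real m) * (real T * qc)" using q by (intro mult_right_mono) auto
    then show "real n * real T * (q * qc) \<le> 2 * real m * real T * qc" by (simp add: algebra_simps)
  qed (use lns lnC e in auto)
  also have "\<dots> < \<kappa>" by (rule B)
  finally show ?thesis using n1 by blast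
qed

end

section \<open>Distances in the Hoelder norm and final choice of constants\<close>

lemma A_sig_hsm: assumes "1 < \<sigma>" "\<alpha> > 0" shows "hsm \<alpha> (4 * \<sigma>) (A_sig \<sigma>)"
proof -
  have "fdep {- int 0..int 0} (A_sig \<sigma>)" by (rule fdepI) (auto simp: A_sig_def)
  moreover have "opnorm (A_sig \<sigma> x) \<le> 2 * \<sigma>" for x
  proof -
    have "1 / \<sigma> \<le> \<sigma>" using assms by (simp add: field_simps) (smt (verit) mult_less_cancel_right2)
    then show ?thesis using opnorm_mk2_le[of \<sigma> 0 0 "1/\<sigma>"] opnorm_mk2_le[of "1/\<sigma>" 0 0 \<sigma>] assms
      by (auto simp: A_sig_def diag2_mk2)
  qed
  ultimately show ?thesis using hsm_local[OF assms(2), of 0 "A_sig \<sigma>" "2 * \<sigma>"] by simp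
qed

lemma A_sig_hsm_diff:
  assumes "1 < \<sigma>" "\<sigma> \<le> s" "\<alpha> > 0" shows "hsm \<alpha> (4 * (s - \<sigma>)) (\<lambda>x. A_sig s x - A_sig \<sigma> x)"
proof -
  have "fdep {- int 0..int 0} (\<lambda>x. A_sig s x - A_sig \<sigma> x)" by (rule fdepI) (auto simp: A_sig_def)
  moreover have "opnorm (A_sig s x - A_sig \<sigma> x) \<le> 2 * (s - \<sigma>)" for x
  proof -
    have "1 / \<sigma> - 1 / s = (s - \<sigma>) / (s * \<sigma>)" using assms by (simp add: field_simps)
    also have "\<dots> \<le> (s - \<sigma>) / 1"
    proof (rule divide_left_mono)
      show "1 \<le> s * \<sigma>" using assms mult_mono[of 1 s 1 \<sigma>] by simp
    qed (use assms in auto)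
    finally have "\<bar>1 / s - 1 / \<sigma>\<bar> \<le> s - \<sigma>" using assms by (simp add: frac_le)
    then show ?thesis
      using opnorm_mk2_le[of "s - \<sigma>" 0 0 "1/s - 1/\<sigma>"] opnorm_mk2_le[of "1/s - 1/\<sigma>" 0 0 "s - \<sigma>"] assms
      by (auto simp: A_sig_def diag2_mk2 mk2_diff)
  qed
  ultimately show ?thesis using hsm_local[OF assms(3), of 0 "\<lambda>x. A_sig s x - A_sig \<sigma> x" "2 * (s - \<sigma>)"] by simp
qed

text \<open>All lengths are multiples of \<open>m\<close>: the long marker has length (r+1)m and the
  delay is cm. Every error term then tends to 0 as \<open>m\<close> grows.\<close>

lemma (in bern) parameters:
  fixes s \<alpha> \<kappa> \<epsilon> :: real
  assumes s: "1 < s" and \<alpha>: "0 < \<alpha>" and p: "1 / 2 < p"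
    and st: "\<alpha> * ln 2 < 2 * (2 * p - 1) * ln s" and \<kappa>: "0 < \<kappa>" and \<epsilon>: "0 < \<epsilon>"
  shows "\<exists>\<gamma> m d T. pconstr p s \<gamma> m d T \<and>
     2 * s powr (- 2 * real m) * 2 powr (\<alpha> * real m) \<le> \<epsilon> \<and>
     2 * s powr (- 2 * \<gamma> * real T) * 2 powr (\<alpha> * real (T + 1)) \<le> \<epsilon> \<and>
     2 * s powr (- 2 * (real d - real m)) * 2 powr (\<alpha> * real (d + 1)) \<le> \<epsilon> \<and>
     (\<exists>n\<ge>1. coc.mlog p (constr.Lc s \<gamma> m d T 1 0) n / real n < \<kappa>)"
proof -
  have ls: "0 < ln s" using s by simp
  have l2: "0 < ln (2::real)" by simp
  \<comment> \<open>Midpoint between the rate at which the second shear becomes affordable in the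
    Hoelder norm and the drift 2p - 1 of \<open>height\<close>.\<close>
  define \<gamma> where "\<gamma> = (\<alpha> * ln 2 / (2 * ln s) + (2 * p - 1)) / 2"
  have g0: "\<alpha> * ln 2 / (2 * ln s) < 2 * p - 1" using st ls by (simp add: field_simps)
  have g1: "0 < \<alpha> * ln 2 / (2 * ln s)" using \<alpha> ls by simp
  have \<gamma>: "0 < \<gamma>" "\<gamma> < 2 * p - 1" "\<alpha> * ln 2 / (2 * ln s) < \<gamma>"
    using g0 g1 by (auto simp: \<gamma>_def)
  have \<gamma>s: "\<alpha> * ln 2 - 2 * \<gamma> * ln s < 0" using \<gamma>(3) ls by (simp add: field_simps)
  have s2: "\<alpha> * ln 2 - 2 * ln s < 0"
  proof -
    have "2 * (2 * p - 1) * ln s \<le> 2 * 1 * ln s" using p1 ls by (intro mult_right_mono mult_left_mono) auto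
    then show ?thesis using st by simp
  qed
  \<comment> \<open>For large \<open>r\<close> the upper shear, of size s^(-2rm), pays for its
    window of about (r+1)m symbols.\<close>
  obtain r0 :: nat where r0: "real r0 > \<alpha> * ln 2 / (2 * ln s - \<alpha> * ln 2)" using reals_Archimedean2 by blast
  define r where "r = r0 + 1"
  have r1: "1 \<le> r" by (simp add: r_def)
  have rs: "\<alpha> * (real r + 1) * ln 2 - 2 * real r * ln s < 0"
  proof -
    have "real r > \<alpha> * ln 2 / (2 * ln s - \<alpha> * ln 2)" using r0 by (simp add: r_def)
    then have "\<alpha> * ln 2 < real r * (2 * ln s - \<alpha> * ln 2)" using s2 by (simp add: pos_divide_less_eq)
    then show ?thesis by (simp add: algebra_simps)
  qed
  obtain z where z: "0 < z" "z < 1" "z powr (- \<gamma>) * (p * z + (1 - p) / z) < 1"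
    using chernoff_factor[OF \<gamma>(2)] by blast
  define \<theta> where "\<theta> = z powr (- \<gamma>) * (p * z + (1 - p) / z)"
  have \<theta>: "0 < \<theta>" "\<theta> < 1" using z p0 p1 by (auto simp: \<theta>_def intro!: mult_pos_pos add_pos_pos)
  define x where "x = 1 - p"
  have x: "0 < x" "x < 1" using p0 p1 by (auto simp: x_def)
  have xr: "0 < x ^ (r + 1)" "x ^ (r + 1) < 1" using x power_Suc_less_one[of x r] by auto
  have "(\<lambda>c. \<theta> ^ c) \<longlonglongrightarrow> 0" using \<theta> by (intro LIMSEQ_power_zero) auto
  then have "eventually (\<lambda>c. \<theta> ^ c < x ^ (r + 1)) sequentially" by (rule order_tendstoD) (rule xr)
  then obtain c0 where c0: "\<And>c. c \<ge> c0 \<Longrightarrow> \<theta> ^ c < x ^ (r + 1)" by (auto simp: eventually_sequentially)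
  \<comment> \<open>The deviation bound \<theta>^(cm) must beat \<open>Q m\<close>, because the
    orbit is followed for about m / Q m steps. The second entry of the maximum gives
    \<open>d < T\<close>.\<close>
  define c where "c = max c0 (r + 2)"
  have c: "\<theta> ^ c < x ^ (r + 1)" "r + 2 \<le> c" using c0[of c] by (auto simp: c_def)
  define \<omega> where "\<omega> = \<theta> ^ c / x ^ (r + 1)"
  have \<omega>: "0 < \<omega>" "\<omega> < 1" using c xr \<theta> by (auto simp: \<omega>_def)
  \<comment> \<open>Makes the non-vanishing term \<open>ln s * e / 2\<close> equal to
    \<open>\<kappa> / 2\<close>; all others are collected in \<open>B\<close>.\<close>
  define e where "e = \<kappa> / ln s"
  have e: "0 < e" using \<kappa> ls by (simp add: e_def)
  define CC where "CC = ln (constr.CL s)"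
  define Q where "Q m = p * (x ^ (r + 1)) ^ m" for m :: nat
  define B where "B m = ln 2 / real m + ln s * ((11 / real m + 16 * (Q m * (real ((r + 1) * m))\<^sup>2)) / (2 * e))
      + CC * ((2 * real (c * m) + 1) * (p * x ^ m) + 2 * real m / Q m * \<theta> ^ (c * m) + 2 * real m * real (c * m) * (p * x ^ m))" for m :: nat
  have inv: "(\<lambda>m. a / real m) \<longlonglongrightarrow> 0" for a by (rule lim_const_over_n)
  have xm: "(\<lambda>m. x ^ m) \<longlonglongrightarrow> 0" using x by (intro LIMSEQ_power_zero) auto
  have B: "B \<longlonglongrightarrow> 0"
  proof -
    have b: "B m = ln 2 / real m + ln s * ((11 / real m + 16 * p * (real (r + 1))\<^sup>2 * ((real m)\<^sup>2 * (x ^ (r + 1)) ^ m)) / (2 * e))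
      + CC * (2 * real c * p * (real m * x ^ m) + p * x ^ m + 2 / p * (real m * \<omega> ^ m) + 2 * real c * p * ((real m)\<^sup>2 * x ^ m))" for m
    proof -
      have "2 * real m / Q m * \<theta> ^ (c * m) = 2 / p * (real m * \<omega> ^ m)"
        using p0 x by (simp add: Q_def \<omega>_def power_divide power_mult)
      moreover have "Q m * (real ((r + 1) * m))\<^sup>2 = p * (real (r + 1))\<^sup>2 * ((real m)\<^sup>2 * (x ^ (r + 1)) ^ m)"
        by (simp only: Q_def of_nat_mult power_mult_distrib mult_ac)
      moreover have "(2 * real (c * m) + 1) * (p * x ^ m) = 2 * real c * p * (real m * x ^ m) + p * x ^ m"
        by (simp add: algebra_simps)
      moreover have "2 * real m * real (c * m) * (p * x ^ m) = 2 * real c * p * ((real m)\<^sup>2 * x ^ m)"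
        by (simp add: power2_eq_square)
      ultimately show ?thesis unfolding B_def by (simp only: mult.assoc)
    qed
    have "(\<lambda>m. ln 2 / real m + ln s * ((11 / real m + 16 * p * (real (r + 1))\<^sup>2 * ((real m)\<^sup>2 * (x ^ (r + 1)) ^ m)) / (2 * e))
      + CC * (2 * real c * p * (real m * x ^ m) + p * x ^ m + 2 / p * (real m * \<omega> ^ m) + 2 * real c * p * ((real m)\<^sup>2 * x ^ m)))
      \<longlonglongrightarrow> 0 + ln s * ((0 + 16 * p * (real (r + 1))\<^sup>2 * 0) / (2 * e)) + CC * (2 * real c * p * 0 + p * 0 + 2 / p * 0 + 2 * real c * p * 0)"
      by (intro tendsto_intros inv xm n_pow_tendsto_0 n2_pow_tendsto_0 xr x \<omega>) (use e in simp)
    then show ?thesis unfolding b[abs_def] by simp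
  qed
  define H1 where "H1 m = 2 * s powr (- 2 * real m) * 2 powr (\<alpha> * real m)" for m :: nat
  define H2 where "H2 m = 2 * s powr (- 2 * \<gamma> * real (c * m)) * 2 powr (\<alpha> * real (c * m + 1))" for m
  define H3 where "H3 m = 2 * s powr (- 2 * (real ((r + 1) * m) - real m)) * 2 powr (\<alpha> * real ((r + 1) * m + 1))" for m
  have pw: "s powr u = exp (u * ln s)" "2 powr u = exp (u * ln 2)" for u using s by (simp_all add: powr_def)
  have "eventually (\<lambda>m. B m < \<kappa> / 2) sequentially" using B by (rule order_tendstoD) (use \<kappa> in simp)
  moreover have "eventually (\<lambda>m. H1 m < \<epsilon>) sequentially"
  proof (rule order_tendstoD(2)[OF _ \<epsilon>])
    have "H1 m = 2 * exp ((\<alpha> * ln 2 - 2 * ln s) * real m)" for m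
      by (simp add: H1_def pw mult.assoc algebra_simps flip: exp_add)
    then show "H1 \<longlonglongrightarrow> 0" using exp_neg_tendsto_0[OF s2, of 2] by presburger
  qed
  moreover have "eventually (\<lambda>m. H2 m < \<epsilon>) sequentially"
  proof (rule order_tendstoD(2)[OF _ \<epsilon>])
    let ?a = "real c * (\<alpha> * ln 2 - 2 * \<gamma> * ln s)"
    have "H2 m = 2 * exp (\<alpha> * ln 2) * exp (?a * real m)" for m
      by (simp add: H2_def pw mult.assoc algebra_simps flip: exp_add)
    moreover have "?a < 0" using \<gamma>s c by (intro mult_pos_neg) auto
    ultimately show "H2 \<longlonglongrightarrow> 0" using exp_neg_tendsto_0[of ?a "2 * exp (\<alpha> * ln 2)"] by presburger
  qed
  moreover have "eventually (\<lambda>m. H3 m < \<epsilon>) sequentially"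
  proof (rule order_tendstoD(2)[OF _ \<epsilon>])
    have "H3 m = 2 * exp (\<alpha> * ln 2) * exp ((\<alpha> * (real r + 1) * ln 2 - 2 * real r * ln s) * real m)" for m
      by (simp add: H3_def pw mult.assoc algebra_simps flip: exp_add)
    then show "H3 \<longlonglongrightarrow> 0" using exp_neg_tendsto_0[OF rs, of "2 * exp (\<alpha> * ln 2)"] by presburger
  qed
  moreover have "eventually (\<lambda>m. Q m * real ((r + 1) * m) < 3 / 10) sequentially"
  proof (rule order_tendstoD(2))
    have "(\<lambda>m. p * real (r + 1) * (real m * (x ^ (r + 1)) ^ m)) \<longlonglongrightarrow> p * real (r + 1) * 0"
      by (intro tendsto_intros n_pow_tendsto_0 xr)
    moreover have "p * real (r + 1) * (real m * (x ^ (r + 1)) ^ m) = Q m * real ((r + 1) * m)" for m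
      by (simp only: Q_def of_nat_mult mult_ac)
    ultimately show "(\<lambda>m. Q m * real ((r + 1) * m)) \<longlonglongrightarrow> 0" by simp
  qed simp
  moreover have "eventually (\<lambda>m::nat. 2 \<le> m) sequentially" by (rule eventually_ge_at_top)
  ultimately have "eventually (\<lambda>m. B m < \<kappa> / 2 \<and> H1 m < \<epsilon> \<and> H2 m < \<epsilon> \<and> H3 m < \<epsilon> \<and>
      Q m * real ((r + 1) * m) < 3 / 10 \<and> 2 \<le> m) sequentially"
    by (intro eventually_conj)
  then obtain m where m: "B m < \<kappa> / 2" "H1 m < \<epsilon>" "H2 m < \<epsilon>" "H3 m < \<epsilon>" "Q m * real ((r + 1) * m) < 3 / 10" "2 \<le> m"
    unfolding eventually_sequentially by blast
  define d where "d = (r + 1) * m"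
  define T where "T = c * m"
  have "m < d" using r1 m(6) by (simp add: d_def)
  moreover have "d < T"
    unfolding d_def T_def using c(2) m(6) by (intro mult_strict_right_mono) auto
  ultimately interpret pc: pconstr p s \<gamma> m d T
    using s m(6) \<gamma> by unfold_locales auto
  have q: "pc.q = Q m" unfolding pc.q_def by (simp only: Q_def x_def d_def power_mult)
  have qc: "pc.qc = p * x ^ m" by (simp add: pc.qc_def x_def)
  have "\<exists>n\<ge>1. coc.mlog p (pc.Lc 1 0) n / real n < \<kappa>"
  proof (rule pc.lyap_small[where \<theta> = \<theta> and e = e and z = z])
    show "pc.q * real d \<le> 3 / 10" using m(5) unfolding q by (simp add: d_def)
    have "ln s * e / 2 = \<kappa> / 2" using ls by (simp add: e_def)
    then show "ln 2 / real m + ln s * ((11 / real m + 16 * (pc.q * (real d)\<^sup>2)) / (2 * e)) + ln s * e / 2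
      + ln pc.CL * ((2 * real T + 1) * pc.qc + 2 * real m / pc.q * \<theta> ^ T + 2 * real m * real T * pc.qc) < \<kappa>"
      using m(1) unfolding q qc unfolding B_def CC_def d_def T_def by linarith
  qed (use e z \<theta> m(6) \<theta>_def in auto)
  moreover have "pconstr p s \<gamma> m d T" by unfold_locales
  ultimately show ?thesis
    using less_imp_le[OF m(2)] less_imp_le[OF m(3)] less_imp_le[OF m(4)]
    unfolding H1_def H2_def H3_def unfolding d_def[symmetric] T_def[symmetric] by blast
qed

lemma (in bern) exists_cocycle:
  fixes \<alpha> \<sigma> \<kappa> \<delta> :: real
  assumes \<alpha>: "0 < \<alpha>" and p: "1 / 2 < p" and \<sigma>: "1 < \<sigma>" and h: "2 powr \<alpha> \<le> \<sigma> powr (4 * p - 2)"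
    and \<kappa>: "0 < \<kappa>" "\<kappa> \<le> (2 * p - 1) * ln \<sigma>" and \<delta>: "0 < \<delta>"
  shows "\<exists>L\<in>C_alpha \<alpha>. locally_constant L \<and> holder_norm \<alpha> (\<lambda>x. L x - A_sig \<sigma> x) < \<delta> \<and> lyap L (mu p) = \<kappa>"
proof -
  define a where "a = 4 * \<sigma>"
  define \<epsilon>0 where "\<epsilon>0 = min 1 (\<delta> / 4)"
  have \<epsilon>0: "0 < \<epsilon>0" "\<epsilon>0 \<le> 1" "2 * \<epsilon>0 < \<delta>" using \<delta> by (auto simp: \<epsilon>0_def)
  \<comment> \<open>Strictly above \<open>\<sigma>\<close>, which makes the threshold
    \<open>st\<close> strict even when the hypothesis is an equality. The change of the diagonal
    part uses half of \<open>\<epsilon>0\<close>; the four remaining factors, each bounded by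
    \<open>h0\<close>, share the other half.\<close>
  define s where "s = \<sigma> + \<epsilon>0 / 8"
  have s: "1 < s" "\<sigma> < s" using \<sigma> \<epsilon>0 by (auto simp: s_def)
  have lss: "ln \<sigma> < ln s" using s \<sigma> by simp
  have st: "\<alpha> * ln 2 < 2 * (2 * p - 1) * ln s"
  proof -
    have "ln (2 powr \<alpha>) \<le> ln (\<sigma> powr (4 * p - 2))" using h by (intro ln_mono) auto
    then have "\<alpha> * ln 2 \<le> (4 * p - 2) * ln \<sigma>" using \<sigma> by (simp add: ln_powr)
    also have "\<dots> < (4 * p - 2) * ln s" using lss p by (intro mult_strict_left_mono) auto
    finally show ?thesis by (simp add: algebra_simps)
  qed
  define h0 where "h0 = \<epsilon>0 / (16 * (a + 1))"
  have a0: "0 < a" using \<sigma> by (simp add: a_def)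
  have h0: "0 < h0" using \<epsilon>0 a0 by (simp add: h0_def)
  obtain \<gamma> m d T n where pc: "pconstr p s \<gamma> m d T"
    and h1: "2 * s powr (- 2 * real m) * 2 powr (\<alpha> * real m) \<le> h0"
    and h2: "2 * s powr (- 2 * \<gamma> * real T) * 2 powr (\<alpha> * real (T + 1)) \<le> h0"
    and h3: "2 * s powr (- 2 * (real d - real m)) * 2 powr (\<alpha> * real (d + 1)) \<le> h0"
    and n: "1 \<le> n" "coc.mlog p (constr.Lc s \<gamma> m d T 1 0) n / real n < \<kappa>"
    using parameters[OF s(1) \<alpha> p st \<kappa>(1) h0] by blast
  interpret pc: pconstr p s \<gamma> m d T by (rule pc)
  \<comment> \<open>The upper bound at the fixed time \<open>n\<close> was obtained without noise.
    It survives small noise, so \<open>\<eta>\<close> is chosen after all other constants.\<close>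
  have "coc.mlog p (pc.Lc 1 0) n < \<kappa> * real n" using n by (simp add: pos_divide_less_eq)
  from pc.mlog_cont_noise[OF this] obtain e where e: "0 < e"
    "\<And>\<eta>. 0 \<le> \<eta> \<Longrightarrow> \<eta> \<le> 1 \<Longrightarrow> \<eta> < e \<Longrightarrow> coc.mlog p (pc.Lc 1 \<eta>) n < \<kappa> * real n" by blast
  define \<eta> where "\<eta> = min 1 (min (e / 2) (h0 / 6))"
  have \<eta>: "0 < \<eta>" "\<eta> \<le> 1" "\<eta> < e" "6 * \<eta> \<le> h0" using e(1) h0 by (auto simp: \<eta>_def)
  have lo: "lyap (pc.Lc 1 \<eta>) (mu p) \<le> \<kappa>"
  proof -
    have "lyap (pc.Lc 1 \<eta>) (mu p) \<le> coc.mlog p (pc.Lc 1 \<eta>) n / real n"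
      by (rule coc.lyap_le[OF pc.coc_Lc n(1)]) (use \<eta> in auto)
    also have "\<dots> \<le> \<kappa>" using e(2)[of \<eta>] \<eta> n(1) by (simp add: pos_divide_le_eq)
    finally show ?thesis .
  qed
  have hi: "\<kappa> \<le> (2 * p - 1) * ln s"
    by (rule order_trans[OF \<kappa>(2) mult_left_mono]) (use lss p in auto)
  obtain t where t: "0 \<le> t" "t \<le> 1" "lyap (pc.Lc t \<eta>) (mu p) = \<kappa>"
    using pc.lyap_ivt[OF \<eta>(1,2) lo hi] by blast
  let ?L = "pc.Lc t \<eta>"
  have sum: "4 * (s - \<sigma>) + 2 * (a + 1) * (h0 + h0 + h0 + h0) = \<epsilon>0"
  proof -
    have "a + 1 \<noteq> 0" using a0 by simp
    then have "(a + 1) * h0 = \<epsilon>0 / 16" unfolding h0_def by (simp add: divide_simps)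
    then have "2 * (a + 1) * (h0 + h0 + h0 + h0) = \<epsilon>0 / 2" by (simp add: algebra_simps)
    then show ?thesis by (simp add: s_def)
  qed
  note near = pc.Lc_near[OF \<alpha> t(1,2) less_imp_le[OF \<eta>(1)] \<eta>(2) A_sig_hsm[OF \<sigma> \<alpha>, folded a_def]
      A_sig_hsm_diff[OF \<sigma> less_imp_le[OF s(2)] \<alpha>] h1 h2 h3 \<eta>(4), unfolded sum, OF \<epsilon>0(2)]
  have "holder_norm \<alpha> (\<lambda>x. ?L x - A_sig \<sigma> x) < \<delta>"
    using hsm_holder_norm[OF near] \<epsilon>0(3) by linarith
  moreover have "?L \<in> C_alpha \<alpha>"
    using hsm_holder[OF hsm_add[OF near A_sig_hsm[OF \<sigma> \<alpha>]]] pc.Lc_det by (simp add: C_alpha_def)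
  moreover have "locally_constant ?L"
    unfolding locally_constant_def
  proof (intro exI[of _ pc.KL] allI impI)
    fix x y :: sigma assume "\<forall>n. \<bar>n\<bar> \<le> int pc.KL \<longrightarrow> x n = y n"
    then show "?L x = ?L y" by (intro fdepD[OF pc.Lc_dep]) auto
  qed
  ultimately show ?thesis using t(3) by blast
qed

theorem theorem1:
  fixes \<alpha> p \<sigma> :: real
  assumes "\<alpha> > 0" and "1/2 < p" and "p < 1" and "\<sigma> > 1"
    and "\<sigma> powr (4 * p - 2) \<ge> 2 powr \<alpha>"
  shows "(\<forall>U \<kappa>. C_alpha_open \<alpha> U \<and> A_sig \<sigma> \<in> U \<and> 0 < \<kappa> \<and> \<kappa> \<le> (2 * p - 1) * ln \<sigma> \<longrightarrow>
            (\<exists>L\<in>U. locally_constant L \<and> lyap L (mu p) = \<kappa>))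
       \<and> \<not> (\<forall>\<epsilon>>0. \<exists>\<delta>>0. \<forall>B\<in>C_alpha \<alpha>. holder_norm \<alpha> (\<lambda>x. B x - A_sig \<sigma> x) < \<delta> \<longrightarrow>
              \<bar>lyap B (mu p) - lyap (A_sig \<sigma>) (mu p)\<bar> < \<epsilon>)"
proof (intro conjI allI impI notI)
  interpret bern p using assms by unfold_locales auto
  note ex = exists_cocycle[OF assms(1,2,4,5)]
  {
    fix U \<kappa> assume U: "C_alpha_open \<alpha> U \<and> A_sig \<sigma> \<in> U \<and> 0 < \<kappa> \<and> \<kappa> \<le> (2 * p - 1) * ln \<sigma>"
    then obtain \<epsilon> where \<epsilon>: "\<epsilon> > 0"
      "\<And>B. B \<in> C_alpha \<alpha> \<Longrightarrow> holder_norm \<alpha> (\<lambda>x. B x - A_sig \<sigma> x) < \<epsilon> \<Longrightarrow> B \<in> U"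
      unfolding C_alpha_open_def by blast
    show "\<exists>L\<in>U. locally_constant L \<and> lyap L (mu p) = \<kappa>"
      using ex[of \<kappa> \<epsilon>] U \<epsilon> by blast
  }
  assume c: "\<forall>\<epsilon>>0. \<exists>\<delta>>0. \<forall>B\<in>C_alpha \<alpha>. holder_norm \<alpha> (\<lambda>x. B x - A_sig \<sigma> x) < \<delta> \<longrightarrow>
              \<bar>lyap B (mu p) - lyap (A_sig \<sigma>) (mu p)\<bar> < \<epsilon>"
  define M where "M = (2 * p - 1) * ln \<sigma>"
  have M: "M > 0" using assms by (simp add: M_def)
  obtain \<delta> where \<delta>: "\<delta> > 0" "\<And>B. B \<in> C_alpha \<alpha> \<Longrightarrow> holder_norm \<alpha> (\<lambda>x. B x - A_sig \<sigma> x) < \<delta> \<Longrightarrow>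
              \<bar>lyap B (mu p) - lyap (A_sig \<sigma>) (mu p)\<bar> < M / 4"
    using c[rule_format, of "M / 4"] M by auto
  have "\<bar>\<kappa> - lyap (A_sig \<sigma>) (mu p)\<bar> < M / 4" if "0 < \<kappa>" "\<kappa> \<le> M" for \<kappa>
    using ex[of \<kappa> \<delta>] \<delta> that unfolding M_def by blast
  \<comment> \<open>Both \<open>M\<close> and \<open>M / 2\<close> occur arbitrarily close to
    \<open>A_sig \<sigma>\<close>, so continuity fails whatever the exponent of
    \<open>A_sig \<sigma>\<close> itself is.\<close>
  from this[of M] this[of "M / 2"] M
  have "\<bar>M - lyap (A_sig \<sigma>) (mu p)\<bar> < M / 4" "\<bar>M / 2 - lyap (A_sig \<sigma>) (mu p)\<bar> < M / 4" by auto
  then show False by linarith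
qed

end
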